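(* Let $(M,g)$ be a compact connected Riemannian manifold without boundary, let $H:M\to\mathbb{R}$ be smooth, let $\Delta_w=\Delta-\nabla H$ be the associated Witten Laplacian, and let $d\mu=\frac1Z e^{-H(x)}dx$ be the associated probability measure. Let $f_1,\dots,f_k:M\to\mathbb{R}$ be eigenfunctions of $\Delta_w$ with corresponding eigenvalues $-\nu_1,\dots,-\nu_k$ (that is, $\Delta_w f_i=-\nu_i f_i$), orthonormal in $L^2(\mu)$ and satisfying $\int_M f_i\,d\mu=0$ for each $i$. Let $X$ be a random point of $M$ with law $\mu$, and let $W=(f_1(X),\dots,f_k(X))$. Then $$d_W(W,Z)\le\left[\max_{1\le i\le k}\nu_i^{-1}\right]\cdot \mathbb{E}\sqrt{\sum_{i,j=1}^k\Big[\langle\nabla f_i(X),\nabla f_j(X)\rangle-\mathbb{E}\langle\nabla f_i(X),\nabla f_j(X)\rangle\Big]^2}\,,$$ where $Z$ is a standard Gaussian random vector in $\mathbb{R}^k$.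
   Context: $\Delta$ is the Laplace--Beltrami operator of $g$, $dx$ is the Riemannian volume measure, and the normalizing constant in $d\mu=\frac1Z e^{-H(x)}dx$ makes $\mu$ a probability measure. The Witten Laplacian acts by $\Delta_w f=\Delta f-\langle\nabla H,\nabla f\rangle$, where $\nabla$ is the Riemannian gradient and $\langle\cdot,\cdot\rangle$ is the inner product induced by $g$. For random vectors $X,Y$ in $\mathbb{R}^k$, the Wasserstein distance is $d_W(X,Y)=\sup|\mathbb{E}g(X)-\mathbb{E}g(Y)|$, the supremum being over functions $g:\mathbb{R}^k\to\mathbb{R}$ with Lipschitz constant at most $1$. *)

theory Defs
  imports "HOL-Probability.Probability"
begin

section \<open>Functions of class C^n on open sets\<close>

text \<open>Intended for open \<^term>\<open>S\<close>. The derivatives are taken in all directions \<^term>\<open>v\<close>, so each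
  recursion step keeps the type of the function.\<close>

primrec Ck_on :: "nat \<Rightarrow> 'a::real_normed_vector set \<Rightarrow> ('a \<Rightarrow> 'b::real_normed_vector) \<Rightarrow> bool" where
  "Ck_on 0 S f \<longleftrightarrow> continuous_on S f"
| "Ck_on (Suc n) S f \<longleftrightarrow>
     (\<forall>x\<in>S. f differentiable (at x)) \<and> (\<forall>v. Ck_on n S (\<lambda>x. frechet_derivative f (at x) v))"

definition smooth_on :: "'a::real_normed_vector set \<Rightarrow> ('a \<Rightarrow> 'b::real_normed_vector) \<Rightarrow> bool" where
  "smooth_on S f \<longleftrightarrow> (\<forall>n. Ck_on n S f)"

definition partial_deriv :: "'n \<Rightarrow> (real^'n::finite \<Rightarrow> real) \<Rightarrow> real^'n \<Rightarrow> real" where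
  "partial_deriv i u y = frechet_derivative u (at y) (axis i 1)"

section \<open>Smooth manifolds\<close>

text \<open>A chart is a pair of its domain and its coordinate map; the values of the coordinate map
  outside the domain are irrelevant. Charts have open images in \<^typ>\<open>real^'n\<close>, so manifolds have
  no boundary. The point set \<^term>\<open>M\<close> carries the subspace topology of the ambient Hausdorff
  type (a compact \<^term>\<open>M\<close> with an atlas is automatically second countable).\<close>

type_synonym ('a, 'n) chart = "'a set \<times> ('a \<Rightarrow> real^'n)"

abbreviation chart_inv :: "('a, 'n::finite) chart \<Rightarrow> real^'n \<Rightarrow> 'a" where
  "chart_inv c \<equiv> inv_into (fst c) (snd c)"

definition in_coords :: "('a, 'n::finite) chart \<Rightarrow> ('a \<Rightarrow> 'b) \<Rightarrow> real^'n \<Rightarrow> 'b" where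
  "in_coords c f = (\<lambda>y. f (chart_inv c y))"

definition is_chart :: "'a::t2_space set \<Rightarrow> ('a, 'n::finite) chart \<Rightarrow> bool" where
  "is_chart M c \<longleftrightarrow>
     openin (top_of_set M) (fst c) \<and> open (snd c ` fst c) \<and>
     homeomorphism (fst c) (snd c ` fst c) (snd c) (chart_inv c)"

definition smooth_atlas :: "'a::t2_space set \<Rightarrow> ('a, 'n::finite) chart set \<Rightarrow> bool" where
  "smooth_atlas M A \<longleftrightarrow>
     (\<forall>c\<in>A. is_chart M c) \<and> (\<Union>c\<in>A. fst c) = M \<and>
     (\<forall>c\<in>A. \<forall>d\<in>A. smooth_on (snd c ` (fst c \<inter> fst d)) (in_coords c (snd d)))"

definition Ck_on_manifold :: "nat \<Rightarrow> ('a, 'n::finite) chart set \<Rightarrow> ('a \<Rightarrow> real) \<Rightarrow> bool" where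
  "Ck_on_manifold n A f \<longleftrightarrow> (\<forall>c\<in>A. Ck_on n (snd c ` fst c) (in_coords c f))"

definition smooth_on_manifold :: "('a, 'n::finite) chart set \<Rightarrow> ('a \<Rightarrow> real) \<Rightarrow> bool" where
  "smooth_on_manifold A f \<longleftrightarrow> (\<forall>c\<in>A. smooth_on (snd c ` fst c) (in_coords c f))"

section \<open>Riemannian metrics\<close>

text \<open>For \<^term>\<open>p\<close> in the domain of the chart \<^term>\<open>c\<close>, \<^term>\<open>g c p\<close> is the Gram matrix of the inner
  product on the tangent space at \<^term>\<open>p\<close> in the coordinate frame of \<^term>\<open>c\<close>. The last condition is
  the transformation law of a covariant 2-tensor, \<^term>\<open>J\<close> being the Jacobian matrix at \<^term>\<open>p\<close>
  of the transition map from \<^term>\<open>c\<close> to \<^term>\<open>d\<close>.\<close>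

type_synonym ('a, 'n) metric = "('a, 'n) chart \<Rightarrow> 'a \<Rightarrow> real^'n^'n"

definition riemannian_metric :: "('a, 'n::finite) chart set \<Rightarrow> ('a, 'n) metric \<Rightarrow> bool" where
  "riemannian_metric A g \<longleftrightarrow>
     (\<forall>c\<in>A. smooth_on (snd c ` fst c) (in_coords c (g c))) \<and>
     (\<forall>c\<in>A. \<forall>p\<in>fst c. transpose (g c p) = g c p \<and> (\<forall>v. v \<noteq> 0 \<longrightarrow> v \<bullet> (g c p *v v) > 0)) \<and>
     (\<forall>c\<in>A. \<forall>d\<in>A. \<forall>p\<in>fst c \<inter> fst d.
        let J = matrix (frechet_derivative (in_coords c (snd d)) (at (snd c p)))
        in g c p = transpose J ** g d p ** J)"

definition volume_density :: "('a, 'n::finite) metric \<Rightarrow> ('a, 'n) chart \<Rightarrow> 'a \<Rightarrow> real" where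
  "volume_density g c p = sqrt (det (g c p))"

text \<open>The measure \<open>sqrt (det g) dy\<close> of a chart, extended by zero to \<^term>\<open>M\<close>.\<close>

definition chart_volume ::
    "'a::t2_space set \<Rightarrow> ('a, 'n::finite) metric \<Rightarrow> ('a, 'n) chart \<Rightarrow> 'a measure" where
  "chart_volume M g c =
     distr (density (restrict_space lborel (snd c ` fst c))
                    (\<lambda>y. ennreal (in_coords c (volume_density g c) y)))
           (restrict_space borel M) (chart_inv c)"

text \<open>The measures \<^term>\<open>chart_volume M g c\<close> agree on overlaps of charts, so their supremum in the
  lattice of Borel measures on \<^term>\<open>M\<close> is the measure that restricts to \<open>sqrt (det g) dy\<close> in
  every chart. (It is a supremum of measures, not a setwise supremum of their values.)\<close>

definition riemannian_volume ::
    "'a::t2_space set \<Rightarrow> ('a, 'n::finite) chart set \<Rightarrow> ('a, 'n) metric \<Rightarrow> 'a measure" where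
  "riemannian_volume M A g = (SUP c\<in>A. chart_volume M g c)"

section \<open>Gradient, Laplace--Beltrami operator, Witten Laplacian\<close>

text \<open>Vector fields on a chart domain are given by their components in the coordinate frame:
  the gradient has components \<open>g^{ij} d_j f\<close>, and the divergence of \<open>V\<close> is
  \<open>(det g)^{-1/2} d_i ((det g)^{1/2} V^i)\<close>.\<close>

definition gradient ::
    "('a, 'n::finite) metric \<Rightarrow> ('a, 'n) chart \<Rightarrow> ('a \<Rightarrow> real) \<Rightarrow> 'a \<Rightarrow> real^'n" where
  "gradient g c f p = matrix_inv (g c p) *v (\<chi> j. partial_deriv j (in_coords c f) (snd c p))"

definition divergence ::
    "('a, 'n::finite) metric \<Rightarrow> ('a, 'n) chart \<Rightarrow> ('a \<Rightarrow> real^'n) \<Rightarrow> 'a \<Rightarrow> real" where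
  "divergence g c V p =
     (\<Sum>i\<in>UNIV. partial_deriv i (in_coords c (\<lambda>q. volume_density g c q * V q $ i)) (snd c p))
       / volume_density g c p"

text \<open>The following scalars do not depend on the chart around the point in which they are computed.\<close>

definition chart_at :: "('a, 'n::finite) chart set \<Rightarrow> 'a \<Rightarrow> ('a, 'n) chart" where
  "chart_at A p = (SOME c. c \<in> A \<and> p \<in> fst c)"

definition grad_inner ::
    "('a, 'n::finite) chart set \<Rightarrow> ('a, 'n) metric \<Rightarrow> ('a \<Rightarrow> real) \<Rightarrow> ('a \<Rightarrow> real) \<Rightarrow> 'a \<Rightarrow> real" where
  "grad_inner A g f h p =
     (let c = chart_at A p in gradient g c f p \<bullet> (g c p *v gradient g c h p))"

definition laplace_beltrami ::
    "('a, 'n::finite) chart set \<Rightarrow> ('a, 'n) metric \<Rightarrow> ('a \<Rightarrow> real) \<Rightarrow> 'a \<Rightarrow> real" where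
  "laplace_beltrami A g f p = (let c = chart_at A p in divergence g c (gradient g c f) p)"

definition witten_laplacian ::
    "('a, 'n::finite) chart set \<Rightarrow> ('a, 'n) metric \<Rightarrow> ('a \<Rightarrow> real) \<Rightarrow> ('a \<Rightarrow> real) \<Rightarrow> 'a \<Rightarrow> real" where
  "witten_laplacian A g H f p = laplace_beltrami A g f p - grad_inner A g H f p"

definition witten_measure ::
    "'a::t2_space set \<Rightarrow> ('a, 'n::finite) chart set \<Rightarrow> ('a, 'n) metric \<Rightarrow> ('a \<Rightarrow> real) \<Rightarrow> 'a measure" where
  "witten_measure M A g H =
     (let vol = riemannian_volume M A g
      in density vol (\<lambda>x. ennreal (exp (- H x) / (LINT y|vol. exp (- H y)))))"

section \<open>Wasserstein distance and Gaussian vectors\<close>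

text \<open>The supremum is taken in \<^typ>\<open>ereal\<close>, where it is meaningful even if infinite. \<^term>\<open>P\<close> and
  \<^term>\<open>Q\<close> are the probability spaces on which \<^term>\<open>X\<close> and \<^term>\<open>Y\<close> are defined.\<close>

definition wasserstein_dist ::
    "'p measure \<Rightarrow> ('p \<Rightarrow> real^'k::finite) \<Rightarrow> 'q measure \<Rightarrow> ('q \<Rightarrow> real^'k) \<Rightarrow> ereal" where
  "wasserstein_dist P X Q Y =
     (SUP h\<in>{h :: real^'k \<Rightarrow> real. 1-lipschitz_on UNIV h}.
        ereal \<bar>(LINT \<omega>|P. h (X \<omega>)) - (LINT \<omega>|Q. h (Y \<omega>))\<bar>)"

definition std_gaussian_vector :: "'q measure \<Rightarrow> ('q \<Rightarrow> real^'k::finite) \<Rightarrow> bool" where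
  "std_gaussian_vector Q Z \<longleftrightarrow>
     distributed Q lborel Z (\<lambda>z. ennreal (\<Prod>i\<in>UNIV. std_normal_density (z $ i)))"

end

theory Submission
  imports Defs
begin

text \<open>
  Write \<open>W = (f\<^sub>1, ..., f\<^sub>k)\<close> and let \<open>G i j\<close> be the inner product of the gradients of \<open>f i\<close> and \<open>f j\<close>.

  Integration by parts on the manifold says that the integral of \<open>q\<close> times the Witten Laplacian
  of \<open>f\<close> is minus the integral of the inner product of their gradients. For an eigenfunction and a
  function of \<open>W\<close> this becomes a Stein identity: the mean of \<open>\<nu> i * W i * \<phi> W\<close> equals the mean of the sum
  over \<open>j\<close> of \<open>\<partial>\<^sub>j \<phi> W * G i j\<close>. For \<open>\<phi> w = w j\<close> it shows that \<open>G i j\<close> has mean \<open>\<nu> i\<close> if \<open>i = j\<close> and zero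
  otherwise. If \<open>G\<close> were constant, the identity would be the one that characterises the standard
  Gaussian law; so the distance to the Gaussian should be controlled by the fluctuations of \<open>G\<close>.

  To make this quantitative, let \<open>Z\<close> be Gaussian and independent of \<open>W\<close>, and follow a smooth test function
  \<open>u\<close> along \<open>sin t * W + cos t * Z\<close> for \<open>t\<close> from 0 to \<open>pi/2\<close>. Differentiating in \<open>t\<close> and applying the Stein identity
  to \<open>W\<close> brings in second derivatives of \<open>u\<close>. A Gaussian integration by parts in \<open>Z\<close> turns each of them into
  a first derivative times a coordinate of \<open>Z\<close>. The derivative of the mean is then \<open>sin t\<close> times the mean of
  the pairing of the gradient of \<open>u\<close> with \<open>B Z\<close>, where \<open>B i j = (G i j - mean (G i j)) / \<nu> i\<close>. Given \<open>W\<close>, the mean norm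
  of \<open>B Z\<close> is at most the Hilbert--Schmidt norm of \<open>B\<close>, and \<open>sin t\<close> integrates to one
  (\<open>derivative_identity\<close>, \<open>C2_bound\<close>). Since only the Lipschitz constant of \<open>u\<close> enters, the estimate passes from
  mollified test functions to Lipschitz ones (\<open>lipschitz_C2_approximation\<close>, \<open>lipschitz_bound\<close>).

  Integration by parts on the manifold is reduced to the fact that the divergence of a C1 vector field with
  compact support on \<open>\<real>\<^sup>n\<close> integrates to zero. The measures of the charts agree on overlaps by the change of
  variables formula, hence their supremum restricts to each of them (\<open>emeasure_riemannian_volume\<close>), and in every
  chart the Witten Laplacian is the divergence of the gradient for the weighted volume
  (\<open>chart_integration_by_parts\<close>). The inner product of gradients is chart independent by linear algebra.
  The Witten Laplacian is then chart independent because its weak form is (\<open>chart_witten_le\<close>), and a partition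
  of unity gives the global formula (\<open>integration_by_parts\<close>). Connectedness makes the \<open>\<nu> i\<close> positive: an eigenfunction
  with \<open>\<nu> i = 0\<close> has vanishing gradient, so it would be constant (\<open>\<nu>_pos\<close>).\<close>

section \<open>Integrals of directional derivatives\<close>

lemma lborel_integral_translate:
  fixes f :: "'a::euclidean_space \<Rightarrow> real"
  assumes [measurable]: "f \<in> borel_measurable borel"
  shows "(LINT x|lborel. f (x + a)) = (LINT x|lborel. f x)"
    and "integrable lborel (\<lambda>x. f (x + a)) \<longleftrightarrow> integrable lborel f"
proof -
  have "(LINT x|lborel. f x) = (LINT x|distr lborel borel ((+) a). f x)"
    by (simp add: lborel_distr_plus)
  also have "\<dots> = (LINT x|lborel. f (a + x))"
    by (subst integral_distr) auto
  finally show "(LINT x|lborel. f (x + a)) = (LINT x|lborel. f x)"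
    by (simp add: add.commute)
  have "integrable lborel f \<longleftrightarrow> integrable (distr lborel borel ((+) a)) f"
    by (simp add: lborel_distr_plus)
  also have "\<dots> \<longleftrightarrow> integrable lborel (\<lambda>x. f (a + x))"
    by (subst integrable_distr_eq) auto
  finally show "integrable lborel (\<lambda>x. f (x + a)) \<longleftrightarrow> integrable lborel f"
    by (simp add: add.commute)
qed

text \<open>The integral of the increment \<open>u (x + e) - u x\<close> vanishes by translation invariance. Writing the
increment as the integral of the derivative along the segment and exchanging the two integrals
gives the claim. All integrations by parts below come from this fact: the Gaussian one, the one for
convolutions, and the divergence theorem in a chart.\<close>

lemma integral_directional_derivative_eq_0:
  fixes u :: "'a::euclidean_space \<Rightarrow> real"
  assumes der: "\<And>x. (u has_derivative u' x) (at x)"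
    and cont: "continuous_on UNIV (\<lambda>x. u' x e)"
    and int: "integrable lborel u" and int': "integrable lborel (\<lambda>x. u' x e)"
  shows "(LINT x|lborel. u' x e) = 0"
proof -
  let ?K = "\<lambda>s x. u' (x + s *\<^sub>R e) e * indicator {0..1::real} s"
  have contu: "continuous_on UNIV u"
    using der by (auto intro!: continuous_at_imp_continuous_on has_derivative_continuous)
  have [measurable]: "u \<in> borel_measurable borel" "(\<lambda>x. u' x e) \<in> borel_measurable borel"
    using contu cont by (auto intro: borel_measurable_continuous_onI)
  have intK: "integrable (lborel \<Otimes>\<^sub>M lborel) (case_prod ?K)"
  proof (rule lborel_pair.Fubini_integrable)
    have [measurable]: "(\<lambda>(s, x). u' (x + s *\<^sub>R e) e) \<in> borel_measurable (borel \<Otimes>\<^sub>M borel)"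
      by measurable
    show "case_prod ?K \<in> borel_measurable (lborel \<Otimes>\<^sub>M lborel)"
      by measurable
    have "(LINT x|lborel. norm (?K s x)) = (LINT x|lborel. \<bar>u' x e\<bar>) * indicator {0..1} s" for s
      using lborel_integral_translate(1)[of "\<lambda>x. \<bar>u' x e\<bar>" "s *\<^sub>R e"]
      by (simp add: abs_mult)
    then show "integrable lborel (\<lambda>s. LINT x|lborel. norm (case (s, x) of (s, x) \<Rightarrow> ?K s x))"
      by (simp add: integrable_real_indicator)
    show "AE s in lborel. integrable lborel (\<lambda>x. case (s, x) of (s, x) \<Rightarrow> ?K s x)"
      using int' lborel_integral_translate(2)[of "\<lambda>x. u' x e"] by simp
  qed
  have ftc: "(LINT s|lborel. ?K s x) = u (x + e) - u x" for x
  proof -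
    have "(LINT s|lborel. ?K s x) = u (x + 1 *\<^sub>R e) - u (x + 0 *\<^sub>R e)"
    proof (rule integral_FTC_Icc_real)
      fix s :: real
      have 1: "((\<lambda>s. x + s *\<^sub>R e) has_derivative (\<lambda>r. r *\<^sub>R e)) (at s)"
        by (auto intro!: derivative_eq_intros)
      have "((\<lambda>s. u (x + s *\<^sub>R e)) has_derivative (\<lambda>r. u' (x + s *\<^sub>R e) (r *\<^sub>R e))) (at s)"
        using has_derivative_compose[OF 1 der] by simp
      moreover have "u' (x + s *\<^sub>R e) (r *\<^sub>R e) = u' (x + s *\<^sub>R e) e * r" for r
        using linear_cmul[OF has_derivative_linear[OF der[of "x + s *\<^sub>R e"]], of r e] by simp
      ultimately show "((\<lambda>s. u (x + s *\<^sub>R e)) has_real_derivative u' (x + s *\<^sub>R e) e) (at s)"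
        by (simp add: has_field_derivative_def)
      have "continuous (at s) (\<lambda>s. x + s *\<^sub>R e)" by (intro continuous_intros)
      moreover have "isCont (\<lambda>x. u' x e) (x + s *\<^sub>R e)"
        using cont by (simp add: continuous_on_eq_continuous_at)
      ultimately show "isCont (\<lambda>s. u' (x + s *\<^sub>R e) e) s"
        by (rule isCont_o2)
    qed simp
    then show ?thesis by simp
  qed
  have "(LINT x|lborel. u' x e) = (LINT s|lborel. (LINT x|lborel. u' x e) * indicator {0..1::real} s)"
    by simp
  also have "\<dots> = (LINT s|lborel. (LINT x|lborel. ?K s x))"
    using lborel_integral_translate(1)[of "\<lambda>x. u' x e"] by simp
  also have "\<dots> = (LINT x|lborel. (LINT s|lborel. ?K s x))"
    using lborel_pair.Fubini_integral[OF intK] by simp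
  also have "\<dots> = (LINT x|lborel. u (x + e) - u x)"
    by (simp only: ftc)
  also have "\<dots> = 0"
    using int lborel_integral_translate[of u e] by simp
  finally show ?thesis .
qed

lemma integrable_lborel_continuous_compact_support:
  fixes u :: "'a::euclidean_space \<Rightarrow> real"
  assumes "continuous_on UNIV u" "compact K" "\<And>x. x \<notin> K \<Longrightarrow> u x = 0"
  shows "integrable lborel u"
proof -
  have "integrable lborel (\<lambda>x. indicator K x *\<^sub>R u x)"
    using assms borel_integrable_compact continuous_on_subset by blast
  also have "(\<lambda>x. indicator K x *\<^sub>R u x) = u"
    using assms(3) by (auto simp: indicator_def fun_eq_iff)
  finally show ?thesis .
qed

section \<open>Functions of class C1\<close>

text \<open>Replaces the chosen derivative \<^const>\<open>frechet_derivative\<close> by any derivative that is explicitly known.\<close>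

lemma C1_onI:
  assumes "\<And>x. x \<in> S \<Longrightarrow> (f has_derivative f' x) (at x)"
    and "\<And>v. continuous_on S (\<lambda>x. f' x v)"
  shows "Ck_on (Suc 0) S f"
proof -
  have "frechet_derivative f (at x) = f' x" if "x \<in> S" for x
    using frechet_derivative_at[OF assms(1)[OF that]] by simp
  then have "continuous_on S (\<lambda>x. frechet_derivative f (at x) v)" for v
    using assms(2)[of v] by (simp cong: continuous_on_cong)
  with assms(1) show ?thesis by (auto simp: differentiable_def)
qed

lemma C1_on_has_derivative:
  "Ck_on (Suc n) S f \<Longrightarrow> x \<in> S \<Longrightarrow> (f has_derivative frechet_derivative f (at x)) (at x)"
  by (auto simp: frechet_derivative_works)

lemma C1_on_continuous_derivative:
  "Ck_on (Suc 0) S f \<Longrightarrow> continuous_on S (\<lambda>x. frechet_derivative f (at x) v)"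
  by auto

lemma Ck_on_imp_continuous:
  "Ck_on n S f \<Longrightarrow> continuous_on S f"
  by (cases n) (auto intro!: continuous_at_imp_continuous_on
      intro: differentiable_imp_continuous_within)

lemma Ck_on_Suc: "Ck_on (Suc n) S f \<Longrightarrow> Ck_on n S f"
proof (induction n arbitrary: f)
  case 0
  then show ?case using Ck_on_imp_continuous[of "Suc 0"] by simp
next
  case (Suc n)
  then show ?case by auto
qed

lemma C1_on_const: "Ck_on (Suc 0) S (\<lambda>x. c)"
  by (rule C1_onI[where f'="\<lambda>x v. 0"]) auto

lemma C1_on_cong:
  assumes S: "open S" and eq: "\<And>x. x \<in> S \<Longrightarrow> f x = h x" and h: "Ck_on (Suc 0) S h"
  shows "Ck_on (Suc 0) S f"
proof (rule C1_onI[where f'="\<lambda>x. frechet_derivative h (at x)"])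
  fix x assume x: "x \<in> S"
  show "(f has_derivative frechet_derivative h (at x)) (at x)"
    using has_derivative_transform_within_open[OF C1_on_has_derivative[OF h x] S x] eq by simp
qed (use h in auto)

lemma C1_on_add:
  assumes f: "Ck_on (Suc 0) S f" and h: "Ck_on (Suc 0) S h"
  shows "Ck_on (Suc 0) S (\<lambda>x. f x + h x)"
  by (rule C1_onI[where f'="\<lambda>x v. frechet_derivative f (at x) v + frechet_derivative h (at x) v"])
     (use C1_on_has_derivative[OF f] C1_on_has_derivative[OF h] f h in
       \<open>auto intro!: derivative_intros continuous_intros\<close>)

lemma C1_on_mult:
  fixes f h :: "'a::real_normed_vector \<Rightarrow> real"
  assumes f: "Ck_on (Suc 0) S f" and h: "Ck_on (Suc 0) S h"
  shows "Ck_on (Suc 0) S (\<lambda>x. f x * h x)"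
  by (rule C1_onI[where f'="\<lambda>x v. f x * frechet_derivative h (at x) v + frechet_derivative f (at x) v * h x"])
     (use C1_on_has_derivative[OF f] C1_on_has_derivative[OF h] f h
        Ck_on_imp_continuous[OF f] Ck_on_imp_continuous[OF h] in
       \<open>auto intro!: derivative_intros continuous_intros\<close>)

lemma C1_on_sum:
  assumes "\<And>i. i \<in> I \<Longrightarrow> Ck_on (Suc 0) S (f i)"
  shows "Ck_on (Suc 0) S (\<lambda>x. \<Sum>i\<in>I. f i x)"
  using assms
  by (induction I rule: infinite_finite_induct) (auto intro: C1_on_const C1_on_add simp del: Ck_on.simps)

lemma C1_on_prod:
  fixes f :: "'i \<Rightarrow> 'a::real_normed_vector \<Rightarrow> real"
  assumes "\<And>i. i \<in> I \<Longrightarrow> Ck_on (Suc 0) S (f i)"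
  shows "Ck_on (Suc 0) S (\<lambda>x. \<Prod>i\<in>I. f i x)"
  using assms
  by (induction I rule: infinite_finite_induct) (auto intro: C1_on_const C1_on_mult simp del: Ck_on.simps)

lemma C1_on_compose_real:
  fixes f :: "'a::real_normed_vector \<Rightarrow> real" and \<phi> :: "real \<Rightarrow> real"
  assumes f: "Ck_on (Suc 0) S f" and sub: "\<And>x. x \<in> S \<Longrightarrow> f x \<in> T"
    and der: "\<And>t. t \<in> T \<Longrightarrow> (\<phi> has_real_derivative \<phi>' t) (at t)" and cont: "continuous_on T \<phi>'"
  shows "Ck_on (Suc 0) S (\<lambda>x. \<phi> (f x))"
proof (rule C1_onI[where f'="\<lambda>x v. \<phi>' (f x) * frechet_derivative f (at x) v"])
  fix x assume x: "x \<in> S"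
  show "((\<lambda>x. \<phi> (f x)) has_derivative (\<lambda>v. \<phi>' (f x) * frechet_derivative f (at x) v)) (at x)"
    using has_derivative_compose[OF C1_on_has_derivative[OF f x]]
      der[OF sub[OF x]] by (auto simp: has_field_derivative_def)
next
  fix v
  have "continuous_on S (\<lambda>x. \<phi>' (f x))"
    using continuous_on_compose2[OF cont Ck_on_imp_continuous[OF f]] sub by blast
  then show "continuous_on S (\<lambda>x. \<phi>' (f x) * frechet_derivative f (at x) v)"
    using f by (auto intro!: continuous_intros)
qed

lemma C1_on_sqrt:
  fixes f :: "'a::real_normed_vector \<Rightarrow> real"
  assumes f: "Ck_on (Suc 0) S f" and "\<And>x. x \<in> S \<Longrightarrow> f x > 0"
  shows "Ck_on (Suc 0) S (\<lambda>x. sqrt (f x))"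
  by (rule C1_on_compose_real[OF f, of "{0<..}" sqrt "\<lambda>t. inverse (sqrt t) / 2"])
     (use assms(2) in \<open>auto intro!: DERIV_real_sqrt continuous_intros\<close>)

lemma C1_on_exp:
  fixes f :: "'a::real_normed_vector \<Rightarrow> real"
  assumes f: "Ck_on (Suc 0) S f"
  shows "Ck_on (Suc 0) S (\<lambda>x. exp (f x))"
  by (rule C1_on_compose_real[OF f, of UNIV exp exp]) (auto intro!: continuous_intros)

lemma C1_on_inverse:
  fixes f :: "'a::real_normed_vector \<Rightarrow> real"
  assumes f: "Ck_on (Suc 0) S f" and "\<And>x. x \<in> S \<Longrightarrow> f x \<noteq> 0"
  shows "Ck_on (Suc 0) S (\<lambda>x. inverse (f x))"
  by (rule C1_on_compose_real[OF f, of "- {0}" inverse "\<lambda>t. - (inverse t ^ 2)"])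
     (use assms(2) in \<open>auto intro!: continuous_intros derivative_eq_intros simp: power2_eq_square\<close>)

lemma C1_on_uminus:
  fixes f :: "'a::real_normed_vector \<Rightarrow> real"
  assumes f: "Ck_on (Suc 0) S f"
  shows "Ck_on (Suc 0) S (\<lambda>x. - f x)"
  using C1_on_mult[OF C1_on_const[of S "-1"] f] by simp

text \<open>The outer derivative at \<open>f x\<close> is applied to a direction that itself varies with \<open>x\<close>, whereas continuity
is known for fixed directions only. Expanding the direction in the basis reduces to fixed ones.\<close>

lemma C1_on_compose:
  fixes f :: "'a::real_normed_vector \<Rightarrow> 'b::euclidean_space" and h :: "'b \<Rightarrow> real"
  assumes f: "Ck_on (Suc 0) S f" and h: "Ck_on (Suc 0) T h" and sub: "f ` S \<subseteq> T"
  shows "Ck_on (Suc 0) S (\<lambda>x. h (f x))"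
proof (rule C1_onI[where f'="\<lambda>x v. frechet_derivative h (at (f x)) (frechet_derivative f (at x) v)"])
  fix x assume x: "x \<in> S"
  then have "f x \<in> T" using sub by auto
  then show "((\<lambda>x. h (f x)) has_derivative
      (\<lambda>v. frechet_derivative h (at (f x)) (frechet_derivative f (at x) v))) (at x)"
    using has_derivative_compose[OF C1_on_has_derivative[OF f x] C1_on_has_derivative[OF h]] by blast
next
  fix v
  have *: "frechet_derivative h (at (f x)) w =
      (\<Sum>b\<in>Basis. (w \<bullet> b) * frechet_derivative h (at (f x)) b)" if "x \<in> S" for x w
  proof -
    have lin: "linear (frechet_derivative h (at (f x)))"
      using C1_on_has_derivative[OF h] sub that by (blast intro: has_derivative_linear)
    have "frechet_derivative h (at (f x)) w = frechet_derivative h (at (f x)) (\<Sum>b\<in>Basis. (w \<bullet> b) *\<^sub>R b)"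
      by (simp add: euclidean_representation)
    also have "\<dots> = (\<Sum>b\<in>Basis. (w \<bullet> b) * frechet_derivative h (at (f x)) b)"
      using lin by (simp add: linear_sum linear_cmul)
    finally show ?thesis .
  qed
  have "continuous_on S (\<lambda>x. frechet_derivative h (at (f x)) b)" for b
    using continuous_on_compose2[OF C1_on_continuous_derivative[OF h] Ck_on_imp_continuous[OF f] sub] .
  then have "continuous_on S (\<lambda>x. \<Sum>b\<in>Basis. (frechet_derivative f (at x) v \<bullet> b) *
      frechet_derivative h (at (f x)) b)"
    using f by (intro continuous_intros) auto
  then show "continuous_on S (\<lambda>x. frechet_derivative h (at (f x)) (frechet_derivative f (at x) v))"
    by (subst continuous_on_cong[OF refl *]) auto
qed

lemma C1_on_bounded_linear:
  assumes f: "Ck_on (Suc 0) S f" and L: "bounded_linear L"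
  shows "Ck_on (Suc 0) S (\<lambda>x. L (f x))"
  by (rule C1_onI[where f'="\<lambda>x v. L (frechet_derivative f (at x) v)"])
     (use f C1_on_has_derivative[OF f] in
       \<open>auto intro!: bounded_linear.has_derivative[OF L] bounded_linear.continuous_on[OF L]\<close>)

lemma C1_on_nth:
  fixes f :: "'a::real_normed_vector \<Rightarrow> 'b::real_normed_vector^'m::finite"
  assumes f: "Ck_on (Suc 0) S f"
  shows "Ck_on (Suc 0) S (\<lambda>x. f x $ i)"
  by (rule C1_on_bounded_linear[OF f bounded_linear_vec_nth])

lemma C1_on_vec:
  fixes f :: "'a::real_normed_vector \<Rightarrow> real^'m::finite"
  assumes f: "\<And>i. Ck_on (Suc 0) S (\<lambda>x. f x $ i)"
  shows "Ck_on (Suc 0) S f"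
proof (rule C1_onI[where f'="\<lambda>x v. \<chi> i. frechet_derivative (\<lambda>x. f x $ i) (at x) v"])
  fix x assume x: "x \<in> S"
  show "(f has_derivative (\<lambda>v. \<chi> i. frechet_derivative (\<lambda>x. f x $ i) (at x) v)) (at x)"
    unfolding has_derivative_componentwise_within[of f]
  proof
    fix b :: "real^'m" assume "b \<in> Basis"
    then obtain i where b: "b = axis i 1" by (auto simp: Basis_vec_def)
    show "((\<lambda>x. f x \<bullet> b) has_derivative
        (\<lambda>v. (\<chi> i. frechet_derivative (\<lambda>x. f x $ i) (at x) v) \<bullet> b)) (at x)"
      using C1_on_has_derivative[OF f x] by (simp add: b inner_axis)
  qed
qed (use f in \<open>auto intro!: continuous_intros\<close>)

lemma C1_on_det:
  fixes f :: "'a::real_normed_vector \<Rightarrow> real^'m::finite^'m"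
  assumes f: "\<And>i j. Ck_on (Suc 0) S (\<lambda>x. f x $ i $ j)"
  shows "Ck_on (Suc 0) S (\<lambda>x. det (f x))"
  unfolding det_def by (intro C1_on_sum C1_on_mult C1_on_const C1_on_prod f)

lemma C1_on_Un:
  assumes "Ck_on (Suc 0) S f" "Ck_on (Suc 0) T f" "open S" "open T"
  shows "Ck_on (Suc 0) (S \<union> T) f"
  using assms by (auto intro!: continuous_on_open_Un)

section \<open>A bump function of class C1\<close>

text \<open>The square makes the function C1 with a Lipschitz derivative. This is enough for partitions of unity
and for mollification.\<close>

definition bump :: "real \<Rightarrow> 'a::real_inner \<Rightarrow> 'a \<Rightarrow> real" where
  "bump r a y = (max 0 (r\<^sup>2 - (y - a) \<bullet> (y - a)))\<^sup>2"

lemma has_derivative_max_0_square: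
  "((\<lambda>t. (max 0 t)\<^sup>2) has_real_derivative 2 * max 0 t) (at (t::real))"
proof -
  consider "t > 0" | "t < 0" | "t = 0" by linarith
  then show ?thesis
  proof cases
    case 1
    have "((\<lambda>t. t\<^sup>2) has_real_derivative 2 * max 0 t) (at t)"
      using 1 by (auto intro!: derivative_eq_intros)
    then show ?thesis
      by (rule DERIV_cong_ev[THEN iffD2, rotated -1])
         (use 1 eventually_nhds_in_open[of "{0<..}" t] in \<open>auto elim!: eventually_mono\<close>)
  next
    case 2
    have "((\<lambda>t. 0) has_real_derivative 2 * max 0 t) (at t)"
      using 2 by (auto intro!: derivative_eq_intros)
    then show ?thesis
      by (rule DERIV_cong_ev[THEN iffD2, rotated -1])
         (use 2 eventually_nhds_in_open[of "{..<0}" t] in \<open>auto elim!: eventually_mono\<close>)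
  next
    case 3
    have "((\<lambda>h. (max 0 (0 + h))\<^sup>2 / h) \<longlongrightarrow> 0) (at (0::real))"
    proof (rule Lim_null_comparison)
      show "\<forall>\<^sub>F h in at (0::real). norm ((max 0 (0 + h))\<^sup>2 / h) \<le> \<bar>h\<bar>"
        by (auto simp: max_def power2_eq_square)
      show "((\<lambda>h. \<bar>h\<bar>) \<longlongrightarrow> 0) (at (0::real))"
        by (rule tendsto_eq_intros | simp)+
    qed
    then show ?thesis using 3 by (simp add: DERIV_def)
  qed
qed

definition bump_deriv :: "real \<Rightarrow> 'a::real_inner \<Rightarrow> 'a \<Rightarrow> 'a \<Rightarrow> real" where
  "bump_deriv r a y v = - 4 * max 0 (r\<^sup>2 - (y - a) \<bullet> (y - a)) * ((y - a) \<bullet> v)"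

lemma bump_has_derivative: "(bump r a has_derivative bump_deriv r a y) (at y)"
proof -
  have "((\<lambda>y. r\<^sup>2 - (y - a) \<bullet> (y - a)) has_derivative (\<lambda>v. - 2 * ((y - a) \<bullet> v))) (at y)"
    by (auto intro!: derivative_eq_intros simp: inner_commute)
  from has_derivative_compose[OF this has_derivative_max_0_square[unfolded has_field_derivative_def]]
  show ?thesis by (simp add: bump_def[abs_def] bump_deriv_def[abs_def] mult_ac)
qed

lemma continuous_bump: "continuous_on S (bump r a)"
  unfolding bump_def by (intro continuous_intros)

lemma continuous_bump_deriv: "continuous_on S (\<lambda>y. bump_deriv r a y v)"
  unfolding bump_deriv_def by (intro continuous_intros)

lemma C1_on_bump: "Ck_on (Suc 0) S (bump r a)"
  by (rule C1_onI[OF bump_has_derivative continuous_bump_deriv])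

lemma bump_nonneg: "bump r a y \<ge> 0"
  by (simp add: bump_def)

lemma bump_pos_iff: "r > 0 \<Longrightarrow> bump r a y > 0 \<longleftrightarrow> y \<in> ball a r"
  by (auto simp: bump_def dist_norm norm_minus_commute max_def power2_norm_eq_inner[symmetric]
      power2_less_imp_less abs_le_square_iff[symmetric])

lemma bump_eq_0: "r > 0 \<Longrightarrow> y \<notin> ball a r \<Longrightarrow> bump r a y = 0"
  using bump_pos_iff[of r a y] bump_nonneg[of r a y] by linarith

section \<open>The standard Gaussian measure\<close>

definition gauss_density :: "real^'k::finite \<Rightarrow> real" where
  "gauss_density z = (\<Prod>i\<in>UNIV. std_normal_density (z $ i))"

abbreviation gaussian :: "(real^'k::finite) measure" where
  "gaussian \<equiv> density lborel (\<lambda>z. ennreal (gauss_density z))"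

lemma measurable_vec_nth_borel [measurable]: "(\<lambda>z::real^'k::finite. z $ i) \<in> borel_measurable borel"
  by (intro borel_measurable_continuous_onI continuous_intros)

text \<open>Lebesgue measure on \<^typ>\<open>real^'k\<close> is a product over the set of basis vectors; the proof relabels the
basis vectors by the index type.\<close>

lemma nn_integral_vec_prod:
  fixes f :: "'k::finite \<Rightarrow> real \<Rightarrow> ennreal"
  assumes [measurable]: "\<And>i. f i \<in> borel_measurable borel"
  shows "(\<integral>\<^sup>+z. (\<Prod>i\<in>UNIV. f i (z $ i)) \<partial>(lborel :: (real^'k) measure)) = (\<Prod>i\<in>UNIV. \<integral>\<^sup>+t. f i t \<partial>lborel)"
proof -
  interpret product_sigma_finite "\<lambda>_::real^'k. lborel :: real measure" ..
  define ax where "ax = (\<lambda>i::'k. axis i (1::real))"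
  have inj: "inj ax" by (auto simp: inj_on_def ax_def axis_eq_axis)
  have B: "(Basis :: (real^'k) set) = range ax"
    by (auto simp: Basis_vec_def ax_def)
  have comp: "(\<Sum>b\<in>Basis. x b *\<^sub>R b) $ i = x (ax i)" for x :: "real^'k \<Rightarrow> real" and i
  proof -
    have "(\<Sum>b\<in>Basis. x b *\<^sub>R b) $ i = (\<Sum>b\<in>Basis. x b *\<^sub>R b) \<bullet> ax i"
      by (simp add: ax_def inner_axis)
    also have "\<dots> = x (ax i)"
      by (rule inner_sum_left_Basis) (auto simp: B)
    finally show ?thesis .
  qed
  have "(\<integral>\<^sup>+z. (\<Prod>i\<in>UNIV. f i (z $ i)) \<partial>(lborel :: (real^'k) measure))
      = (\<integral>\<^sup>+x. (\<Prod>i\<in>UNIV. f i (x (ax i))) \<partial>(\<Pi>\<^sub>M b\<in>Basis. lborel))"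
    by (subst lborel_eq, subst nn_integral_distr) (auto simp: comp simp del: sum_component)
  also have "\<dots> = (\<integral>\<^sup>+x. (\<Prod>b\<in>Basis. f (inv ax b) (x b)) \<partial>(\<Pi>\<^sub>M b\<in>Basis. lborel))"
    by (simp add: B prod.reindex[OF inj] inv_f_f[OF inj])
  also have "\<dots> = (\<Prod>b\<in>Basis. \<integral>\<^sup>+t. f (inv ax b) t \<partial>lborel)"
    by (rule product_nn_integral_prod) auto
  also have "\<dots> = (\<Prod>i\<in>UNIV. \<integral>\<^sup>+t. f i t \<partial>lborel)"
    by (simp add: B prod.reindex[OF inj] inv_f_f[OF inj])
  finally show ?thesis .
qed

lemma prod_less_top:
  fixes f :: "'i \<Rightarrow> ennreal"
  shows "(\<And>i. i \<in> I \<Longrightarrow> f i < \<infinity>) \<Longrightarrow> (\<Prod>i\<in>I. f i) < \<infinity>"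
  by (induction I rule: infinite_finite_induct) (auto simp: ennreal_mult_less_top)

lemma gauss_density_nonneg [simp]: "gauss_density z \<ge> 0"
  by (simp add: gauss_density_def prod_nonneg)

lemma gauss_density_eq:
  "gauss_density (z::real^'k::finite) = (1 / sqrt (2 * pi)) ^ CARD('k) * exp (- (z \<bullet> z) / 2)"
proof -
  have "gauss_density z = (1 / sqrt (2 * pi)) ^ CARD('k) * (\<Prod>i\<in>UNIV. exp (- (z $ i)\<^sup>2 / 2))"
    by (simp add: gauss_density_def std_normal_density_def prod_dividef power_divide)
  also have "(\<Prod>i\<in>UNIV. exp (- (z $ i)\<^sup>2 / 2)) = exp (- (z \<bullet> z) / 2)"
    by (simp add: exp_sum[symmetric] inner_vec_def power2_eq_square sum_divide_distrib[symmetric] sum_negf)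
  finally show ?thesis .
qed

lemma gauss_density_has_derivative:
  "(gauss_density has_derivative (\<lambda>v. - (z \<bullet> v) * gauss_density z)) (at z)"
  unfolding gauss_density_eq[abs_def]
  by (auto intro!: derivative_eq_intros simp: inner_commute fun_eq_iff)

lemma continuous_on_gauss_density [continuous_intros]: "continuous_on S gauss_density"
  unfolding gauss_density_eq[abs_def] by (auto intro!: continuous_intros)

lemma measurable_gauss_density [measurable]: "gauss_density \<in> borel_measurable borel"
  by (intro borel_measurable_continuous_onI continuous_intros)

lemma prob_space_gaussian: "prob_space (gaussian :: (real^'k::finite) measure)"
proof
  have "emeasure (gaussian :: (real^'k) measure) (space gaussian)
      = (\<integral>\<^sup>+z. (\<Prod>i\<in>UNIV. ennreal (std_normal_density (z $ i))) \<partial>(lborel :: (real^'k) measure))"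
    by (subst emeasure_density) (auto simp: gauss_density_def prod_ennreal)
  also have "\<dots> = (\<Prod>i\<in>(UNIV::'k set). \<integral>\<^sup>+t. ennreal (std_normal_density t) \<partial>lborel)"
    by (rule nn_integral_vec_prod) auto
  also have "\<dots> = 1"
    by (subst nn_integral_eq_integral) (auto simp: integral_normal_density)
  finally show "emeasure (gaussian :: (real^'k) measure) (space gaussian) = 1" .
qed

text \<open>The integrand is again a product of functions of single coordinates, so the second moment of the
one-dimensional normal density suffices.\<close>

lemma integrable_gaussian_nth_square: "integrable gaussian (\<lambda>z::real^'k::finite. (z $ j)\<^sup>2)"
proof (rule integrableI_bounded)
  let ?f = "\<lambda>i t. ennreal (if i = j then t\<^sup>2 * std_normal_density t else std_normal_density t)"
  have fin: "(\<integral>\<^sup>+t. ?f i t \<partial>lborel) < \<infinity>" for i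
  proof -
    have 1: "integrable lborel (\<lambda>t. t\<^sup>2 * std_normal_density t)"
      using std_normal_moment_even[of 1] by (simp add: has_bochner_integral_iff mult.commute)
    have "integrable lborel (\<lambda>t. if i = j then t\<^sup>2 * std_normal_density t else std_normal_density t)"
      using 1 by (cases "i = j") auto
    then show ?thesis
      by (subst nn_integral_eq_integral) auto
  qed
  have "(\<integral>\<^sup>+z. ennreal (norm ((z $ j)\<^sup>2)) \<partial>(gaussian :: (real^'k) measure))
      = (\<integral>\<^sup>+z. (\<Prod>i\<in>UNIV. ?f i (z $ i)) \<partial>(lborel :: (real^'k) measure))"
  proof (subst nn_integral_density)
    have *: "gauss_density z * (z $ j)\<^sup>2 = (\<Prod>i\<in>UNIV. if i = j then (z $ i)\<^sup>2 * std_normal_density (z $ i) else std_normal_density (z $ i))" for z :: "real^'k"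
    proof -
      have "(\<Prod>i\<in>UNIV. if i = j then (z $ i)\<^sup>2 * std_normal_density (z $ i) else std_normal_density (z $ i))
        = (\<Prod>i\<in>UNIV. (if i = j then (z $ i)\<^sup>2 else 1) * std_normal_density (z $ i))"
        by (intro prod.cong) auto
      also have "\<dots> = (z $ j)\<^sup>2 * gauss_density z"
        by (simp add: prod.distrib gauss_density_def prod.delta)
      finally show ?thesis by simp
    qed
    show "(\<integral>\<^sup>+z. ennreal (gauss_density z) * ennreal (norm ((z $ j)\<^sup>2)) \<partial>(lborel :: (real^'k) measure)) = (\<integral>\<^sup>+z. (\<Prod>i\<in>UNIV. ?f i (z $ i)) \<partial>(lborel :: (real^'k) measure))"
      by (intro nn_integral_cong) (simp add: ennreal_mult'[symmetric] * prod_ennreal)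
  qed auto
  also have "\<dots> = (\<Prod>i\<in>(UNIV::'k set). \<integral>\<^sup>+t. ?f i t \<partial>lborel)"
    by (rule nn_integral_vec_prod) auto
  also have "\<dots> < \<infinity>"
    by (rule prod_less_top) (rule fin)
  finally show "(\<integral>\<^sup>+z. ennreal (norm ((z $ j)\<^sup>2)) \<partial>(gaussian :: (real^'k) measure)) < \<infinity>" .
qed auto

lemma integrable_gaussian_quadratic:
  fixes F :: "real^'k::finite \<Rightarrow> real"
  assumes [measurable]: "F \<in> borel_measurable borel"
    and bound: "\<And>z. \<bar>F z\<bar> \<le> C * (1 + norm z)\<^sup>2"
  shows "integrable gaussian F"
proof -
  interpret prob_space "gaussian :: (real^'k) measure" by (rule prob_space_gaussian)
  have "0 \<le> C" using bound[of 0] by simp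
  have "integrable gaussian (\<lambda>z::real^'k. C * (2 + 2 * (\<Sum>j\<in>UNIV. (z $ j)\<^sup>2)))"
    by (intro integrable_mult_right Bochner_Integration.integrable_add integrable_const
        Bochner_Integration.integrable_sum integrable_gaussian_nth_square)
  then show ?thesis
  proof (rule Bochner_Integration.integrable_bound)
    have "(1 + norm z)\<^sup>2 \<le> 2 + 2 * (\<Sum>j\<in>UNIV. (z $ j)\<^sup>2)" for z :: "real^'k"
    proof -
      have "(\<Sum>j\<in>UNIV. (z $ j)\<^sup>2) = (norm z)\<^sup>2"
        unfolding power2_norm_eq_inner by (simp add: inner_vec_def power2_eq_square)
      moreover have "0 \<le> (1 - norm z)\<^sup>2" by simp
      ultimately show ?thesis by (simp add: power2_eq_square algebra_simps)
    qed
    then have "C * (1 + norm z)\<^sup>2 \<le> C * (2 + 2 * (\<Sum>j\<in>UNIV. (z $ j)\<^sup>2))" for z :: "real^'k"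
      using \<open>0 \<le> C\<close> by (rule mult_left_mono)
    then show "AE z in gaussian. norm (F z) \<le> norm (C * (2 + 2 * (\<Sum>j\<in>UNIV. (z $ j)\<^sup>2)))"
      using bound by (intro AE_I2) (smt (verit) real_norm_def)
  qed auto
qed

text \<open>The directional derivative of \<open>F\<close> times the Gaussian density integrates to zero, and the density
differentiates to \<open>- (z \<bullet> v)\<close> times itself. Linear growth of \<open>F\<close> is allowed because the coordinate
functions themselves are needed for the covariance.\<close>

lemma gaussian_integration_by_parts:
  fixes F :: "real^'k::finite \<Rightarrow> real"
  assumes der: "\<And>z. (F has_derivative F' z) (at z)"
    and cont: "continuous_on UNIV (\<lambda>z. F' z e)"
    and bound: "\<And>z. \<bar>F z\<bar> \<le> C * (1 + norm z)" and bound': "\<And>z. \<bar>F' z e\<bar> \<le> C"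
  shows "(LINT z|gaussian. F' z e) = (LINT z|gaussian. (z \<bullet> e) * F z)"
proof -
  have contF: "continuous_on UNIV F"
    using der by (auto intro!: continuous_at_imp_continuous_on has_derivative_continuous)
  have [measurable]: "F \<in> borel_measurable borel" "(\<lambda>z. F' z e) \<in> borel_measurable borel"
    using contF cont by (auto intro: borel_measurable_continuous_onI)
  have C: "C \<ge> 0" using bound'[of 0] by linarith
  have 1: "1 \<le> (1 + norm z)" "1 + norm z \<le> (1 + norm z)\<^sup>2" for z :: "real^'k"
    by (auto simp: power2_eq_square algebra_simps)
  have int1: "integrable gaussian F"
    by (rule integrable_gaussian_quadratic[where C=C])
       (auto intro!: order.trans[OF bound] mult_left_mono 1 C)
  have int2: "integrable gaussian (\<lambda>z. F' z e)"
  proof (rule integrable_gaussian_quadratic[where C=C])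
    fix z :: "real^'k"
    have "C * 1 \<le> C * (1 + norm z)\<^sup>2"
      using C 1[of z] by (intro mult_left_mono) linarith+
    then show "\<bar>F' z e\<bar> \<le> C * (1 + norm z)\<^sup>2"
      using bound'[of z] by simp
  qed auto
  have int3: "integrable gaussian (\<lambda>z. (z \<bullet> e) * F z)"
  proof (rule integrable_gaussian_quadratic[where C="C * norm e"])
    fix z
    have "\<bar>(z \<bullet> e) * F z\<bar> \<le> (norm z * norm e) * (C * (1 + norm z))"
      unfolding abs_mult by (intro mult_mono bound Cauchy_Schwarz_ineq2) auto
    also have "\<dots> \<le> ((1 + norm z) * norm e) * (C * (1 + norm z))"
      using C by (intro mult_right_mono) auto
    finally show "\<bar>(z \<bullet> e) * F z\<bar> \<le> C * norm e * (1 + norm z)\<^sup>2"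
      by (simp add: power2_eq_square mult_ac)
  qed auto
  let ?u' = "\<lambda>z v. F z * (- (z \<bullet> v) * gauss_density z) + F' z v * gauss_density z"
  have i1: "integrable lborel (\<lambda>z. F z * gauss_density z)"
    and i2: "integrable lborel (\<lambda>z. F' z e * gauss_density z)"
    and i3: "integrable lborel (\<lambda>z. (z \<bullet> e) * F z * gauss_density z)"
    using int1 int2 int3 by (simp_all add: integrable_real_density mult_ac)
  have "(LINT z|lborel. ?u' z e) = 0"
  proof (rule integral_directional_derivative_eq_0[where u="\<lambda>z. F z * gauss_density z"])
    show "((\<lambda>z. F z * gauss_density z) has_derivative ?u' z) (at z)" for z
      by (rule has_derivative_mult[OF der gauss_density_has_derivative])
    show "continuous_on UNIV (\<lambda>z. ?u' z e)"
      by (intro continuous_intros contF cont)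
    show "integrable lborel (\<lambda>z. ?u' z e)"
      using Bochner_Integration.integrable_diff[OF i2 i3] by (simp add: algebra_simps)
  qed (use i1 in auto)
  also have "(LINT z|lborel. ?u' z e)
      = (LINT z|lborel. F' z e * gauss_density z - (z \<bullet> e) * F z * gauss_density z)"
    by (simp add: algebra_simps)
  also have "\<dots> = (LINT z|lborel. F' z e * gauss_density z) - (LINT z|lborel. (z \<bullet> e) * F z * gauss_density z)"
    by (rule Bochner_Integration.integral_diff[OF i2 i3])
  finally show ?thesis
    by (subst (1 2) integral_real_density) (auto simp: mult_ac)
qed

lemma gaussian_covariance:
  "(LINT z|gaussian. (z $ i) * (z $ j)) = (if i = j then 1 else (0::real))"
proof -
  interpret prob_space "gaussian :: (real^'a::finite) measure" by (rule prob_space_gaussian)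
  have "(LINT z|(gaussian :: (real^'a) measure). axis i 1 $ j)
      = (LINT z|gaussian. (z \<bullet> axis i 1) * (z $ j))"
  proof (rule gaussian_integration_by_parts[where C=1])
    show "((\<lambda>z. z $ j) has_derivative (\<lambda>v. v $ j)) (at z)" for z :: "real^'a"
      by (rule bounded_linear_imp_has_derivative) (rule bounded_linear_vec_nth)
    show "\<bar>z $ j\<bar> \<le> 1 * (1 + norm z)" for z :: "real^'a"
      using component_le_norm_cart[of z j] by simp
  qed (auto simp: axis_def)
  moreover have "(LINT z|(gaussian :: (real^'a) measure). axis i 1 $ j) = (if i = j then 1 else (0::real))"
    using prob_space by (simp add: axis_def)
  ultimately show ?thesis
    by (simp add: inner_axis)
qed

text \<open>By Jensen's inequality the mean of the norm of \<open>B z\<close> is at most the root of the mean of its square.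
As the covariance matrix is the identity, this mean square is the squared Hilbert--Schmidt norm of \<open>B\<close>.\<close>

lemma gaussian_norm_linear_image_le:
  fixes B :: "'i::finite \<Rightarrow> 'k::finite \<Rightarrow> real"
  shows "(LINT z|gaussian. sqrt (\<Sum>i\<in>UNIV. (\<Sum>j\<in>UNIV. B i j * z $ j)\<^sup>2))
     \<le> sqrt (\<Sum>i\<in>UNIV. \<Sum>j\<in>UNIV. (B i j)\<^sup>2)"
    and "integrable gaussian (\<lambda>z. sqrt (\<Sum>i\<in>UNIV. (\<Sum>j\<in>UNIV. B i j * z $ j)\<^sup>2))"
proof -
  interpret prob_space "gaussian :: (real^'k) measure" by (rule prob_space_gaussian)
  let ?N = "\<lambda>z::real^'k. sqrt (\<Sum>i\<in>UNIV. (\<Sum>j\<in>UNIV. B i j * z $ j)\<^sup>2)"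
  have sq: "(?N z)\<^sup>2 = (\<Sum>i\<in>UNIV. \<Sum>j\<in>UNIV. \<Sum>l\<in>UNIV. (B i j * B i l) * (z $ j * z $ l))" for z
  proof -
    have "(?N z)\<^sup>2 = (\<Sum>i\<in>UNIV. (\<Sum>j\<in>UNIV. B i j * z $ j)\<^sup>2)"
      by (intro real_sqrt_pow2 sum_nonneg) auto
    also have "\<dots> = (\<Sum>i\<in>UNIV. \<Sum>j\<in>UNIV. \<Sum>l\<in>UNIV. (B i j * B i l) * (z $ j * z $ l))"
      by (simp add: power2_eq_square sum_product mult_ac)
    finally show ?thesis .
  qed
  have int2: "integrable gaussian (\<lambda>z::real^'k. z $ j * z $ l)" for j l
  proof (rule integrable_gaussian_quadratic[where C=1])
    fix z :: "real^'k"
    have "\<bar>z $ j * z $ l\<bar> \<le> norm z * norm z"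
      unfolding abs_mult by (intro mult_mono component_le_norm_cart) auto
    also have "\<dots> \<le> (1 + norm z) * (1 + norm z)"
      by (intro mult_mono) auto
    finally show "\<bar>z $ j * z $ l\<bar> \<le> 1 * (1 + norm z)\<^sup>2"
      by (simp add: power2_eq_square)
  qed auto
  have i2: "integrable gaussian (\<lambda>z. (?N z)\<^sup>2)"
    unfolding sq by (intro Bochner_Integration.integrable_sum integrable_mult_right int2)
  have "(LINT z|gaussian. (?N z)\<^sup>2) = (\<Sum>i\<in>UNIV. \<Sum>j\<in>UNIV. \<Sum>l\<in>UNIV. (B i j * B i l) * (if j = l then 1 else 0))"
    unfolding sq
    by (simp add: int2 gaussian_covariance Bochner_Integration.integral_sum)
  also have "\<dots> = (\<Sum>i\<in>UNIV. \<Sum>j\<in>UNIV. (B i j)\<^sup>2)"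
    by (simp add: power2_eq_square if_distrib sum.delta cong: if_cong)
  finally have E2: "(LINT z|gaussian. (?N z)\<^sup>2) = (\<Sum>i\<in>UNIV. \<Sum>j\<in>UNIV. (B i j)\<^sup>2)" .
  have m: "?N \<in> borel_measurable gaussian" by measurable
  show i1: "integrable gaussian ?N"
    by (rule square_integrable_imp_integrable[OF m i2])
  have "(expectation ?N)\<^sup>2 \<le> expectation (\<lambda>z. (?N z)\<^sup>2)"
    using variance_positive[of ?N] variance_eq[OF i1 i2] by simp
  then show "expectation ?N \<le> sqrt (\<Sum>i\<in>UNIV. \<Sum>j\<in>UNIV. (B i j)\<^sup>2)"
    unfolding E2 by (rule real_le_rsqrt)
qed

section \<open>Mollification of Lipschitz functions\<close>

lemma lipschitz_imp_derivative_bound: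
  fixes f :: "'a::real_normed_vector \<Rightarrow> real"
  assumes lip: "\<And>x y. \<bar>f x - f y\<bar> \<le> L * norm (x - y)" and der: "(f has_derivative f') (at x)"
  shows "\<bar>f' v\<bar> \<le> L * norm v"
proof -
  have 1: "((\<lambda>s. x + s *\<^sub>R v) has_derivative (\<lambda>r. r *\<^sub>R v)) (at (0::real))"
    by (auto intro!: derivative_eq_intros)
  have "((\<lambda>s. f (x + s *\<^sub>R v)) has_derivative (\<lambda>r. f' (r *\<^sub>R v))) (at 0)"
    using has_derivative_compose[OF 1, of f f'] der by simp
  moreover have "f' (r *\<^sub>R v) = f' v * r" for r
    using linear_cmul[OF has_derivative_linear[OF der], of r v] by simp
  ultimately have "((\<lambda>s. f (x + s *\<^sub>R v)) has_real_derivative f' v) (at 0)"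
    by (simp add: has_field_derivative_def)
  then have lim: "((\<lambda>h. (f (x + h *\<^sub>R v) - f x) / h) \<longlongrightarrow> f' v) (at 0)"
    by (simp add: DERIV_def)
  have "\<bar>(f (x + h *\<^sub>R v) - f x) / h\<bar> \<le> L * norm v" if "h \<noteq> 0" for h
    using lip[of "x + h *\<^sub>R v" x] that by (simp add: abs_divide field_simps)
  then have "\<forall>\<^sub>F h in at 0. \<bar>(f (x + h *\<^sub>R v) - f x) / h\<bar> \<le> L * norm v"
    by (auto simp: eventually_at_filter)
  from tendsto_upperbound[OF tendsto_rabs[OF lim] this] show ?thesis by simp
qed

lemma continuous_on_lipschitz_real:
  fixes f :: "'a::real_normed_vector \<Rightarrow> real"
  assumes lip: "\<And>x y. \<bar>f x - f y\<bar> \<le> L * norm (x - y)"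
  shows "continuous_on S f"
proof -
  have "\<bar>f x - f y\<bar> \<le> max 0 L * norm (x - y)" for x y
    using lip[of x y] by (rule order_trans) (intro mult_right_mono, auto)
  then have "(max 0 L)-lipschitz_on S f"
    by (auto simp: lipschitz_on_def dist_norm)
  then show ?thesis by (rule lipschitz_on_continuous_on)
qed

text \<open>A common estimate for the kernels \<^const>\<open>bump\<close> and \<^const>\<open>bump_deriv\<close>: the values to be compared matter
only where the kernel does not vanish.\<close>

lemma weighted_integral_diff_le:
  fixes k a b \<kappa> :: "'b \<Rightarrow> real"
  assumes a: "integrable N (\<lambda>z. k z * a z)" and b: "integrable N (\<lambda>z. k z * b z)"
    and \<kappa>: "integrable N \<kappa>" "\<And>z. \<bar>k z\<bar> \<le> \<kappa> z" and D0: "D \<ge> 0" and D: "\<And>z. k z \<noteq> 0 \<Longrightarrow> \<bar>a z - b z\<bar> \<le> D"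
  shows "\<bar>(LINT z|N. k z * a z) - (LINT z|N. k z * b z)\<bar> \<le> (LINT z|N. \<kappa> z) * D"
proof -
  have diff: "integrable N (\<lambda>z. k z * (a z - b z))"
    using Bochner_Integration.integrable_diff[OF a b] by (simp add: right_diff_distrib)
  have "\<bar>(LINT z|N. k z * a z) - (LINT z|N. k z * b z)\<bar> = \<bar>LINT z|N. k z * (a z - b z)\<bar>"
    using Bochner_Integration.integral_diff[OF a b] by (simp add: right_diff_distrib)
  also have "\<dots> \<le> (LINT z|N. \<kappa> z * D)"
  proof (rule integral_abs_bound[THEN order_trans], rule integral_mono)
    show "\<bar>k z * (a z - b z)\<bar> \<le> \<kappa> z * D" for z
    proof (cases "k z = 0")
      case True
      then show ?thesis using D0 \<kappa>(2)[of z] by simp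
    next
      case False
      then show ?thesis using \<kappa>(2)[of z] D[of z] unfolding abs_mult by (intro mult_mono) auto
    qed
  qed (use diff \<kappa> in auto)
  finally show ?thesis by simp
qed

definition mollify :: "real \<Rightarrow> ('a::euclidean_space \<Rightarrow> real) \<Rightarrow> 'a \<Rightarrow> real" where
  "mollify r q x = (LINT z|lborel. bump r 0 z * q (x + z)) / (LINT z|lborel. bump r (0::'a) z)"

text \<open>The derivative of the convolution falls on the bump. The sign comes from moving the shift by \<open>x\<close> from \<open>q\<close> to the bump.\<close>

definition mollify_deriv :: "real \<Rightarrow> ('a::euclidean_space \<Rightarrow> real) \<Rightarrow> 'a \<Rightarrow> 'a \<Rightarrow> real" where
  "mollify_deriv r q x v = - (LINT z|lborel. bump_deriv r 0 z v * q (x + z)) / (LINT z|lborel. bump r (0::'a) z)"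

context
  fixes r :: real
  assumes r: "r > 0"
begin

lemma bump_deriv_eq_0: "y \<notin> ball a r \<Longrightarrow> bump_deriv r a y v = 0"
proof -
  assume "y \<notin> ball a r"
  then have "norm (y - a) \<ge> r" by (simp add: dist_norm norm_minus_commute)
  then have "r\<^sup>2 \<le> (y - a) \<bullet> (y - a)"
    using r by (simp add: power2_norm_eq_inner[symmetric] power_mono)
  then show ?thesis by (simp add: bump_deriv_def)
qed

lemma bump_deriv_bound: "\<bar>bump_deriv r a y v\<bar> \<le> 4 * r ^ 3 * norm v"
proof (cases "y \<in> ball a r")
  case True
  then have "norm (y - a) \<le> r" by (simp add: dist_norm norm_minus_commute)
  then have "\<bar>(y - a) \<bullet> v\<bar> \<le> r * norm v"
    by (smt (verit) Cauchy_Schwarz_ineq2 mult_right_mono norm_ge_zero)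
  moreover have "\<bar>4 * max 0 (r\<^sup>2 - (y - a) \<bullet> (y - a))\<bar> \<le> 4 * r\<^sup>2"
    by simp
  ultimately have "\<bar>4 * max 0 (r\<^sup>2 - (y - a) \<bullet> (y - a))\<bar> * \<bar>(y - a) \<bullet> v\<bar> \<le> 4 * r\<^sup>2 * (r * norm v)"
    by (intro mult_mono) auto
  then show ?thesis
    by (simp add: bump_deriv_def abs_mult power3_eq_cube power2_eq_square mult_ac)
qed (use r in \<open>simp add: bump_deriv_eq_0\<close>)

text \<open>A Taylor estimate without second derivatives, which do not exist on the boundary sphere of the
bump. The bump is \<open>(max 0 t)\<^sup>2\<close> at \<open>t = r\<^sup>2 - y \<bullet> y\<close>; moving \<open>y\<close> by \<open>v\<close> changes \<open>t\<close> by some \<open>s\<close> of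
order \<open>norm v\<close>, the remainder of the square is at most \<open>s\<^sup>2\<close>, and \<open>s\<close> differs from its linear part by
\<open>v \<bullet> v\<close>.\<close>

lemma bump_quadratic_estimate:
  assumes v: "norm v \<le> 1"
  shows "\<bar>bump r 0 (y + v) - bump r 0 y - bump_deriv r 0 y v\<bar>
    \<le> ((2 * r + 3)\<^sup>2 + 2 * r\<^sup>2) * (norm v)\<^sup>2 * indicator (cball 0 (r + 1)) y"
proof (cases "y \<in> cball 0 (r + 1)")
  case True
  define t where "t = r\<^sup>2 - y \<bullet> y"
  define s where "s = - 2 * (y \<bullet> v) - v \<bullet> v"
  have 1: "r\<^sup>2 - (y + v) \<bullet> (y + v) = t + s"
    by (simp add: t_def s_def algebra_simps inner_commute)
  have 2: "\<bar>(max 0 (t + s))\<^sup>2 - (max 0 t)\<^sup>2 - 2 * max 0 t * s\<bar> \<le> s\<^sup>2"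
  proof -
    consider "t \<ge> 0" "t + s \<ge> 0" | "t \<ge> 0" "t + s < 0" | "t < 0" "t + s < 0" | "t < 0" "t + s \<ge> 0" by linarith
    then show ?thesis
    proof cases
      case 1 then show ?thesis by (simp add: power2_eq_square algebra_simps)
    next
      case 2
      then have "0 \<le> t * (- t - 2 * s)" by (intro mult_nonneg_nonneg) auto
      moreover have "- t * t - 2 * t * s \<le> s * s" using sum_squares_ge_zero[of "t + s" 0] by (simp add: algebra_simps)
      ultimately show ?thesis using 2 by (simp add: power2_eq_square algebra_simps max_def)
    next
      case 3 then show ?thesis by simp
    next
      case 4
      then have "(t + s)\<^sup>2 \<le> s\<^sup>2" by (intro power_mono) auto
      with 4 show ?thesis by (simp add: max_def)
    qed
  qed
  have "\<bar>s\<bar> \<le> 2 * \<bar>y \<bullet> v\<bar> + \<bar>v \<bullet> v\<bar>" unfolding s_def by linarith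
  also have "\<dots> \<le> 2 * (norm y * norm v) + norm v * norm v"
    using Cauchy_Schwarz_ineq2[of y v] by (simp add: power2_norm_eq_inner[symmetric] power2_eq_square)
  also have "\<dots> \<le> 2 * ((r + 1) * norm v) + 1 * norm v"
    using True v by (intro add_mono mult_left_mono mult_right_mono) auto
  also have "\<dots> = (2 * r + 3) * norm v" by (simp add: algebra_simps)
  finally have "s\<^sup>2 \<le> ((2 * r + 3) * norm v)\<^sup>2"
    using power_mono[of "\<bar>s\<bar>" _ 2] by simp
  then have 3: "s\<^sup>2 \<le> (2 * r + 3)\<^sup>2 * (norm v)\<^sup>2" by (simp add: power_mult_distrib)
  have 4: "2 * max 0 t * s - bump_deriv r 0 y v = - 2 * max 0 t * (norm v)\<^sup>2"
    by (simp add: bump_deriv_def t_def s_def algebra_simps power2_norm_eq_inner)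
  have "0 \<le> max 0 t" "max 0 t \<le> r\<^sup>2" by (auto simp: t_def)
  then have 5: "\<bar>2 * max 0 t * s - bump_deriv r 0 y v\<bar> \<le> 2 * r\<^sup>2 * (norm v)\<^sup>2"
    unfolding 4 by (auto simp: abs_mult intro!: mult_right_mono)
  have "bump r 0 (y + v) - bump r 0 y - bump_deriv r 0 y v =
     ((max 0 (t + s))\<^sup>2 - (max 0 t)\<^sup>2 - 2 * max 0 t * s) + (2 * max 0 t * s - bump_deriv r 0 y v)"
    using 1 by (simp add: bump_def t_def)
  then have "\<bar>bump r 0 (y + v) - bump r 0 y - bump_deriv r 0 y v\<bar> \<le> (2 * r + 3)\<^sup>2 * (norm v)\<^sup>2 + 2 * r\<^sup>2 * (norm v)\<^sup>2"
    using 2 3 5 by linarith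
  with True show ?thesis by (simp add: algebra_simps)
next
  case False
  then have y: "norm y > r + 1" by simp
  then have "norm (y + v) > r" using v norm_triangle_ineq4[of "y + v" v] by simp
  then show ?thesis using y r by (simp add: bump_eq_0 bump_deriv_eq_0)
qed

lemma integrable_bump_times:
  fixes q :: "'a::euclidean_space \<Rightarrow> real"
  assumes "continuous_on UNIV q"
  shows "integrable lborel (\<lambda>z. bump r 0 z * q (x + z))"
    and "integrable lborel (\<lambda>z. bump_deriv r 0 z v * q (x + z))"
  using assms r
  by (auto intro!: integrable_lborel_continuous_compact_support[of _ "cball 0 r"] continuous_intros
        continuous_bump continuous_bump_deriv continuous_on_compose2[OF assms]
      simp: bump_eq_0 bump_deriv_eq_0)

lemma integrable_bump: "integrable lborel (bump r (0::'a::euclidean_space))"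
  using integrable_bump_times(1)[of "\<lambda>_. 1"] by simp

lemma bump_integral_pos: "(LINT z|lborel. bump r (0::'a::euclidean_space) z) > 0"
proof -
  have "(LINT z|lborel. bump r (0::'a) z) \<noteq> 0"
  proof
    assume "(LINT z|lborel. bump r (0::'a) z) = 0"
    then have "AE z in lborel. bump r (0::'a) z = 0"
      by (subst (asm) integral_nonneg_eq_0_iff_AE) (auto simp: integrable_bump bump_nonneg)
    then have "AE z in lborel. z \<notin> ball (0::'a) r"
      by (rule AE_mp) (auto intro!: AE_I2 simp: bump_pos_iff[OF r, symmetric] simp del: mem_ball)
    then have "emeasure lborel (ball (0::'a) r) = 0"
      by (subst (asm) AE_iff_measurable[of "ball 0 r"]) (auto simp: ball_def)
    moreover have "measure lborel (ball (0::'a) r) > 0"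
      using content_ball_pos[OF r] by simp
    ultimately show False by (simp add: measure_def)
  qed
  moreover have "(LINT z|lborel. bump r (0::'a) z) \<ge> 0"
    by (intro integral_nonneg_AE) (auto simp: bump_nonneg)
  ultimately show ?thesis by linarith
qed


lemma integrable_bump_deriv_bound:
  "integrable lborel (\<lambda>z. K * indicator (ball (0::'a::euclidean_space) r) z)" for K :: real
  by (intro integrable_mult_right integrable_real_indicator) (use emeasure_bounded_finite[OF bounded_ball] in auto)

lemma bump_deriv_le_indicator: "\<bar>bump_deriv r 0 z v\<bar> \<le> 4 * r ^ 3 * norm v * indicator (ball 0 r) z"
  using bump_deriv_bound[of 0 z v] bump_deriv_eq_0[of z 0 v] by (cases "z \<in> ball 0 r") simp_all

lemma mollify_lipschitz:
  fixes q :: "'a::euclidean_space \<Rightarrow> real"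
  assumes lip: "\<And>x y. \<bar>q x - q y\<bar> \<le> L * norm (x - y)"
  shows "\<bar>mollify r q x - mollify r q y\<bar> \<le> L * norm (x - y)"
proof -
  let ?c = "LINT z|lborel. bump r (0::'a) z"
  note int = integrable_bump_times(1)[OF continuous_on_lipschitz_real[OF lip]]
  have "\<bar>(LINT z|lborel. bump r 0 z * q (x + z)) - (LINT z|lborel. bump r 0 z * q (y + z))\<bar>
      \<le> ?c * (L * norm (x - y))"
  proof (rule weighted_integral_diff_le[OF int int integrable_bump])
    show "0 \<le> L * norm (x - y)" using lip[of x y] by linarith
    show "\<bar>q (x + z) - q (y + z)\<bar> \<le> L * norm (x - y)" for z
      using lip[of "x + z" "y + z"] by simp
  qed (simp add: bump_nonneg)
  then show ?thesis
    using bump_integral_pos[where 'a='a]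
    by (simp add: mollify_def diff_divide_distrib[symmetric] abs_divide pos_divide_le_eq mult_ac)
qed

lemma mollify_close:
  fixes q :: "'a::euclidean_space \<Rightarrow> real"
  assumes lip: "\<And>x y. \<bar>q x - q y\<bar> \<le> L * norm (x - y)"
  shows "\<bar>mollify r q x - q x\<bar> \<le> L * r"
proof -
  let ?c = "LINT z|lborel. bump r (0::'a) z"
  note int = integrable_bump_times(1)[OF continuous_on_lipschitz_real[OF lip]]
  \<comment> \<open>The hypothesis at two distinct points shows that the Lipschitz constant is not negative.\<close>
  have "0 \<le> L * norm (x - (x + (SOME b. b \<in> Basis)))" using lip abs_ge_zero order_trans by blast
  then have L: "0 \<le> L" by (simp add: zero_le_mult_iff some_in_eq nonzero_Basis)
  have "\<bar>(LINT z|lborel. bump r 0 z * q (x + z)) - (LINT z|lborel. bump r (0::'a) z * q x)\<bar> \<le> ?c * (L * r)"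
  proof (rule weighted_integral_diff_le[OF int integrable_mult_left[OF integrable_bump] integrable_bump])
    fix z :: 'a assume "bump r 0 z \<noteq> 0"
    then have "norm z \<le> r" using bump_eq_0[OF r, of z 0] by (cases "z \<in> ball 0 r") auto
    then have "L * norm z \<le> L * r" using L by (rule mult_left_mono)
    then show "\<bar>q (x + z) - q x\<bar> \<le> L * r" using lip[of "x + z" x] by simp
  qed (use L r in \<open>simp_all add: bump_nonneg\<close>)
  then have *: "\<bar>(LINT z|lborel. bump r 0 z * q (x + z)) - ?c * q x\<bar> \<le> ?c * (L * r)" by simp
  have "mollify r q x - q x = ((LINT z|lborel. bump r 0 z * q (x + z)) - ?c * q x) / ?c"
    using bump_integral_pos[where 'a='a] by (simp add: mollify_def field_simps)
  with * show ?thesis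
    using bump_integral_pos[where 'a='a] by (simp add: abs_divide pos_divide_le_eq mult_ac)
qed

text \<open>After a translation the point \<open>x + v\<close> enters only through the bump, whose remainder of first order is
bounded by a multiple of \<open>(norm v)\<^sup>2\<close> on a fixed ball and vanishes outside of it. Since \<open>q\<close> is bounded
there, the remainder of the convolution is of second order as well.\<close>

lemma mollify_has_derivative:
  fixes q :: "'a::euclidean_space \<Rightarrow> real"
  assumes lip: "\<And>x y. \<bar>q x - q y\<bar> \<le> L * norm (x - y)"
  shows "(mollify r q has_derivative mollify_deriv r q x) (at x)"
proof -
  let ?c = "LINT z|lborel. bump r (0::'a) z"
  let ?I = "\<lambda>x. LINT z|lborel. bump r 0 z * q (x + z)"
  let ?D = "\<lambda>v. - (LINT z|lborel. bump_deriv r 0 z v * q (x + z))"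
  have q: "continuous_on UNIV q" by (rule continuous_on_lipschitz_real[OF lip])
  note int = integrable_bump_times[OF q]
  have [measurable]: "q \<in> borel_measurable borel" "bump r (0::'a) \<in> borel_measurable borel"
    "(\<lambda>z. bump_deriv r (0::'a) z v) \<in> borel_measurable borel" for v
    by (auto intro!: borel_measurable_continuous_onI q continuous_bump continuous_bump_deriv)
  have "compact ((\<lambda>z. q (x + z)) ` cball 0 (r + 1))"
    by (intro compact_continuous_image continuous_on_compose2[OF q] continuous_intros) auto
  then obtain Q where Q: "\<And>z. z \<in> cball 0 (r + 1) \<Longrightarrow> \<bar>q (x + z)\<bar> \<le> Q"
    by (metis bounded_iff compact_imp_bounded image_eqI real_norm_def)
  \<comment> \<open>The constant of the quadratic estimate times the size of \<open>q\<close> and the volume of the ball.\<close>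
  define K where "K = ((2 * r + 3)\<^sup>2 + 2 * r\<^sup>2) * Q * measure lborel (cball (0::'a) (r + 1))"
  have shift: "?I (x + v) = (LINT z|lborel. bump r 0 (z - v) * q (x + z))"
    "integrable lborel (\<lambda>z. bump r 0 (z - v) * q (x + z))" for v
  proof -
    have eq: "(\<lambda>z. bump r 0 (z - v) * q (x + z)) = (\<lambda>z. (\<lambda>z. bump r 0 z * q (x + v + z)) (z + (- v)))"
      by (simp add: add_ac)
    show "?I (x + v) = (LINT z|lborel. bump r 0 (z - v) * q (x + z))"
      unfolding eq by (subst lborel_integral_translate(1)) auto
    show "integrable lborel (\<lambda>z. bump r 0 (z - v) * q (x + z))"
      unfolding eq by (subst lborel_integral_translate(2)) (auto intro: int)
  qed
  have rem: "\<bar>?I (x + v) - ?I x - ?D v\<bar> \<le> K * (norm v)\<^sup>2" if v: "norm v \<le> 1" for v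
  proof -
    have lin: "bump_deriv r 0 z (- v) = - bump_deriv r 0 z v" for z :: 'a
      by (simp add: bump_deriv_def)
    have "?I (x + v) - ?I x - ?D v = (LINT z|lborel. bump r 0 (z - v) * q (x + z)
        - bump r 0 z * q (x + z) + bump_deriv r 0 z v * q (x + z))"
      using int shift(2)[of v] by (simp add: shift(1))
    also have "\<bar>\<dots>\<bar> \<le> (LINT z|lborel. ((2 * r + 3)\<^sup>2 + 2 * r\<^sup>2) * (norm v)\<^sup>2 * Q * indicator (cball (0::'a) (r + 1)) z)"
    proof (rule integral_abs_bound[THEN order_trans], rule integral_mono)
      show "integrable lborel (\<lambda>z. \<bar>bump r 0 (z - v) * q (x + z) - bump r 0 z * q (x + z) + bump_deriv r 0 z v * q (x + z)\<bar>)"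
        using int shift(2)[of v] by (intro integrable_abs Bochner_Integration.integrable_add Bochner_Integration.integrable_diff) auto
      show "integrable lborel (\<lambda>z. ((2 * r + 3)\<^sup>2 + 2 * r\<^sup>2) * (norm v)\<^sup>2 * Q * indicator (cball (0::'a) (r + 1)) z)"
        by (intro integrable_mult_right integrable_real_indicator) (use emeasure_bounded_finite[OF bounded_cball] in auto)
      fix z :: 'a
      have "bump r 0 (z - v) * q (x + z) - bump r 0 z * q (x + z) + bump_deriv r 0 z v * q (x + z)
         = (bump r 0 (z + - v) - bump r 0 z - bump_deriv r 0 z (- v)) * q (x + z)"
        by (simp add: lin algebra_simps)
      also have "\<bar>\<dots>\<bar> \<le> ((2 * r + 3)\<^sup>2 + 2 * r\<^sup>2) * (norm v)\<^sup>2 * indicator (cball 0 (r + 1)) z * \<bar>q (x + z)\<bar>"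
        unfolding abs_mult using bump_quadratic_estimate[of "-v" z] v by (intro mult_right_mono) auto
      also have "\<dots> \<le> ((2 * r + 3)\<^sup>2 + 2 * r\<^sup>2) * (norm v)\<^sup>2 * Q * indicator (cball (0::'a) (r + 1)) z"
        using Q[of z] by (auto simp: indicator_def intro!: mult_left_mono)
      finally show "\<bar>bump r 0 (z - v) * q (x + z) - bump r 0 z * q (x + z) + bump_deriv r 0 z v * q (x + z)\<bar> \<le> \<dots>" .
    qed
    also have "\<dots> = K * (norm v)\<^sup>2" by (simp add: K_def)
    finally show ?thesis .
  qed
  have "(?I has_derivative ?D) (at x)"
    unfolding has_derivative_at
  proof
    show "bounded_linear ?D"
    proof (rule linear_conv_bounded_linear[THEN iffD1])
      show "linear ?D"
      proof (rule linearI)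
        fix v w :: 'a
        have "bump_deriv r 0 z (v + w) * q (x + z) = bump_deriv r 0 z v * q (x + z) + bump_deriv r 0 z w * q (x + z)" for z :: 'a
          by (simp add: bump_deriv_def algebra_simps inner_add_right)
        then show "?D (v + w) = ?D v + ?D w"
          using int(2) by simp
      next
        fix c :: real and v :: 'a
        have "bump_deriv r 0 z (c *\<^sub>R v) = c * bump_deriv r 0 z v" for z :: 'a
          by (simp add: bump_deriv_def)
        then show "?D (c *\<^sub>R v) = c *\<^sub>R ?D v" by (simp add: mult.assoc)
      qed
    qed
    show "(\<lambda>v. norm (?I (x + v) - ?I x - ?D v) / norm v) \<midarrow>0\<rightarrow> 0"
    proof (rule Lim_null_comparison)
      show "\<forall>\<^sub>F v in at 0. norm (norm (?I (x + v) - ?I x - ?D v) / norm v) \<le> K * norm v"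
        unfolding eventually_at
      proof (intro exI[of _ 1] conjI ballI impI)
        fix v :: 'a assume "v \<noteq> 0 \<and> dist v 0 < 1"
        then show "norm (norm (?I (x + v) - ?I x - ?D v) / norm v) \<le> K * norm v"
          using rem[of v] by (simp add: divide_le_eq power2_eq_square mult_ac)
      qed auto
      show "(\<lambda>v. K * norm v) \<midarrow>0\<rightarrow> 0"
        by (rule tendsto_eq_intros | simp)+
    qed
  qed
  then show ?thesis
    unfolding mollify_def mollify_deriv_def
    by (auto intro!: derivative_eq_intros simp: divide_inverse)
qed

lemma mollify_deriv_bound:
  fixes q :: "'a::euclidean_space \<Rightarrow> real"
  assumes q: "continuous_on UNIV q" and bound: "\<And>x. \<bar>q x\<bar> \<le> B"
  shows "\<bar>mollify_deriv r q x v\<bar> \<le> B * (4 * r ^ 3 * measure lborel (ball (0::'a) r) / (LINT z|lborel. bump r (0::'a) z)) * norm v"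
proof -
  have "\<bar>(LINT z|lborel. bump_deriv r 0 z v * q (x + z)) - (LINT z|lborel. bump_deriv r (0::'a) z v * 0)\<bar>
     \<le> (LINT z|lborel. 4 * r ^ 3 * norm v * indicator (ball (0::'a) r) z) * B"
  proof (rule weighted_integral_diff_le[OF integrable_bump_times(2)[OF q] _ integrable_bump_deriv_bound bump_deriv_le_indicator])
    show "B \<ge> 0" using bound[of x] by linarith
  qed (use bound in simp_all)
  then show ?thesis
    using bump_integral_pos[where 'a='a]
    by (simp add: mollify_deriv_def abs_divide divide_right_mono mult_ac)
qed

lemma mollify_deriv_lipschitz:
  fixes q :: "'a::euclidean_space \<Rightarrow> real"
  assumes lip: "\<And>x y. \<bar>q x - q y\<bar> \<le> L * norm (x - y)"
  obtains L' where "\<And>x y. \<bar>mollify_deriv r q x v - mollify_deriv r q y v\<bar> \<le> L' * norm (x - y)"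
proof
  fix x y
  let ?c = "LINT z|lborel. bump r (0::'a) z"
  note int = integrable_bump_times(2)[OF continuous_on_lipschitz_real[OF lip]]
  have "\<bar>(LINT z|lborel. bump_deriv r 0 z v * q (x + z)) - (LINT z|lborel. bump_deriv r 0 z v * q (y + z))\<bar>
     \<le> (LINT z|lborel. 4 * r ^ 3 * norm v * indicator (ball (0::'a) r) z) * (L * norm (x - y))"
  proof (rule weighted_integral_diff_le[OF int int integrable_bump_deriv_bound bump_deriv_le_indicator])
    show "0 \<le> L * norm (x - y)" using lip[of x y] by linarith
    show "\<bar>q (x + z) - q (y + z)\<bar> \<le> L * norm (x - y)" for z
      using lip[of "x + z" "y + z"] by simp
  qed
  then show "\<bar>mollify_deriv r q x v - mollify_deriv r q y v\<bar>
      \<le> (4 * r ^ 3 * norm v * L * measure lborel (ball (0::'a) r) / ?c) * norm (x - y)"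
    using bump_integral_pos[where 'a='a]
    by (simp add: mollify_deriv_def diff_divide_distrib[symmetric] abs_divide divide_right_mono
         abs_minus_commute mult_ac)
qed

text \<open>For differentiable \<open>q\<close> the derivative can be moved from the bump to \<open>q\<close> by an integration by parts.\<close>

lemma mollify_deriv_eq_mollify:
  fixes q :: "'a::euclidean_space \<Rightarrow> real"
  assumes der: "\<And>x. (q has_derivative q' x) (at x)" and cont: "continuous_on UNIV (\<lambda>x. q' x v)"
  shows "mollify_deriv r q x v = mollify r (\<lambda>x. q' x v) x"
proof -
  have q: "continuous_on UNIV q"
    using der by (auto intro!: continuous_at_imp_continuous_on has_derivative_continuous)
  let ?u' = "\<lambda>z w. bump r 0 z * q' (x + z) w + bump_deriv r 0 z w * q (x + z)"
  have "(LINT z|lborel. ?u' z v) = 0"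
  proof (rule integral_directional_derivative_eq_0[where u="\<lambda>z. bump r 0 z * q (x + z)" and u'="?u'" and e=v])
    fix z
    have "((\<lambda>z. x + z) has_derivative (\<lambda>v. v)) (at z)"
      by (auto intro!: derivative_eq_intros)
    from has_derivative_compose[OF this der]
    show "((\<lambda>z. bump r 0 z * q (x + z)) has_derivative ?u' z) (at z)"
      by (intro has_derivative_mult bump_has_derivative)
    show "continuous_on UNIV (\<lambda>z. ?u' z v)"
      by (intro continuous_intros continuous_bump continuous_bump_deriv
          continuous_on_compose2[OF q] continuous_on_compose2[OF cont]) auto
    show "integrable lborel (\<lambda>z. ?u' z v)"
      by (intro Bochner_Integration.integrable_add integrable_bump_times(1)[OF cont] integrable_bump_times(2)[OF q])
  qed (rule integrable_bump_times(1)[OF q])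
  then have "(LINT z|lborel. bump r 0 z * q' (x + z) v) + (LINT z|lborel. bump_deriv r 0 z v * q (x + z)) = 0"
    by (simp add: Bochner_Integration.integral_add integrable_bump_times(1)[OF cont] integrable_bump_times(2)[OF q])
  then have "(LINT z|lborel. bump r 0 z * q' (x + z) v) = - (LINT z|lborel. bump_deriv r 0 z v * q (x + z))"
    by linarith
  then show ?thesis
    by (simp add: mollify_def mollify_deriv_def)
qed

end

text \<open>One mollification of a Lipschitz function has a Lipschitz gradient. The gradient of a
second mollification is the mollification of that gradient and hence differentiable again. Mollifying
preserves the Lipschitz constant, so the bound on \<open>u'\<close> is the same for all \<open>e\<close>; the bound \<open>C\<close> on the
second derivatives depends on \<open>e\<close> and serves integrability.\<close>

lemma lipschitz_C2_approximation:
  fixes h :: "'a::euclidean_space \<Rightarrow> real"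
  assumes h: "1-lipschitz_on UNIV h" and e: "e > 0"
  obtains u u' u'' C where
    "\<And>x. \<bar>u x - h x\<bar> \<le> e"
    "\<And>x. (u has_derivative u' x) (at x)" "\<And>x v. \<bar>u' x v\<bar> \<le> norm v"
    "\<And>v. continuous_on UNIV (\<lambda>x. u' x v)"
    "\<And>x v. ((\<lambda>x. u' x v) has_derivative u'' v x) (at x)"
    "\<And>v w. continuous_on UNIV (\<lambda>x. u'' v x w)"
    "\<And>v x w. \<bar>u'' v x w\<bar> \<le> C * norm v * norm w"
proof -
  define r where "r = e / 2"
  have r: "r > 0" using e by (simp add: r_def)
  have lip: "\<bar>h x - h y\<bar> \<le> 1 * norm (x - y)" for x y
    using h by (auto simp: lipschitz_on_def dist_norm)
  define q where "q = mollify r h"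
  define q' where "q' = mollify_deriv r h"
  have qlip: "\<bar>q x - q y\<bar> \<le> 1 * norm (x - y)" for x y
    unfolding q_def by (rule mollify_lipschitz[OF r lip])
  have qder: "(q has_derivative q' x) (at x)" for x
    unfolding q_def q'_def by (rule mollify_has_derivative[OF r lip])
  have q'lip: "\<exists>L. \<forall>x y. \<bar>q' x v - q' y v\<bar> \<le> L * norm (x - y)" for v
    unfolding q'_def using mollify_deriv_lipschitz[OF r lip] by metis
  then have q'cont: "continuous_on UNIV (\<lambda>x. q' x v)" for v
    by (meson continuous_on_lipschitz_real)
  have q'bound: "\<bar>q' x v\<bar> \<le> norm v" for x v
    using lipschitz_imp_derivative_bound[OF qlip qder] by simp
  define u where "u = mollify r q"
  define u' where "u' = (\<lambda>x v. mollify r (\<lambda>x. q' x v) x)"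
  define u'' where "u'' = (\<lambda>v. mollify_deriv r (\<lambda>x. q' x v))"
  define C where "C = 4 * r ^ 3 * measure lborel (ball (0::'a) r) / (LINT z|lborel. bump r (0::'a) z)"
  have ulip: "\<bar>u x - u y\<bar> \<le> 1 * norm (x - y)" for x y
    unfolding u_def by (rule mollify_lipschitz[OF r qlip])
  have "mollify_deriv r q = u'"
    unfolding u'_def by (intro ext mollify_deriv_eq_mollify[OF r qder q'cont])
  then have uder: "(u has_derivative u' x) (at x)" for x
    unfolding u_def using mollify_has_derivative[OF r qlip] by metis
  have u'der: "((\<lambda>x. u' x v) has_derivative u'' v x) (at x)" for x v
  proof -
    obtain L where "\<And>x y. \<bar>q' x v - q' y v\<bar> \<le> L * norm (x - y)" using q'lip by blast
    from mollify_has_derivative[OF r this] show ?thesis by (simp add: u'_def u''_def)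
  qed
  show thesis
  proof
    fix x v w
    show "\<bar>u x - h x\<bar> \<le> e"
      using mollify_close[OF r qlip, of x] mollify_close[OF r lip, of x]
      unfolding u_def q_def r_def by linarith
    show "(u has_derivative u' x) (at x)" by (rule uder)
    show "\<bar>u' x v\<bar> \<le> norm v"
      using lipschitz_imp_derivative_bound[OF ulip uder] by simp
    show "continuous_on UNIV (\<lambda>x. u' x v)"
      using u'der by (auto intro!: continuous_at_imp_continuous_on has_derivative_continuous)
    show "((\<lambda>x. u' x v) has_derivative u'' v x) (at x)" by (rule u'der)
    obtain L where "\<And>x y. \<bar>q' x v - q' y v\<bar> \<le> L * norm (x - y)" using q'lip by blast
    then obtain L' where "\<And>x y. \<bar>u'' v x w - u'' v y w\<bar> \<le> L' * norm (x - y)"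
      unfolding u''_def using mollify_deriv_lipschitz[OF r] by metis
    then show "continuous_on UNIV (\<lambda>x. u'' v x w)" by (rule continuous_on_lipschitz_real)
    show "\<bar>u'' v x w\<bar> \<le> C * norm v * norm w"
      using mollify_deriv_bound[OF r q'cont q'bound, of v x w] by (simp add: u''_def C_def mult_ac)
  qed
qed

section \<open>Normal approximation from a Stein identity\<close>

lemma linear_axis_sum:
  fixes f :: "real^'k::finite \<Rightarrow> real"
  assumes "linear f"
  shows "f v = (\<Sum>i\<in>UNIV. v $ i * f (axis i 1))"
proof -
  have "f v = f (\<Sum>i\<in>UNIV. v $ i *\<^sub>R axis i 1)"
    using basis_expansion[of v] by (simp add: scalar_mult_eq_scaleR)
  also have "\<dots> = (\<Sum>i\<in>UNIV. v $ i * f (axis i 1))"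
    using assms by (simp add: linear_sum linear_cmul)
  finally show ?thesis .
qed

lemma lebesgue_integral_abs_le:
  fixes f g :: "'x \<Rightarrow> real"
  assumes "integrable M f" "integrable M g" "\<And>x. x \<in> space M \<Longrightarrow> \<bar>f x\<bar> \<le> g x"
  shows "\<bar>LINT x|M. f x\<bar> \<le> (LINT x|M. g x)"
  by (rule integral_abs_bound[THEN order_trans], rule integral_mono) (use assms in auto)

text \<open>The hypothesis \<open>by_parts\<close> is what integration by parts on a manifold gives for eigenfunctions \<open>W $ i\<close>
with eigenvalues \<open>- \<nu> i\<close> when \<open>G i j\<close> is the inner product of the gradients of \<open>W $ i\<close> and \<open>W $ j\<close>. For a
standard Gaussian vector it holds with \<open>G i j = \<nu> i * (if i = j then 1 else 0)\<close>. The locale estimates the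
distance to the Gaussian by the deviation of \<open>G\<close> from this value. The bound \<open>R\<close> provides integrability.\<close>

locale stein_data = prob_space \<mu> for \<mu> :: "'x measure" +
  fixes W :: "'x \<Rightarrow> real^'k::finite" and G :: "'k \<Rightarrow> 'k \<Rightarrow> 'x \<Rightarrow> real" and \<nu> :: "'k \<Rightarrow> real" and R :: real
  assumes W_measurable [measurable]: "W \<in> borel_measurable \<mu>"
    and G_measurable [measurable]: "\<And>i j. G i j \<in> borel_measurable \<mu>"
    and W_bounded: "\<And>x. x \<in> space \<mu> \<Longrightarrow> norm (W x) \<le> R"
    and G_bounded: "\<And>x i j. x \<in> space \<mu> \<Longrightarrow> \<bar>G i j x\<bar> \<le> R"
    and \<nu>_pos: "\<And>i. \<nu> i > 0"
    and by_parts: "\<And>q i. Ck_on (Suc 0) UNIV q \<Longrightarrow>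
      \<nu> i * (LINT x|\<mu>. W x $ i * q (W x))
        = (LINT x|\<mu>. (\<Sum>j\<in>UNIV. frechet_derivative q (at (W x)) (axis j 1) * G i j x))"
begin

definition B :: "'k \<Rightarrow> 'k \<Rightarrow> 'x \<Rightarrow> real" where
  "B i j x = G i j x / \<nu> i - (if i = j then 1 else 0)"

definition defect :: "'x \<Rightarrow> real" where
  "defect x = sqrt (\<Sum>i\<in>UNIV. \<Sum>j\<in>UNIV. (B i j x)\<^sup>2)"

lemma B_measurable [measurable]: "B i j \<in> borel_measurable \<mu>"
  unfolding B_def by measurable

lemma defect_measurable [measurable]: "defect \<in> borel_measurable \<mu>"
  unfolding defect_def by measurable

lemma R_nonneg: "R \<ge> 0"
  using W_bounded not_empty norm_ge_zero order_trans by blast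

lemma integrable_bounded:
  "F \<in> borel_measurable \<mu> \<Longrightarrow> (\<And>x. x \<in> space \<mu> \<Longrightarrow> \<bar>F x\<bar> \<le> K) \<Longrightarrow> integrable \<mu> F"
  for F :: "'x \<Rightarrow> real"
  by (rule integrable_const_bound[where B=K]) auto

lemma B_bound: "x \<in> space \<mu> \<Longrightarrow> \<bar>B i j x\<bar> \<le> R / \<nu> i + 1"
proof -
  assume x: "x \<in> space \<mu>"
  have "\<bar>G i j x / \<nu> i\<bar> \<le> R / \<nu> i"
    using G_bounded[OF x, of i j] \<nu>_pos[of i] by (simp add: abs_divide divide_right_mono)
  moreover have "\<bar>if i = j then 1 else 0 :: real\<bar> \<le> 1" by simp
  ultimately show ?thesis
    using abs_triangle_ineq4[of "G i j x / \<nu> i" "if i = j then 1 else 0"]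
    unfolding B_def by linarith
qed

lemma integrable_defect: "integrable \<mu> defect"
proof (rule integrable_bounded)
  fix x assume x: "x \<in> space \<mu>"
  have "(\<Sum>i\<in>UNIV. \<Sum>j\<in>UNIV. (B i j x)\<^sup>2) \<le> (\<Sum>i\<in>UNIV. \<Sum>j\<in>(UNIV::'k set). (R / \<nu> i + 1)\<^sup>2)"
    by (intro sum_mono power2_le_iff_abs_le[THEN iffD2] B_bound x)
       (auto intro!: add_nonneg_nonneg divide_nonneg_pos R_nonneg \<nu>_pos)
  then show "\<bar>defect x\<bar> \<le> sqrt (\<Sum>i\<in>UNIV. \<Sum>j\<in>(UNIV::'k set). (R / \<nu> i + 1)\<^sup>2)"
    by (simp add: defect_def sum_nonneg)
qed simp

sublocale pr: pair_prob_space \<mu> "gaussian :: (real^'k) measure"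
  using prob_space_gaussian by (intro pair_prob_space.intro pair_sigma_finite.intro prob_space_imp_sigma_finite)
    (simp_all add: prob_space_axioms)

lemma integrable_product:
  fixes F :: "'x \<times> (real^'k) \<Rightarrow> real"
  assumes [measurable]: "F \<in> borel_measurable (\<mu> \<Otimes>\<^sub>M borel)"
    and bound: "\<And>x z. x \<in> space \<mu> \<Longrightarrow> \<bar>F (x, z)\<bar> \<le> K * (1 + norm z)\<^sup>2"
  shows "integrable (\<mu> \<Otimes>\<^sub>M gaussian) F"
proof (rule pr.Fubini_integrable)
  let ?I = "LINT z|gaussian. K * (1 + norm (z::real^'k))\<^sup>2"
  have K: "0 \<le> K" using bound[of _ 0] not_empty by fastforce
  have sets_eq: "sets (\<mu> \<Otimes>\<^sub>M gaussian) = sets (\<mu> \<Otimes>\<^sub>M (borel :: (real^'k) measure))"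
    by (intro sets_pair_measure_cong) auto
  show F: "F \<in> borel_measurable (\<mu> \<Otimes>\<^sub>M gaussian)"
    by (subst measurable_cong_sets[OF sets_eq refl]) measurable
  have Fz [measurable]: "(\<lambda>z. F (x, z)) \<in> borel_measurable borel" if "x \<in> space \<mu>" for x
    using that by measurable
  have int: "integrable gaussian (\<lambda>z. F (x, z))" if "x \<in> space \<mu>" for x
    using that bound by (intro integrable_gaussian_quadratic) auto
  show "AE x in \<mu>. integrable gaussian (\<lambda>z. F (x, z))"
    using int by (intro AE_I2)
  have q: "integrable gaussian (\<lambda>z::real^'k. K * (1 + norm z)\<^sup>2)"
    using K by (intro integrable_gaussian_quadratic[where C=K]) auto
  show "integrable \<mu> (\<lambda>x. LINT z|gaussian. norm (F (x, z)))"
  proof (rule integrable_bounded)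
    show "(\<lambda>x. LINT z|gaussian. norm (F (x, z))) \<in> borel_measurable \<mu>"
      using F by measurable
    fix x assume x: "x \<in> space \<mu>"
    have "(LINT z|gaussian. norm (F (x, z))) \<le> ?I"
      using int[OF x] q bound[OF x] by (intro integral_mono integrable_norm) auto
    then show "\<bar>LINT z|gaussian. norm (F (x, z))\<bar> \<le> ?I"
      by (simp add: integral_nonneg_AE)
  qed
qed

context
  fixes u :: "real^'k \<Rightarrow> real" and u' u'' and C :: real
  assumes du: "\<And>y. (u has_derivative u' y) (at y)" and u'_le: "\<And>y v. \<bar>u' y v\<bar> \<le> norm v"
    and cont_u': "\<And>v. continuous_on UNIV (\<lambda>y. u' y v)"
    and du': "\<And>y v. ((\<lambda>y. u' y v) has_derivative u'' v y) (at y)"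
    and cont_u'': "\<And>v w. continuous_on UNIV (\<lambda>y. u'' v y w)"
    and u''_le: "\<And>v y w. \<bar>u'' v y w\<bar> \<le> C * norm v * norm w"
begin

text \<open>The quarter circle from \<open>z\<close> at \<open>t = 0\<close> to \<open>W x\<close> at \<open>t = pi/2\<close>. For independent standard Gaussian
vectors in place of \<open>W x\<close> and \<open>z\<close> its law does not depend on \<open>t\<close>; in contrast to the parametrisation by
\<open>sqrt t\<close> and \<open>sqrt (1 - t)\<close> its velocity is bounded.\<close>

abbreviation path :: "real \<Rightarrow> 'x \<Rightarrow> real^'k \<Rightarrow> real^'k" where
  "path t x z \<equiv> sin t *\<^sub>R W x + cos t *\<^sub>R z"

lemma u_measurable [measurable]: "u \<in> borel_measurable borel"
  using du by (intro borel_measurable_continuous_onI)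
    (auto intro!: continuous_at_imp_continuous_on has_derivative_continuous)

lemma u'_measurable [measurable]: "(\<lambda>y. u' y v) \<in> borel_measurable borel"
  by (intro borel_measurable_continuous_onI cont_u')

lemma u''_measurable [measurable]: "(\<lambda>y. u'' v y w) \<in> borel_measurable borel"
  by (intro borel_measurable_continuous_onI cont_u'')

lemma u'_sum: "u' y v = (\<Sum>i\<in>UNIV. v $ i * u' y (axis i 1))"
  by (rule linear_axis_sum[OF has_derivative_linear[OF du]])

lemma u'_axis_le: "\<bar>u' y (axis i 1)\<bar> \<le> 1"
  using u'_le[of y "axis i 1"] by simp

lemma u''_axis_le: "\<bar>u'' (axis i 1) y (axis j 1)\<bar> \<le> C"
  using u''_le[of "axis i 1" y "axis j 1"] by simp

lemma C_nonneg: "C \<ge> 0"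
  using u''_axis_le[of undefined undefined undefined] by linarith

lemma by_parts_path:
  "\<nu> i * (LINT x|\<mu>. W x $ i * u' (path t x z) (axis i 1))
    = sin t * (LINT x|\<mu>. (\<Sum>j\<in>UNIV. u'' (axis i 1) (path t x z) (axis j 1) * G i j x))"
proof -
  let ?q = "\<lambda>w. u' (sin t *\<^sub>R w + cos t *\<^sub>R z) (axis i 1)"
  have q: "(?q has_derivative (\<lambda>v. u'' (axis i 1) (sin t *\<^sub>R w + cos t *\<^sub>R z) (sin t *\<^sub>R v))) (at w)" for w
  proof -
    have "((\<lambda>w. sin t *\<^sub>R w + cos t *\<^sub>R z) has_derivative (\<lambda>v. sin t *\<^sub>R v)) (at w)"
      by (auto intro!: derivative_eq_intros)
    from has_derivative_compose[OF this du'] show ?thesis .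
  qed
  have "Ck_on (Suc 0) UNIV ?q"
    by (rule C1_onI[OF q]) (intro continuous_on_compose2[OF cont_u''] continuous_intros, auto)
  moreover have "frechet_derivative ?q (at w) (axis j 1)
      = sin t * u'' (axis i 1) (sin t *\<^sub>R w + cos t *\<^sub>R z) (axis j 1)" for w j
    unfolding frechet_derivative_at[OF q, symmetric]
    using linear_cmul[OF has_derivative_linear[OF du']] by simp
  ultimately have "\<nu> i * (LINT x|\<mu>. W x $ i * ?q (W x))
      = (LINT x|\<mu>. (\<Sum>j\<in>UNIV. (sin t * u'' (axis i 1) (path t x z) (axis j 1)) * G i j x))"
    using by_parts[of ?q i] by simp
  also have "\<dots> = (LINT x|\<mu>. sin t * (\<Sum>j\<in>UNIV. u'' (axis i 1) (path t x z) (axis j 1) * G i j x))"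
    by (simp add: sum_distrib_left mult_ac)
  also have "\<dots> = sin t * (LINT x|\<mu>. (\<Sum>j\<in>UNIV. u'' (axis i 1) (path t x z) (axis j 1) * G i j x))"
    by simp
  finally show ?thesis .
qed

text \<open>In combination with the previous identity, this removes the second derivatives of \<open>u\<close>, for
which there is no bound that is uniform over the approximations of a Lipschitz function.\<close>

lemma gaussian_by_parts_path:
  "(LINT z|gaussian. cos t * u'' (axis i 1) (path t x z) (axis j 1))
    = (LINT z|gaussian. z $ j * u' (path t x z) (axis i 1))"
proof -
  let ?F' = "\<lambda>z v. u'' (axis i 1) (path t x z) (cos t *\<^sub>R v)"
  have lin: "?F' z (axis j 1) = cos t * u'' (axis i 1) (path t x z) (axis j 1)" for z
    using linear_cmul[OF has_derivative_linear[OF du']] by simp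
  have "(LINT z|gaussian. ?F' z (axis j 1)) = (LINT z|gaussian. (z \<bullet> axis j 1) * u' (path t x z) (axis i 1))"
  proof (rule gaussian_integration_by_parts[where C="C + 1" and F="\<lambda>z. u' (path t x z) (axis i 1)" and F'="?F'"])
    fix z
    have "((\<lambda>z. path t x z) has_derivative (\<lambda>v. cos t *\<^sub>R v)) (at z)"
      by (auto intro!: derivative_eq_intros)
    from has_derivative_compose[OF this du']
    show "((\<lambda>z. u' (path t x z) (axis i 1)) has_derivative ?F' z) (at z)" .
    show "\<bar>u' (path t x z) (axis i 1)\<bar> \<le> (C + 1) * (1 + norm z)"
    proof -
      have "1 * 1 \<le> (C + 1) * (1 + norm z)" using C_nonneg by (intro mult_mono) auto
      then show ?thesis using u'_axis_le[of "path t x z" i] by linarith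
    qed
    have "\<bar>cos t\<bar> * \<bar>u'' (axis i 1) (path t x z) (axis j 1)\<bar> \<le> 1 * C"
      by (intro mult_mono u''_axis_le) auto
    then show "\<bar>?F' z (axis j 1)\<bar> \<le> C + 1"
      unfolding lin by (simp add: abs_mult)
  next
    show "continuous_on UNIV (\<lambda>z. ?F' z (axis j 1))"
      by (intro continuous_on_compose2[OF cont_u''] continuous_intros) auto
  qed
  then show ?thesis unfolding lin by (simp add: inner_axis)
qed

text \<open>The left-hand side is the derivative at \<open>t\<close> of the mean of \<open>u\<close> along the path. The part of the velocity
in the direction \<open>W\<close> produces, by the two integrations by parts, the terms
\<open>sin t * (G i j / \<nu> i) * z $ j * u' (axis i 1)\<close>. The part in the direction \<open>z\<close> already has this shape with
the identity matrix instead of \<open>G i j / \<nu> i\<close>, so the matrix \<open>B\<close> remains.\<close>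

lemma derivative_identity:
  "(LINT x|\<mu>. LINT z|gaussian. u' (path t x z) (cos t *\<^sub>R W x - sin t *\<^sub>R z))
    = sin t * (LINT x|\<mu>. LINT z|gaussian. u' (path t x z) (\<chi> i. \<Sum>j\<in>UNIV. B i j x * z $ j))"
proof -
  let ?P = "\<mu> \<Otimes>\<^sub>M (gaussian :: (real^'k) measure)"
  let ?d = "\<lambda>i x z. u' (path t x z) (axis i 1)"
  let ?dd = "\<lambda>i j x z. u'' (axis i 1) (path t x z) (axis j 1)"
  have one: "1 \<le> (1 + norm z)\<^sup>2" "norm z \<le> (1 + norm z)\<^sup>2" for z :: "real^'k"
    by (auto simp: power2_eq_square algebra_simps intro: add_increasing2)
  have comp_le: "\<bar>z $ j\<bar> \<le> (1 + norm z)\<^sup>2" for z :: "real^'k" and j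
    using component_le_norm_cart[of z j] one(2)[of z] by linarith
  have i1: "integrable ?P (\<lambda>(x, z). W x $ i * ?d i x z)" for i
  proof (rule integrable_product[where K=R])
    fix x and z :: "real^'k" assume x: "x \<in> space \<mu>"
    have "\<bar>W x $ i\<bar> * \<bar>?d i x z\<bar> \<le> R * 1"
      using W_bounded[OF x] component_le_norm_cart[of "W x" i] R_nonneg by (intro mult_mono u'_axis_le) auto
    also have "\<dots> \<le> R * (1 + norm z)\<^sup>2" by (intro mult_left_mono one R_nonneg)
    finally show "\<bar>case (x, z) of (x, z) \<Rightarrow> W x $ i * ?d i x z\<bar> \<le> R * (1 + norm z)\<^sup>2"
      by (simp add: abs_mult)
  qed measurable
  have i2: "integrable ?P (\<lambda>(x, z). z $ j * ?d i x z)" for i j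
  proof (rule integrable_product[where K=1])
    fix x and z :: "real^'k" assume x: "x \<in> space \<mu>"
    have "\<bar>z $ j\<bar> * \<bar>?d i x z\<bar> \<le> (1 + norm z)\<^sup>2 * 1"
      by (intro mult_mono u'_axis_le comp_le) auto
    then show "\<bar>case (x, z) of (x, z) \<Rightarrow> z $ j * ?d i x z\<bar> \<le> 1 * (1 + norm z)\<^sup>2"
      by (simp add: abs_mult)
  qed measurable
  have i3: "integrable ?P (\<lambda>(x, z). G i j x * (z $ j * ?d i x z))" for i j
  proof (rule integrable_product[where K=R])
    fix x and z :: "real^'k" assume x: "x \<in> space \<mu>"
    have "\<bar>G i j x\<bar> * (\<bar>z $ j\<bar> * \<bar>?d i x z\<bar>) \<le> R * ((1 + norm z)\<^sup>2 * 1)"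
      using R_nonneg by (intro mult_mono u'_axis_le comp_le G_bounded x) auto
    then show "\<bar>case (x, z) of (x, z) \<Rightarrow> G i j x * (z $ j * ?d i x z)\<bar> \<le> R * (1 + norm z)\<^sup>2"
      by (simp add: abs_mult)
  qed measurable
  have i4: "integrable ?P (\<lambda>(x, z). ?dd i j x z * G i j x)" for i j
  proof (rule integrable_product[where K="C * R"])
    fix x and z :: "real^'k" assume x: "x \<in> space \<mu>"
    have "\<bar>?dd i j x z\<bar> * \<bar>G i j x\<bar> \<le> C * R"
      using C_nonneg by (intro mult_mono u''_axis_le G_bounded x) auto
    also have "\<dots> \<le> C * R * (1 + norm z)\<^sup>2"
      using mult_left_mono[OF one(1)[of z], of "C * R"] C_nonneg R_nonneg by simp
    finally show "\<bar>case (x, z) of (x, z) \<Rightarrow> ?dd i j x z * G i j x\<bar> \<le> C * R * (1 + norm z)\<^sup>2"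
      by (simp add: abs_mult)
  qed measurable
  have main: "cos t * (\<integral>p. (case p of (x, z) \<Rightarrow> W x $ i * ?d i x z) \<partial>?P)
      = sin t * (\<Sum>j\<in>UNIV. (\<integral>p. (case p of (x, z) \<Rightarrow> G i j x * (z $ j * ?d i x z)) \<partial>?P)) / \<nu> i" for i
  proof -
    have "\<nu> i * (\<integral>p. (case p of (x, z) \<Rightarrow> W x $ i * ?d i x z) \<partial>?P)
        = (LINT z|gaussian. \<nu> i * (LINT x|\<mu>. W x $ i * ?d i x z))"
      using pr.integral_snd[OF i1[of i]] by simp
    also have "\<dots> = (LINT z|gaussian. sin t * (LINT x|\<mu>. (\<Sum>j\<in>UNIV. ?dd i j x z * G i j x)))"
      by (simp only: by_parts_path)
    also have "\<dots> = sin t * (\<integral>p. (case p of (x, z) \<Rightarrow> (\<Sum>j\<in>UNIV. ?dd i j x z * G i j x)) \<partial>?P)"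
    proof -
      have "integrable ?P (\<lambda>(x, z). (\<Sum>j\<in>UNIV. ?dd i j x z * G i j x))"
        using i4[of i] by (simp add: case_prod_unfold)
      from pr.integral_snd[OF this] show ?thesis by simp
    qed
    also have "(\<integral>p. (case p of (x, z) \<Rightarrow> (\<Sum>j\<in>UNIV. ?dd i j x z * G i j x)) \<partial>?P)
        = (\<Sum>j\<in>UNIV. (\<integral>p. (case p of (x, z) \<Rightarrow> ?dd i j x z * G i j x) \<partial>?P))"
      using i4[of i] by (simp add: case_prod_unfold)
    finally have 1: "\<nu> i * (\<integral>p. (case p of (x, z) \<Rightarrow> W x $ i * ?d i x z) \<partial>?P)
        = sin t * (\<Sum>j\<in>UNIV. (\<integral>p. (case p of (x, z) \<Rightarrow> ?dd i j x z * G i j x) \<partial>?P))" .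
    have 2: "cos t * (\<integral>p. (case p of (x, z) \<Rightarrow> ?dd i j x z * G i j x) \<partial>?P)
        = (\<integral>p. (case p of (x, z) \<Rightarrow> G i j x * (z $ j * ?d i x z)) \<partial>?P)" for j
    proof -
      have "cos t * (\<integral>p. (case p of (x, z) \<Rightarrow> ?dd i j x z * G i j x) \<partial>?P)
          = (LINT x|\<mu>. cos t * (LINT z|gaussian. ?dd i j x z * G i j x))"
        using pr.integral_fst[OF i4[of i j]] by simp
      also have "\<dots> = (LINT x|\<mu>. G i j x * (LINT z|gaussian. cos t * ?dd i j x z))"
        by (simp add: mult_ac)
      also have "\<dots> = (LINT x|\<mu>. (LINT z|gaussian. G i j x * (z $ j * ?d i x z)))"
        by (simp only: gaussian_by_parts_path[symmetric] integral_mult_right_zero)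
      also have "\<dots> = (\<integral>p. (case p of (x, z) \<Rightarrow> G i j x * (z $ j * ?d i x z)) \<partial>?P)"
        using pr.integral_fst[OF i3[of i j]] by simp
      finally show ?thesis .
    qed
    have "\<nu> i * (cos t * (\<integral>p. (case p of (x, z) \<Rightarrow> W x $ i * ?d i x z) \<partial>?P))
       = sin t * (\<Sum>j\<in>UNIV. cos t * (\<integral>p. (case p of (x, z) \<Rightarrow> ?dd i j x z * G i j x) \<partial>?P))"
      using 1 by (simp add: sum_distrib_left[symmetric] algebra_simps)
    then show ?thesis
      unfolding 2 using \<nu>_pos[of i] by (simp add: field_simps)
  qed
  have lhs: "u' (path t x z) (cos t *\<^sub>R W x - sin t *\<^sub>R z)
      = (\<Sum>i\<in>UNIV. cos t * (W x $ i * ?d i x z) - sin t * (z $ i * ?d i x z))" for x z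
    by (subst u'_sum) (simp add: algebra_simps)
  have rhs: "u' (path t x z) (\<chi> i. \<Sum>j\<in>UNIV. B i j x * z $ j)
      = (\<Sum>i\<in>UNIV. (\<Sum>j\<in>UNIV. G i j x * (z $ j * ?d i x z)) / \<nu> i - z $ i * ?d i x z)" for x z
  proof -
    have "(\<Sum>j\<in>UNIV. B i j x * z $ j) * ?d i x z
        = (\<Sum>j\<in>UNIV. G i j x * (z $ j * ?d i x z)) / \<nu> i - z $ i * ?d i x z" for i
    proof -
      have "B i j x * z $ j * ?d i x z = G i j x * (z $ j * ?d i x z) / \<nu> i
          - (if i = j then z $ j * ?d i x z else 0)" for j
        by (simp add: B_def algebra_simps)
      then show ?thesis
        by (simp add: sum_distrib_right sum_subtractf sum_divide_distrib)
    qed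
    then show ?thesis by (subst u'_sum) simp
  qed
  have il: "integrable ?P (\<lambda>(x, z). u' (path t x z) (cos t *\<^sub>R W x - sin t *\<^sub>R z))"
    unfolding lhs using i1 i2 by (simp add: case_prod_unfold)
  have ir: "integrable ?P (\<lambda>(x, z). u' (path t x z) (\<chi> i. \<Sum>j\<in>UNIV. B i j x * z $ j))"
    unfolding rhs using i2 i3 by (simp add: case_prod_unfold)
  have "(LINT x|\<mu>. LINT z|gaussian. u' (path t x z) (cos t *\<^sub>R W x - sin t *\<^sub>R z))
     = (\<integral>p. (case p of (x, z) \<Rightarrow> u' (path t x z) (cos t *\<^sub>R W x - sin t *\<^sub>R z)) \<partial>?P)"
    using pr.integral_fst[OF il] by simp
  also have "\<dots> = (\<Sum>i\<in>UNIV. cos t * (\<integral>p. (case p of (x, z) \<Rightarrow> W x $ i * ?d i x z) \<partial>?P)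
       - sin t * (\<integral>p. (case p of (x, z) \<Rightarrow> z $ i * ?d i x z) \<partial>?P))"
    unfolding lhs using i1 i2 by (simp add: case_prod_unfold)
  also have "\<dots> = sin t * (\<Sum>i\<in>UNIV. (\<Sum>j\<in>UNIV. (\<integral>p. (case p of (x, z) \<Rightarrow> G i j x * (z $ j * ?d i x z)) \<partial>?P)) / \<nu> i
       - (\<integral>p. (case p of (x, z) \<Rightarrow> z $ i * ?d i x z) \<partial>?P))"
    unfolding main by (simp add: sum_distrib_left algebra_simps)
  also have "\<dots> = sin t * (\<integral>p. (case p of (x, z) \<Rightarrow> u' (path t x z) (\<chi> i. \<Sum>j\<in>UNIV. B i j x * z $ j)) \<partial>?P)"
    unfolding rhs using i2 i3 by (simp add: case_prod_unfold)
  also have "\<dots> = sin t * (LINT x|\<mu>. LINT z|gaussian. u' (path t x z) (\<chi> i. \<Sum>j\<in>UNIV. B i j x * z $ j))"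
    using pr.integral_fst[OF ir] by simp
  finally show ?thesis .
qed

text \<open>Only the first derivative of \<open>u\<close> is left, and it has norm at most one. For fixed \<open>x\<close> the inner integral
is therefore at most the Gaussian mean of the norm of \<open>B z\<close>.\<close>

lemma derivative_bound:
  assumes "sin t \<ge> 0"
  shows "\<bar>LINT x|\<mu>. LINT z|gaussian. u' (path t x z) (cos t *\<^sub>R W x - sin t *\<^sub>R z)\<bar>
    \<le> sin t * (LINT x|\<mu>. defect x)"
proof -
  let ?I = "\<lambda>x. LINT z|gaussian. u' (path t x z) (\<chi> i. \<Sum>j\<in>UNIV. B i j x * z $ j)"
  have inner: "\<bar>?I x\<bar> \<le> defect x" for x
  proof -
    let ?N = "\<lambda>z. sqrt (\<Sum>i\<in>UNIV. (\<Sum>j\<in>UNIV. B i j x * z $ j)\<^sup>2)"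
    have "\<bar>?I x\<bar> \<le> (LINT z|gaussian. ?N z)"
    proof (rule lebesgue_integral_abs_le)
      show "integrable gaussian ?N" by (rule gaussian_norm_linear_image_le(2))
      have le: "\<bar>u' (path t x z) (\<chi> i. \<Sum>j\<in>UNIV. B i j x * z $ j)\<bar> \<le> ?N z" for z
        using u'_le[of "path t x z" "\<chi> i. \<Sum>j\<in>UNIV. B i j x * z $ j"]
        by (simp add: norm_vec_def L2_set_def)
      then show "\<bar>u' (path t x z) (\<chi> i. \<Sum>j\<in>UNIV. B i j x * z $ j)\<bar> \<le> ?N z" for z .
      have "(\<lambda>z. \<Sum>i\<in>UNIV. (\<Sum>j\<in>UNIV. B i j x * z $ j) * u' (path t x z) (axis i 1)) \<in> borel_measurable borel"
        by measurable
      then have "(\<lambda>z. u' (path t x z) (\<chi> i. \<Sum>j\<in>UNIV. B i j x * z $ j)) \<in> borel_measurable gaussian"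
        by (subst u'_sum) simp
      then show "integrable gaussian (\<lambda>z. u' (path t x z) (\<chi> i. \<Sum>j\<in>UNIV. B i j x * z $ j))"
        by (rule Bochner_Integration.integrable_bound[OF gaussian_norm_linear_image_le(2)[of "\<lambda>i j. B i j x"]])
           (use le in \<open>auto intro: order_trans[OF _ abs_ge_self]\<close>)
    qed
    also have "\<dots> \<le> defect x"
      unfolding defect_def by (rule gaussian_norm_linear_image_le(1))
    finally show ?thesis by simp
  qed
  have "\<bar>LINT x|\<mu>. ?I x\<bar> \<le> (LINT x|\<mu>. defect x)"
  proof (cases "integrable \<mu> ?I")
    case True
    then show ?thesis
      using inner lebesgue_integral_abs_le[OF True integrable_defect] by simp
  next
    case False
    then show ?thesis
      by (simp add: not_integrable_integral_eq defect_def sum_nonneg)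
  qed
  then show ?thesis
    unfolding derivative_identity using assms by (simp add: abs_mult mult_left_mono)
qed

text \<open>The fundamental theorem of calculus along each path, Fubini's theorem, and the integral of
\<^const>\<open>sin\<close> over the quarter circle, which is one.\<close>

lemma C2_bound: "\<bar>(LINT x|\<mu>. u (W x)) - (LINT z|gaussian. u z)\<bar> \<le> (LINT x|\<mu>. defect x)"
proof -
  let ?P = "\<mu> \<Otimes>\<^sub>M (gaussian :: (real^'k) measure)"
  let ?k = "\<lambda>t (x, z). u' (path t x z) (cos t *\<^sub>R W x - sin t *\<^sub>R z)"
  let ?K = "\<lambda>t p. ?k t p * indicator {0..pi/2} t"
  interpret L: pair_sigma_finite lborel ?P ..
  have k_sum: "?k t (x, z) = (\<Sum>i\<in>UNIV. (cos t * W x $ i - sin t * z $ i) * u' (path t x z) (axis i 1))" for t x z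
    by (simp, subst u'_sum) simp
  have k_le: "\<bar>?k t (x, z)\<bar> \<le> (R + 1) * (1 + norm z)\<^sup>2" if x: "x \<in> space \<mu>" for t x z
  proof -
    have "\<bar>?k t (x, z)\<bar> \<le> norm (cos t *\<^sub>R W x - sin t *\<^sub>R z)" by (simp add: u'_le)
    also have "\<dots> \<le> \<bar>cos t\<bar> * norm (W x) + \<bar>sin t\<bar> * norm z"
      using norm_triangle_ineq4[of "cos t *\<^sub>R W x" "sin t *\<^sub>R z"] by simp
    also have "\<dots> \<le> 1 * R + 1 * norm z"
      using W_bounded[OF x] by (intro add_mono mult_mono) auto
    also have "\<dots> \<le> (R + 1) * (1 + norm z)"
      using R_nonneg by (simp add: algebra_simps)
    also have "\<dots> \<le> (R + 1) * (1 + norm z)\<^sup>2"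
      using R_nonneg by (intro mult_left_mono) (auto simp: power2_eq_square algebra_simps)
    finally show ?thesis .
  qed
  have sets_eq: "sets (lborel \<Otimes>\<^sub>M ?P) = sets (borel \<Otimes>\<^sub>M (\<mu> \<Otimes>\<^sub>M (borel :: (real^'k) measure)))"
    by (intro sets_pair_measure_cong) auto
  have K_meas: "case_prod ?K \<in> borel_measurable (lborel \<Otimes>\<^sub>M ?P)"
    by (subst measurable_cong_sets[OF sets_eq refl])
       (unfold split_def prod.case k_sum[unfolded prod.case] , measurable)
  have k_int: "integrable ?P (?k t)" for t
  proof (rule integrable_product[OF _ k_le])
    show "?k t \<in> borel_measurable (\<mu> \<Otimes>\<^sub>M borel)"
      by (unfold split_def prod.case k_sum[unfolded prod.case] , measurable)
  qed
  have bnd_int: "integrable ?P (\<lambda>(x, z). (R + 1) * (1 + norm z)\<^sup>2)"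
    using R_nonneg by (intro integrable_product[where K="R + 1"]) auto
  let ?S = "\<integral>p. (case p of (x, z) \<Rightarrow> (R + 1) * (1 + norm z)\<^sup>2) \<partial>?P"
  have K_int: "integrable (lborel \<Otimes>\<^sub>M ?P) (case_prod ?K)"
  proof (rule L.Fubini_integrable[OF K_meas])
    show "AE t in lborel. integrable ?P (\<lambda>p. case (t, p) of (t, p) \<Rightarrow> ?K t p)"
      using k_int by simp
    show "integrable lborel (\<lambda>t. \<integral>p. norm (case (t, p) of (t, p) \<Rightarrow> ?K t p) \<partial>?P)"
    proof (rule Bochner_Integration.integrable_bound)
      show "integrable lborel (\<lambda>t. ?S * indicator {0..pi/2} t)"
        by (intro integrable_mult_right integrable_real_indicator) auto
      show "(\<lambda>t. \<integral>p. norm (case (t, p) of (t, p) \<Rightarrow> ?K t p) \<partial>?P) \<in> borel_measurable lborel"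
        using K_meas by measurable
      have "(\<integral>p. norm (?k t p) \<partial>?P) \<le> ?S" for t
        using k_int[of t] bnd_int
      proof (intro integral_mono_AE integrable_norm AE_I2)
        fix p assume "p \<in> space ?P"
        then show "norm (?k t p) \<le> (case p of (x, z) \<Rightarrow> (R + 1) * (1 + norm z)\<^sup>2)"
          using k_le by (cases p) (auto simp: space_pair_measure)
      qed
      then show "AE t in lborel. norm (\<integral>p. norm (case (t, p) of (t, p) \<Rightarrow> ?K t p) \<partial>?P) \<le> norm (?S * indicator {0..pi/2} t)"
        by (intro AE_I2) (auto simp: abs_mult indicator_def integral_nonneg_AE intro: order_trans[OF _ abs_ge_self])
    qed
  qed
  have ftc: "(LINT t|lborel. ?K t p) = u (W (fst p)) - u (snd p)" for p
  proof -
    obtain x z where p: "p = (x, z)" by fastforce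
    have "(LINT t|lborel. ?k t (x, z) * indicator {0..pi/2} t) = u (path (pi/2) x z) - u (path 0 x z)"
    proof (rule integral_FTC_Icc_real)
      fix t :: real
      have "((\<lambda>t. path t x z) has_derivative (\<lambda>s. s *\<^sub>R (cos t *\<^sub>R W x - sin t *\<^sub>R z))) (at t)"
        by (auto intro!: derivative_eq_intros simp: algebra_simps)
      from has_derivative_compose[OF this du]
      have "((\<lambda>t. u (path t x z)) has_derivative (\<lambda>s. u' (path t x z) (s *\<^sub>R (cos t *\<^sub>R W x - sin t *\<^sub>R z)))) (at t)" .
      then show "((\<lambda>t. u (path t x z)) has_real_derivative ?k t (x, z)) (at t)"
        using linear_cmul[OF has_derivative_linear[OF du]]
        by (simp add: has_field_derivative_def mult_commute_abs)
      have "continuous_on UNIV (\<lambda>t. ?k t (x, z))"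
        unfolding k_sum by (intro continuous_intros continuous_on_compose2[OF cont_u']) auto
      then show "isCont (\<lambda>t. ?k t (x, z)) t"
        by (simp add: continuous_on_eq_continuous_at)
    qed simp
    then show ?thesis by (simp add: p)
  qed
  have uW: "integrable ?P (\<lambda>p. u (W (fst p)))" and uz: "integrable ?P (\<lambda>p. u (snd p))"
  proof -
    have ulin: "\<bar>u y\<bar> \<le> \<bar>u 0\<bar> + norm y" for y
    proof -
      have "norm (u y - u 0) \<le> 1 * norm (y - 0)"
      proof (rule differentiable_bound[of UNIV u u'])
        show "onorm (u' x) \<le> 1" for x
          using u'_le by (intro onorm_le) (auto)
      qed (auto intro: du)
      then show ?thesis by simp
    qed
    have sq: "1 \<le> (1 + norm z)\<^sup>2" "norm z \<le> (1 + norm z)\<^sup>2" for z :: "real^'k"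
      by (auto simp: power2_eq_square algebra_simps intro: add_increasing2)
    have "\<bar>u (W (fst (x, z)))\<bar> \<le> (\<bar>u 0\<bar> + R) * (1 + norm z)\<^sup>2" if "x \<in> space \<mu>" for x z
    proof -
      have "\<bar>u (W (fst (x, z)))\<bar> \<le> (\<bar>u 0\<bar> + R) * 1" using ulin[of "W x"] W_bounded[OF that] by simp
      also have "\<dots> \<le> (\<bar>u 0\<bar> + R) * (1 + norm z)\<^sup>2"
        using R_nonneg by (intro mult_left_mono sq) auto
      finally show ?thesis .
    qed
    then show "integrable ?P (\<lambda>p. u (W (fst p)))"
      by (intro integrable_product) auto
    have "\<bar>u (snd (x, z))\<bar> \<le> (\<bar>u 0\<bar> + 1) * (1 + norm z)\<^sup>2" for x z
    proof -
      have "\<bar>u (snd (x, z))\<bar> \<le> \<bar>u 0\<bar> * 1 + 1 * norm z" using ulin[of z] by simp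
      also have "\<dots> \<le> \<bar>u 0\<bar> * (1 + norm z)\<^sup>2 + 1 * (1 + norm z)\<^sup>2"
        by (intro add_mono mult_left_mono sq) auto
      finally show ?thesis by (simp add: algebra_simps)
    qed
    then show "integrable ?P (\<lambda>p. u (snd p))"
      by (intro integrable_product) auto
  qed
  have eW: "(\<integral>p. u (W (fst p)) \<partial>?P) = (LINT x|\<mu>. u (W x))"
    using pr.integral_fst[of "\<lambda>x z. u (W x)"] uW pr.M2.prob_space by (simp add: case_prod_unfold)
  have ez: "(\<integral>p. u (snd p) \<partial>?P) = (LINT z|gaussian. u z)"
    using pr.integral_snd[of "\<lambda>x z. u z"] uz by (simp add: case_prod_unfold prob_space)
  have "(LINT x|\<mu>. u (W x)) - (LINT z|gaussian. u z) = (\<integral>p. u (W (fst p)) - u (snd p) \<partial>?P)"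
    using uW uz by (simp add: eW ez)
  also have "\<dots> = (\<integral>p. (LINT t|lborel. ?K t p) \<partial>?P)"
    by (simp only: ftc)
  also have "\<dots> = (LINT t|lborel. (\<integral>p. ?K t p \<partial>?P))"
    using L.Fubini_integral[OF K_int] by simp
  also have "\<bar>\<dots>\<bar> \<le> (LINT t|lborel. (LINT x|\<mu>. defect x) * (sin t * indicator {0..pi/2} t))"
  proof -
    have b: "\<bar>\<integral>p. ?K t p \<partial>?P\<bar> \<le> (LINT x|\<mu>. defect x) * (sin t * indicator {0..pi/2} t)" for t
    proof (cases "t \<in> {0..pi/2}")
      case True
      then have "sin t \<ge> 0" by (intro sin_ge_zero) auto
      have "(\<integral>p. ?k t p \<partial>?P) = (LINT x|\<mu>. LINT z|gaussian. ?k t (x, z))"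
        using pr.integral_fst'[OF k_int[of t]] by simp
      then show ?thesis
        using derivative_bound[OF \<open>sin t \<ge> 0\<close>] True by (simp add: mult.commute)
    qed simp
    have "\<bar>LINT t|lborel. (\<integral>p. ?K t p \<partial>?P)\<bar> \<le> (LINT t|lborel. (LINT x|\<mu>. defect x) * (sin t * indicator {0..pi/2} t))"
    proof (rule lebesgue_integral_abs_le[OF _ _ b])
      show "integrable lborel (\<lambda>t. \<integral>p. ?K t p \<partial>?P)"
        using L.integrable_fst[OF K_int] by simp
      show "integrable lborel (\<lambda>t. (LINT x|\<mu>. defect x) * (sin t * indicator {0..pi/2} t))"
        using borel_integrable_compact[of "{0..pi/2}" sin]
        by (intro integrable_mult_right) (auto simp: mult.commute continuous_on_sin)
    qed
    then show ?thesis by simp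
  qed
  also have "\<dots> = (LINT x|\<mu>. defect x)"
  proof -
    have "(LINT t|lborel. sin t * indicator {0..pi/2} t) = (- cos (pi/2)) - (- cos 0)"
      by (rule integral_FTC_Icc_real) (auto intro!: derivative_eq_intros continuous_intros)
    then show ?thesis by simp
  qed
  finally show ?thesis .
qed

end

theorem lipschitz_bound:
  assumes h: "1-lipschitz_on UNIV h"
  shows "\<bar>(LINT x|\<mu>. h (W x)) - (LINT z|gaussian. h z)\<bar> \<le> (LINT x|\<mu>. defect x)"
proof (rule field_le_epsilon)
  fix e :: real assume e: "e > 0"
  then have "e / 2 > 0" by simp
  from lipschitz_C2_approximation[OF h this] obtain u u' u'' C where
    close: "\<And>x. \<bar>u x - h x\<bar> \<le> e / 2" and du: "\<And>x. (u has_derivative u' x) (at x)" and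
    rest: "\<And>x v. \<bar>u' x v\<bar> \<le> norm v"
    "\<And>v. continuous_on UNIV (\<lambda>x. u' x v)"
    "\<And>x v. ((\<lambda>x. u' x v) has_derivative u'' v x) (at x)"
    "\<And>v w. continuous_on UNIV (\<lambda>x. u'' v x w)"
    "\<And>v x w. \<bar>u'' v x w\<bar> \<le> C * norm v * norm w" by blast
  have conth: "continuous_on UNIV h" using h by (rule lipschitz_on_continuous_on)
  have [measurable]: "h \<in> borel_measurable borel" "u \<in> borel_measurable borel"
    using conth du by (auto intro!: borel_measurable_continuous_onI
        continuous_at_imp_continuous_on has_derivative_continuous)
  have hlin: "\<bar>h y\<bar> \<le> \<bar>h 0\<bar> + norm y" for y
    using h[unfolded lipschitz_on_def, THEN conjunct2, rule_format, of y 0]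
    by (simp add: dist_norm)
  have i1: "integrable \<mu> (\<lambda>x. h (W x))"
    by (rule integrable_bounded[where K="\<bar>h 0\<bar> + R"])
       (use hlin W_bounded in \<open>auto intro: order_trans[OF hlin]\<close>)
  have i2: "integrable gaussian h"
  proof (rule integrable_gaussian_quadratic[where C="\<bar>h 0\<bar> + 1"])
    fix z :: "real^'k"
    have "\<bar>h 0\<bar> * 1 + 1 * norm z \<le> \<bar>h 0\<bar> * (1 + norm z)\<^sup>2 + 1 * (1 + norm z)\<^sup>2"
      by (intro add_mono mult_left_mono) (auto simp: power2_eq_square algebra_simps intro: add_increasing2)
    then show "\<bar>h z\<bar> \<le> (\<bar>h 0\<bar> + 1) * (1 + norm z)\<^sup>2"
      using hlin[of z] by (simp add: algebra_simps)
  qed auto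
  have d1: "integrable \<mu> (\<lambda>x. u (W x) - h (W x))"
    by (rule integrable_bounded[where K="e / 2"]) (use close in auto)
  have d2: "integrable gaussian (\<lambda>z. u z - h z)"
    by (rule pr.M2.integrable_const_bound[where B="e / 2"]) (use close in auto)
  have "\<bar>LINT x|\<mu>. u (W x) - h (W x)\<bar> \<le> (LINT x|\<mu>. e / 2)"
    using lebesgue_integral_abs_le[OF d1, of "\<lambda>_. e / 2"] close by simp
  then have 1: "\<bar>(LINT x|\<mu>. u (W x)) - (LINT x|\<mu>. h (W x))\<bar> \<le> e / 2"
    using Bochner_Integration.integral_add[OF d1 i1] by (simp add: prob_space)
  have "\<bar>LINT z|gaussian. u z - h z\<bar> \<le> (LINT z|(gaussian :: (real^'k) measure). e / 2)"
    using lebesgue_integral_abs_le[OF d2, of "\<lambda>_. e / 2"] close by simp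
  then have 2: "\<bar>(LINT z|gaussian. u z) - (LINT z|gaussian. h z)\<bar> \<le> e / 2"
    using Bochner_Integration.integral_add[OF d2 i2] pr.M2.prob_space by simp
  show "\<bar>(LINT x|\<mu>. h (W x)) - (LINT z|gaussian. h z)\<bar> \<le> (LINT x|\<mu>. defect x) + e"
    using C2_bound[OF du rest] 1 2 by linarith
qed

end

section \<open>Change of variables for an arbitrary finite index type\<close>

text \<open>The case of an infinite integral makes the change of variables formula for absolutely integrable
functions applicable to all nonnegative ones.\<close>

lemma nn_integral_eq_absolute_integral:
  fixes G :: "'a::euclidean_space \<Rightarrow> real"
  assumes meas: "(\<lambda>x. indicator S x * G x) \<in> borel_measurable borel" and nn: "\<And>x. x \<in> S \<Longrightarrow> G x \<ge> 0"
  shows "(\<integral>\<^sup>+x. ennreal (indicator S x * G x) \<partial>lborel)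
    = (if G absolutely_integrable_on S then ennreal (integral S G) else \<infinity>)"
proof -
  have nn': "0 \<le> indicator S x * G x" for x using nn by (auto simp: indicator_def)
  have iff: "G absolutely_integrable_on S \<longleftrightarrow> integrable lborel (\<lambda>x. indicator S x * G x)"
    unfolding set_integrable_def using integrable_completion[of "\<lambda>x. indicator S x * G x" lborel] meas by simp
  show ?thesis
  proof (cases "G absolutely_integrable_on S")
    case True
    have "(LINT x|lborel. indicator S x * G x) = (LINT x|lebesgue. indicator S x * G x)"
      using integral_completion[of "\<lambda>x. indicator S x * G x" lborel] meas by simp
    also have "\<dots> = integral S G"
      using set_lebesgue_integral_eq_integral(2)[OF True] by (simp add: set_lebesgue_integral_def)
    finally show ?thesis
      using True iff nn' by (simp add: nn_integral_eq_integral)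
  next
    case False
    have "(\<integral>\<^sup>+x. ennreal (indicator S x * G x) \<partial>lborel) = \<infinity>"
    proof (rule ccontr)
      assume "(\<integral>\<^sup>+x. ennreal (indicator S x * G x) \<partial>lborel) \<noteq> \<infinity>"
      then have "integrable lborel (\<lambda>x. indicator S x * G x)"
        using meas nn' by (intro integrableI_nonneg) (auto simp: less_top)
      with False iff show False by simp
    qed
    with False show ?thesis by simp
  qed
qed

lemma nn_change_of_variables_wellorder:
  fixes \<tau> :: "real^'n::{finite,wellorder} \<Rightarrow> real^'n::_" and f :: "real^'n::_ \<Rightarrow> real"
  assumes S: "S \<in> sets borel"
    and der: "\<And>x. x \<in> S \<Longrightarrow> (\<tau> has_derivative \<tau>' x) (at x)" and inj: "inj_on \<tau> S"
    and nn: "\<And>y. y \<in> \<tau> ` S \<Longrightarrow> f y \<ge> 0"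
    and meas: "(\<lambda>x. indicator S x * (\<bar>det (matrix (\<tau>' x))\<bar> * f (\<tau> x))) \<in> borel_measurable borel"
      "(\<lambda>y. indicator (\<tau> ` S) y * f y) \<in> borel_measurable borel"
  shows "(\<integral>\<^sup>+x. ennreal (indicator S x * (\<bar>det (matrix (\<tau>' x))\<bar> * f (\<tau> x))) \<partial>lborel)
    = (\<integral>\<^sup>+y. ennreal (indicator (\<tau> ` S) y * f y) \<partial>lborel)"
proof -
  let ?F = "\<lambda>x. \<bar>det (matrix (\<tau>' x))\<bar> * f (\<tau> x)"
  have "?F absolutely_integrable_on S \<and> integral S ?F = b
     \<longleftrightarrow> f absolutely_integrable_on (\<tau> ` S) \<and> integral (\<tau> ` S) f = b" for b
  proof -
    have Sl: "S \<in> sets lebesgue" using S by simp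
    show ?thesis
      using has_absolute_integral_change_of_variables[OF Sl has_derivative_at_withinI[OF der] inj,
          of "\<lambda>y. (vec (f y) :: real^1)" "vec b"]
      by (simp add: absolutely_integrable_on_1_iff integral_on_1_eq)
  qed
  then have "?F absolutely_integrable_on S \<longleftrightarrow> f absolutely_integrable_on (\<tau> ` S)"
    "?F absolutely_integrable_on S \<Longrightarrow> integral S ?F = integral (\<tau> ` S) f"
    by blast+
  then show ?thesis
    using nn by (subst (1 2) nn_integral_eq_absolute_integral) (auto intro: meas)
qed

text \<open>The change of variables formula above orders the coordinates. An arbitrary finite index type carries
no order, so its elements are wrapped in a copy that is ordered by an enumeration, and the formula is
transported along the relabelling of the coordinates.\<close>

typedef 'a ordered_copy = "UNIV :: 'a set" by auto

lemma bij_Rep_ordered_copy: "bij Rep_ordered_copy"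
  by (rule bij_betw_byWitness[where f'=Abs_ordered_copy])
     (auto simp: Rep_ordered_copy_inverse Abs_ordered_copy_inverse)

instance ordered_copy :: (finite) finite
proof
  show "finite (UNIV :: 'a ordered_copy set)"
    by (rule bij_betw_finite[OF bij_Rep_ordered_copy, THEN iffD2]) (rule finite)
qed

definition enumeration_index :: "'a::finite \<Rightarrow> nat" where
  "enumeration_index = (SOME f. inj f)"

lemma inj_enumeration_index: "inj (enumeration_index :: 'a::finite \<Rightarrow> nat)"
proof -
  have "\<exists>f :: 'a \<Rightarrow> nat. inj f"
    using finite_imp_inj_to_nat_seg[of "UNIV :: 'a set"] by auto
  then show ?thesis unfolding enumeration_index_def by (rule someI_ex)
qed

instantiation ordered_copy :: (finite) wellorder
begin

definition less_eq_ordered_copy :: "'a ordered_copy \<Rightarrow> 'a ordered_copy \<Rightarrow> bool" where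
  "x \<le> y \<longleftrightarrow> enumeration_index (Rep_ordered_copy x) \<le> enumeration_index (Rep_ordered_copy y)"

definition less_ordered_copy :: "'a ordered_copy \<Rightarrow> 'a ordered_copy \<Rightarrow> bool" where
  "x < y \<longleftrightarrow> enumeration_index (Rep_ordered_copy x) < enumeration_index (Rep_ordered_copy y)"

instance
proof
  fix P :: "'a ordered_copy \<Rightarrow> bool" and a
  assume step: "\<And>x. (\<And>y. y < x \<Longrightarrow> P y) \<Longrightarrow> P x"
  show "P a"
  proof (induction "enumeration_index (Rep_ordered_copy a)" arbitrary: a rule: less_induct)
    case less
    show ?case by (rule step) (rule less, simp only: less_ordered_copy_def)
  qed
next
  fix x y :: "'a ordered_copy"
  assume "x \<le> y" "y \<le> x"
  then have "enumeration_index (Rep_ordered_copy x) = enumeration_index (Rep_ordered_copy y)"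
    by (simp add: less_eq_ordered_copy_def)
  then show "x = y"
    using injD[OF inj_enumeration_index] Rep_ordered_copy_inject by blast
qed (auto simp: less_eq_ordered_copy_def less_ordered_copy_def)

end

text \<open>Relabelling rows and columns simultaneously conjugates the permutations of the Leibniz formula, which
does not change their signs.\<close>

lemma det_reindex:
  fixes A :: "real^'n::finite^'n" and r :: "'m::finite \<Rightarrow> 'n"
  assumes r: "bij r"
  shows "det (\<chi> i j. A $ r i $ r j) = det A"
proof -
  have inj: "inj r" and r': "bij (inv r)"
    using r bij_imp_bij_inv by (auto simp: bij_is_inj)
  show ?thesis
    unfolding det_def
  proof (rule sum.reindex_bij_witness[of _ "map_permutation UNIV (inv r)" "map_permutation UNIV r"])
    fix p :: "'m \<Rightarrow> 'm" assume "p \<in> {p. p permutes UNIV}"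
    then have p: "p permutes UNIV" by simp
    show "map_permutation UNIV (inv r) (map_permutation UNIV r p) = p"
      by (rule map_permutation_compose_inv[of r UNIV UNIV]) (use r p inj in auto)
    show "map_permutation UNIV r p \<in> {p. p permutes UNIV}"
      using map_permutation_permutes[of r UNIV UNIV p] r p by simp
    have "(\<Prod>n\<in>UNIV. A $ n $ map_permutation UNIV r p n) = (\<Prod>i\<in>UNIV. A $ r i $ r (p i))"
      using prod.reindex[OF inj, of "\<lambda>n. A $ n $ map_permutation UNIV r p n"] bij_is_surj[OF r]
      by (simp add: map_permutation_apply[OF inj])
    then show "of_int (sign (map_permutation UNIV r p)) * (\<Prod>i\<in>UNIV. A $ i $ map_permutation UNIV r p i)
        = of_int (sign p) * (\<Prod>i\<in>UNIV. (\<chi> i j. A $ r i $ r j) $ i $ p i)"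
      using sign_map_permutation[OF inj p] by simp
  next
    fix p :: "'n \<Rightarrow> 'n" assume "p \<in> {p. p permutes UNIV}"
    then have p: "p permutes UNIV" by simp
    show "map_permutation UNIV r (map_permutation UNIV (inv r) p) = p"
      by (rule map_permutation_compose_inv[of "inv r" UNIV UNIV])
         (use r' p bij_is_surj[OF r] in \<open>auto simp: surj_f_inv_f\<close>)
    show "map_permutation UNIV (inv r) p \<in> {p. p permutes UNIV}"
      using map_permutation_permutes[of "inv r" UNIV UNIV p] r' p by simp
  qed
qed

definition reindex :: "('m \<Rightarrow> 'n) \<Rightarrow> real^'n::finite \<Rightarrow> real^'m::finite" where
  "reindex r x = (\<chi> i. x $ r i)"

lemma linear_reindex: "linear (reindex r)"
  by (auto simp: reindex_def linear_iff vec_eq_iff)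

lemma bounded_linear_reindex: "bounded_linear (reindex r)"
  using linear_reindex linear_conv_bounded_linear by blast

lemma reindex_reindex_inv:
  assumes "bij r"
  shows "reindex r (reindex (inv r) x) = x" "reindex (inv r) (reindex r y) = y"
  using assms by (auto simp: reindex_def vec_eq_iff bij_is_inj bij_is_surj surj_f_inv_f)

lemma lborel_reindex:
  fixes r :: "'m::finite \<Rightarrow> 'n::finite"
  assumes r: "bij r"
  shows "distr lborel borel (reindex r :: real^'n \<Rightarrow> real^'m) = lborel"
proof (rule lborel_eqI[symmetric])
  have [measurable]: "(reindex r :: real^'n \<Rightarrow> real^'m) \<in> borel_measurable borel"
    by (intro borel_measurable_continuous_onI linear_continuous_on bounded_linear_reindex)
  fix l u :: "real^'m" assume le: "\<And>b. b \<in> Basis \<Longrightarrow> l \<bullet> b \<le> u \<bullet> b"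
  have le': "l $ i \<le> u $ i" for i
    using le[of "axis i 1"] by (simp add: inner_axis)
  have prodB: "(\<Prod>b\<in>Basis. v \<bullet> b) = (\<Prod>i\<in>UNIV. v $ i)" for v :: "real^'k::finite"
  proof -
    have inj: "inj (\<lambda>i::'k. axis i (1::real))" by (auto simp: inj_on_def axis_eq_axis)
    have B: "(Basis :: (real^'k) set) = range (\<lambda>i. axis i 1)" by (auto simp: Basis_vec_def)
    show ?thesis unfolding B by (simp add: prod.reindex[OF inj] inner_axis)
  qed
  have box: "reindex r -` box l u = (box (reindex (inv r) l) (reindex (inv r) u) :: (real^'n) set)"
  proof -
    have "(\<forall>i. l $ i < x $ r i \<and> x $ r i < u $ i) \<longleftrightarrow> (\<forall>j. l $ inv r j < x $ j \<and> x $ j < u $ inv r j)" for x :: "real^'n"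
      using r by (metis bij_inv_eq_iff)
    then show ?thesis by (auto simp: reindex_def mem_box_cart)
  qed
  have "emeasure (distr lborel borel (reindex r :: real^'n \<Rightarrow> real^'m)) (box l u)
      = emeasure lborel (box (reindex (inv r) l) (reindex (inv r) u) :: (real^'n) set)"
    by (subst emeasure_distr) (auto simp: box)
  also have "\<dots> = (\<Prod>b\<in>Basis. (reindex (inv r) u - reindex (inv r) l :: real^'n) \<bullet> b)"
    by (rule emeasure_lborel_box) (use le' in \<open>auto simp: Basis_vec_def inner_axis reindex_def\<close>)
  also have "\<dots> = (\<Prod>j\<in>UNIV. u $ inv r j - l $ inv r j)"
    by (simp add: prodB reindex_def)
  also have "\<dots> = (\<Prod>i\<in>UNIV. u $ i - l $ i)"
    using r by (intro arg_cong[where f=ennreal] prod.reindex_bij_betw[of "inv r" UNIV UNIV "\<lambda>i. u $ i - l $ i"])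
      (simp add: bij_imp_bij_inv)
  also have "\<dots> = (\<Prod>b\<in>Basis. (u - l) \<bullet> b)"
    by (simp add: prodB)
  finally show "emeasure (distr lborel borel (reindex r :: real^'n \<Rightarrow> real^'m)) (box l u) = (\<Prod>b\<in>Basis. (u - l) \<bullet> b)" .
qed simp

theorem nn_change_of_variables:
  fixes \<tau> :: "real^'n::finite \<Rightarrow> real^'n" and f :: "real^'n \<Rightarrow> real"
  assumes S: "S \<in> sets borel"
    and der: "\<And>x. x \<in> S \<Longrightarrow> (\<tau> has_derivative \<tau>' x) (at x)" and inj: "inj_on \<tau> S"
    and nn: "\<And>y. y \<in> \<tau> ` S \<Longrightarrow> f y \<ge> 0"
    and meas: "(\<lambda>x. indicator S x * (\<bar>det (matrix (\<tau>' x))\<bar> * f (\<tau> x))) \<in> borel_measurable borel"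
      "(\<lambda>y. indicator (\<tau> ` S) y * f y) \<in> borel_measurable borel"
  shows "(\<integral>\<^sup>+x. ennreal (indicator S x * (\<bar>det (matrix (\<tau>' x))\<bar> * f (\<tau> x))) \<partial>lborel)
    = (\<integral>\<^sup>+y. ennreal (indicator (\<tau> ` S) y * f y) \<partial>lborel)"
proof -
  let ?r = "Rep_ordered_copy :: 'n ordered_copy \<Rightarrow> 'n"
  let ?T = "reindex ?r :: real^'n \<Rightarrow> real^'n ordered_copy"
  let ?T' = "reindex (inv ?r) :: real^'n ordered_copy \<Rightarrow> real^'n"
  note r = bij_Rep_ordered_copy[where 'a='n]
  note TT = reindex_reindex_inv[OF r]
  have [measurable]: "?T \<in> borel_measurable borel" "?T' \<in> borel_measurable borel"
    by (intro borel_measurable_continuous_onI linear_continuous_on bounded_linear_reindex)+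
  have lb: "(\<integral>\<^sup>+x. F x \<partial>(lborel :: (real^'n ordered_copy) measure)) = (\<integral>\<^sup>+x. F (?T x) \<partial>lborel)"
    if "F \<in> borel_measurable borel" for F
    using that nn_integral_distr[of ?T lborel borel F] by (simp add: lborel_reindex[OF r])
  define \<sigma> where "\<sigma> = (\<lambda>x. ?T (\<tau> (?T' x)))"
  define \<sigma>' where "\<sigma>' = (\<lambda>x v. ?T (\<tau>' (?T' x) (?T' v)))"
  have img: "x \<in> ?T ` X \<longleftrightarrow> ?T' x \<in> X" for x X
    using TT by (metis image_iff)
  have inv_T: "bij ?T'" using TT by (metis bij_betw_byWitness subset_UNIV)
  have det_eq: "det (matrix (\<sigma>' x)) = det (matrix (\<tau>' (?T' x)))" if "x \<in> ?T ` S" for x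
  proof -
    have ax: "?T' (axis j 1) = axis (?r j) 1" for j
    proof -
      have "?T' (axis j 1) $ i = axis (?r j) 1 $ i" for i
        using inv_f_f[OF bij_is_inj[OF r], of j] surj_f_inv_f[OF bij_is_surj[OF r], of i]
        by (cases "i = ?r j") (auto simp: reindex_def axis_def)
      then show ?thesis by (simp add: vec_eq_iff)
    qed
    have "matrix (\<sigma>' x) = (\<chi> i j. matrix (\<tau>' (?T' x)) $ ?r i $ ?r j)"
      by (simp add: matrix_def \<sigma>'_def ax vec_eq_iff) (simp add: reindex_def)
    then show ?thesis using det_reindex[OF r] by simp
  qed
  have S': "?T ` S \<in> sets borel"
  proof -
    have "?T ` S = ?T' -` S \<inter> space borel" using img by auto
    also have "\<dots> \<in> sets borel" by (rule measurable_sets[OF _ S]) measurable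
    finally show ?thesis .
  qed
  have im: "\<sigma> ` (?T ` S) = ?T ` (\<tau> ` S)"
    by (auto simp: \<sigma>_def TT image_image)
  have "(\<integral>\<^sup>+x. ennreal (indicator (?T ` S) x * (\<bar>det (matrix (\<sigma>' x))\<bar> * f (?T' (\<sigma> x)))) \<partial>lborel)
    = (\<integral>\<^sup>+y. ennreal (indicator (\<sigma> ` (?T ` S)) y * f (?T' y)) \<partial>lborel)"
  proof (rule nn_change_of_variables_wellorder[OF S'])
    fix x assume "x \<in> ?T ` S"
    then have x: "?T' x \<in> S" by (simp add: img)
    have "((\<lambda>x. ?T' x) has_derivative ?T') (at x)"
      by (rule bounded_linear_imp_has_derivative[OF bounded_linear_reindex])
    from has_derivative_compose[OF this der[OF x]]
    have "((\<lambda>x. \<tau> (?T' x)) has_derivative (\<lambda>v. \<tau>' (?T' x) (?T' v))) (at x)" .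
    then show "(\<sigma> has_derivative \<sigma>' x) (at x)"
      unfolding \<sigma>_def \<sigma>'_def by (rule bounded_linear.has_derivative[OF bounded_linear_reindex])
  next
    show "inj_on \<sigma> (?T ` S)"
      using inj TT by (auto simp: inj_on_def \<sigma>_def img) metis
    show "0 \<le> f (?T' y)" if "y \<in> \<sigma> ` (?T ` S)" for y
      using that nn by (auto simp: im TT)
    have "(\<lambda>x. (\<lambda>x. indicator S x * (\<bar>det (matrix (\<tau>' x))\<bar> * f (\<tau> x))) (?T' x)) \<in> borel_measurable borel"
      by (rule measurable_compose[OF _ meas(1)]) measurable
    also have "(\<lambda>x. (\<lambda>x. indicator S x * (\<bar>det (matrix (\<tau>' x))\<bar> * f (\<tau> x))) (?T' x))
      = (\<lambda>x. indicator (?T ` S) x * (\<bar>det (matrix (\<sigma>' x))\<bar> * f (?T' (\<sigma> x))))"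
      using det_eq by (auto simp: fun_eq_iff indicator_def img \<sigma>_def TT)
    finally show "(\<lambda>x. indicator (?T ` S) x * (\<bar>det (matrix (\<sigma>' x))\<bar> * f (?T' (\<sigma> x)))) \<in> borel_measurable borel" .
    have "(\<lambda>x. (\<lambda>y. indicator (\<tau> ` S) y * f y) (?T' x)) \<in> borel_measurable borel"
      by (rule measurable_compose[OF _ meas(2)]) measurable
    also have "(\<lambda>x. (\<lambda>y. indicator (\<tau> ` S) y * f y) (?T' x)) = (\<lambda>y. indicator (\<sigma> ` (?T ` S)) y * f (?T' y))"
      by (auto simp: fun_eq_iff indicator_def im img)
    finally show "(\<lambda>y. indicator (\<sigma> ` (?T ` S)) y * f (?T' y)) \<in> borel_measurable borel" .
  qed
  also have "(\<integral>\<^sup>+x. ennreal (indicator (?T ` S) x * (\<bar>det (matrix (\<sigma>' x))\<bar> * f (?T' (\<sigma> x)))) \<partial>lborel)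
      = (\<integral>\<^sup>+x. ennreal (indicator S (?T' x) * (\<bar>det (matrix (\<tau>' (?T' x)))\<bar> * f (\<tau> (?T' x)))) \<partial>lborel)"
    using det_eq by (intro nn_integral_cong) (auto simp: indicator_def img \<sigma>_def TT)
  also have "\<dots> = (\<integral>\<^sup>+x. ennreal (indicator S x * (\<bar>det (matrix (\<tau>' x))\<bar> * f (\<tau> x))) \<partial>lborel)"
    by (subst lb) (use measurable_compose[OF _ meas(1), of ?T' borel] in \<open>auto simp: TT\<close>)
  also have "(\<integral>\<^sup>+y. ennreal (indicator (\<sigma> ` (?T ` S)) y * f (?T' y)) \<partial>lborel)
     = (\<integral>\<^sup>+y. ennreal (indicator (\<tau> ` S) (?T' y) * f (?T' y)) \<partial>lborel)"
    by (intro nn_integral_cong) (auto simp: indicator_def im img)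
  also have "\<dots> = (\<integral>\<^sup>+y. ennreal (indicator (\<tau> ` S) y * f y) \<partial>lborel)"
    by (subst lb) (use measurable_compose[OF _ meas(2), of ?T' borel] in \<open>auto simp: TT\<close>)
  finally show ?thesis .
qed

section \<open>Positive definite matrices\<close>

lemma positive_definite_det_ne_0:
  fixes G :: "real^'n::finite^'n"
  assumes "\<And>v. v \<noteq> 0 \<Longrightarrow> v \<bullet> (G *v v) > 0"
  shows "det G \<noteq> 0"
proof -
  have "\<forall>v. G *v v = 0 \<longrightarrow> v = 0"
    using assms by (metis inner_zero_right less_irrefl)
  then have "invertible G"
    unfolding matrix_left_invertible_ker[symmetric] invertible_left_inverse .
  then show ?thesis by (simp add: invertible_det_nz)
qed

text \<open>The segment from the identity matrix to \<open>G\<close> consists of positive definite matrices, so the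
determinant has no zero along it.\<close>

lemma positive_definite_det_pos:
  fixes G :: "real^'n::finite^'n"
  assumes pd: "\<And>v. v \<noteq> 0 \<Longrightarrow> v \<bullet> (G *v v) > 0"
  shows "det G > 0"
proof -
  \<comment> \<open>The segment, with its entries spelled out so that continuity of the determinant is immediate.\<close>
  define P where "P = (\<lambda>t::real. (\<chi> i j. (1 - t) * mat 1 $ i $ j + t * G $ i $ j) :: real^'n^'n)"
  have nz: "det (P t) \<noteq> 0" if t: "0 \<le> t" "t \<le> 1" for t
  proof (rule positive_definite_det_ne_0)
    fix v :: "real^'n" assume v: "v \<noteq> 0"
    have "P t = (1 - t) *\<^sub>R mat 1 + t *\<^sub>R G"
      by (simp add: P_def vec_eq_iff)
    then have "v \<bullet> (P t *v v) = (1 - t) * (v \<bullet> v) + t * (v \<bullet> (G *v v))"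
      by (simp add: matrix_vector_mult_add_rdistrib scaleR_matrix_vector_assoc[symmetric] inner_add_right)
    moreover have "v \<bullet> v > 0" using v by simp
    ultimately show "v \<bullet> (P t *v v) > 0"
      using t pd[OF v] by (cases "t = 0") (auto intro!: add_nonneg_pos mult_pos_pos mult_nonneg_nonneg)
  qed
  have cont: "continuous_on {0..1} (\<lambda>t. det (P t))"
    unfolding det_def P_def by (auto intro!: continuous_intros)
  have P0: "det (P 0) = 1" and P1: "P 1 = G"
    by (simp_all add: P_def vec_lambda_eta)
  show ?thesis
  proof (rule ccontr)
    assume "\<not> det G > 0"
    then have "det (P 1) \<le> 0" by (simp add: P1)
    then obtain t where "0 \<le> t" "t \<le> 1" "det (P t) = 0"
      using IVT2'[of "\<lambda>t. det (P t)" 1 0 0] cont P0 by auto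
    with nz show False by blast
  qed
qed

section \<open>Suprema of measures\<close>

text \<open>If one member of a family of measures dominates all others on the subsets of \<open>U\<close>, then the supremum
agrees with it there. The set function that is given by this member on subsets of \<open>U\<close> and is infinite on
all other sets is a measure and an upper bound of the family.\<close>

lemma emeasure_SUP_eq_of_dominated:
  fixes N :: "'i \<Rightarrow> 'b measure"
  assumes sets_N: "\<And>i. i \<in> I \<Longrightarrow> sets (N i) = sets S" and c: "c \<in> I"
    and U: "U \<in> sets S"
    and dom: "\<And>i B. i \<in> I \<Longrightarrow> B \<in> sets S \<Longrightarrow> B \<subseteq> U \<Longrightarrow> emeasure (N i) B \<le> emeasure (N c) B"
    and B: "B \<in> sets S" "B \<subseteq> U"
  shows "emeasure (SUP i\<in>I. N i) B = emeasure (N c) B"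
proof -
  have I: "I \<noteq> {}" using c by auto
  note sets_sup = sets_SUP[OF sets_N I]
  define \<kappa> where "\<kappa> = (\<lambda>B. if B \<subseteq> U then emeasure (N c) B else \<infinity>)"
  define K where "K = measure_of (space S) (sets S) \<kappa>"
  have sets_K: "sets K = sets S"
    by (simp add: K_def sets.space_closed sets.sigma_sets_eq)
  have "positive (sets S) \<kappa>" by (auto simp: positive_def \<kappa>_def)
  moreover have "countably_additive (sets S) \<kappa>"
  proof (rule countably_additiveI)
    fix A :: "nat \<Rightarrow> 'b set"
    assume A: "range A \<subseteq> sets S" "disjoint_family A" "(\<Union>i. A i) \<in> sets S"
    show "(\<Sum>i. \<kappa> (A i)) = \<kappa> (\<Union>i. A i)"
    proof (cases "\<forall>i. A i \<subseteq> U")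
      case True
      then have "(\<Sum>i. \<kappa> (A i)) = (\<Sum>i. emeasure (N c) (A i))" by (simp add: \<kappa>_def)
      also have "\<dots> = emeasure (N c) (\<Union>i. A i)"
        using A sets_N[OF c] by (intro suminf_emeasure) auto
      also have "\<dots> = \<kappa> (\<Union>i. A i)" using True by (auto simp: \<kappa>_def)
      finally show ?thesis .
    next
      case False
      then obtain i where i: "\<not> A i \<subseteq> U" by blast
      then have "\<not> (\<Union>i. A i) \<subseteq> U" by blast
      then have 1: "\<kappa> (\<Union>i. A i) = \<infinity>" by (simp add: \<kappa>_def)
      have "\<infinity> = (\<Sum>j\<in>{i}. \<kappa> (A j))" using i by (simp add: \<kappa>_def)
      also have "\<dots> \<le> (\<Sum>j. \<kappa> (A j))" by (rule sum_le_suminf) auto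
      finally show ?thesis using 1 by (simp add: top_unique)
    qed
  qed
  ultimately have emeasure_K: "emeasure K A = \<kappa> A" if "A \<in> sets S" for A
    unfolding K_def using that by (intro emeasure_measure_of_sigma sets.sigma_algebra_axioms)
  have "N i \<le> K" if i: "i \<in> I" for i
  proof -
    have "emeasure (N i) A \<le> emeasure K A" for A
    proof (cases "A \<in> sets S")
      case True
      then show ?thesis using dom[OF i True] by (auto simp: emeasure_K \<kappa>_def)
    next
      case False
      then show ?thesis using sets_N[OF i] by (simp add: emeasure_notin_sets)
    qed
    then show ?thesis
      using sets_N[OF i] sets_K sets_eq_imp_space_eq[of "N i" K]
      by (simp add: le_measure_iff le_fun_def)
  qed
  then have "(SUP i\<in>I. N i) \<le> K" by (rule SUP_least)
  then have "emeasure (SUP i\<in>I. N i) B \<le> emeasure K B"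
    using sets_sup sets_K sets_eq_imp_space_eq[of "SUP i\<in>I. N i" K]
    by (simp add: le_measure_iff le_fun_def)
  also have "\<dots> = emeasure (N c) B" using B by (simp add: emeasure_K \<kappa>_def)
  finally have 1: "emeasure (SUP i\<in>I. N i) B \<le> emeasure (N c) B" .
  have "N c \<le> (SUP i\<in>I. N i)" using c by (rule SUP_upper)
  then have "emeasure (N c) B \<le> emeasure (SUP i\<in>I. N i) B"
    using sets_sup sets_N[OF c] sets_eq_imp_space_eq[of "N c" "SUP i\<in>I. N i"]
    by (simp add: le_measure_iff le_fun_def)
  with 1 show ?thesis by (rule antisym)
qed

section \<open>Charts and transition maps\<close>

locale compact_riemannian_manifold =
  fixes M :: "'a::t2_space set" and A :: "('a, 'n::finite) chart set" and g :: "('a, 'n) metric"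
  assumes compact_M: "compact M" and atlas: "smooth_atlas M A" and metric: "riemannian_metric A g"
begin

abbreviation chart_image :: "('a, 'n) chart \<Rightarrow> (real^'n) set" where
  "chart_image c \<equiv> snd c ` fst c"

abbreviation borel_M :: "'a measure" where
  "borel_M \<equiv> restrict_space borel M"

lemmas atlas_conjuncts =
  conjunct1[OF atlas[unfolded smooth_atlas_def]]
  conjunct1[OF conjunct2[OF atlas[unfolded smooth_atlas_def]]]
  conjunct2[OF conjunct2[OF atlas[unfolded smooth_atlas_def]]]

lemma chart: "c \<in> A \<Longrightarrow> is_chart M c"
  using atlas_conjuncts(1) by (rule bspec)

lemma charts_cover: "p \<in> M \<Longrightarrow> \<exists>c\<in>A. p \<in> fst c"
  unfolding atlas_conjuncts(2)[symmetric] by (rule UN_iff[THEN iffD1])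

lemma chart_openin: "c \<in> A \<Longrightarrow> openin (top_of_set M) (fst c)"
  using chart by (auto simp: is_chart_def)

lemma chart_subset: "c \<in> A \<Longrightarrow> fst c \<subseteq> M"
  using chart_openin openin_imp_subset by blast

lemma open_chart_image: "c \<in> A \<Longrightarrow> open (chart_image c)"
  using chart by (auto simp: is_chart_def)

lemma chart_homeomorphism: "c \<in> A \<Longrightarrow> homeomorphism (fst c) (chart_image c) (snd c) (chart_inv c)"
  using chart by (auto simp: is_chart_def)

lemma chart_inv_chart: "c \<in> A \<Longrightarrow> p \<in> fst c \<Longrightarrow> chart_inv c (snd c p) = p"
  using chart_homeomorphism by (auto simp: homeomorphism_def)

lemma chart_chart_inv: "c \<in> A \<Longrightarrow> y \<in> chart_image c \<Longrightarrow> snd c (chart_inv c y) = y"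
  using chart_homeomorphism by (auto simp: homeomorphism_def)

lemma chart_inv_in: "y \<in> chart_image c \<Longrightarrow> chart_inv c y \<in> fst c"
  by (rule inv_into_into)

lemma continuous_chart: "c \<in> A \<Longrightarrow> continuous_on (fst c) (snd c)"
  using chart_homeomorphism by (auto simp: homeomorphism_def)

lemma continuous_chart_inv: "c \<in> A \<Longrightarrow> continuous_on (chart_image c) (chart_inv c)"
  using chart_homeomorphism by (auto simp: homeomorphism_def)

lemma open_chart_image_of:
  assumes c: "c \<in> A" and U: "openin (top_of_set M) U" "U \<subseteq> fst c"
  shows "open (snd c ` U)"
proof -
  have "openin (top_of_set (fst c)) U"
    using U chart_subset[OF c] openin_subset_trans by blast
  then have "openin (top_of_set (chart_image c)) (snd c ` U)"
    by (rule homeomorphism_imp_open_map[OF chart_homeomorphism[OF c]])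
  then show ?thesis
    using open_chart_image[OF c] openin_open_trans by blast
qed

lemma open_overlap_image:
  assumes "c \<in> A" "d \<in> A" shows "open (snd c ` (fst c \<inter> fst d))"
  using assms by (intro open_chart_image_of openin_Int chart_openin) auto

lemma chart_image_subset_iff:
  "c \<in> A \<Longrightarrow> B \<subseteq> fst c \<Longrightarrow> y \<in> snd c ` B \<longleftrightarrow> y \<in> chart_image c \<and> chart_inv c y \<in> B"
  by (auto simp: chart_inv_chart subset_iff intro!: image_eqI[of y "snd c" "chart_inv c y"] dest: chart_chart_inv)

lemma borel_M_openin:
  assumes "openin (top_of_set M) U"
  shows "U \<in> sets borel_M"
proof -
  obtain T where "open T" "U = M \<inter> T"
    using assms unfolding openin_open by blast
  then show ?thesis
    unfolding sets_restrict_space by (intro image_eqI[of _ _ T]) simp_all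
qed

lemma chart_in_borel_M: "c \<in> A \<Longrightarrow> fst c \<in> sets borel_M"
  using chart_openin borel_M_openin by blast

lemma space_borel_M: "space borel_M = M"
  by (simp add: space_restrict_space)

lemma continuous_on_M_measurable: "continuous_on M f \<Longrightarrow> f \<in> borel_measurable borel_M" for f :: "'a \<Rightarrow> 'c::topological_space"
  by (rule borel_measurable_continuous_on_restrict)

lemma chart_inv_measurable:
  assumes c: "c \<in> A"
  shows "chart_inv c \<in> measurable (restrict_space lborel (chart_image c)) borel_M"
proof (rule measurable_restrict_space2)
  show "chart_inv c \<in> space (restrict_space lborel (chart_image c)) \<rightarrow> M"
    using chart_inv_in chart_subset[OF c] by (auto simp: space_restrict_space)
  have "chart_inv c \<in> borel_measurable (restrict_space borel (chart_image c))"
    by (rule borel_measurable_continuous_on_restrict[OF continuous_chart_inv[OF c]])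
  then show "chart_inv c \<in> borel_measurable (restrict_space lborel (chart_image c))"
    by (subst measurable_cong_sets[OF sets_restrict_space_cong[OF sets_lborel] refl])
qed

lemma chart_image_borel:
  assumes c: "c \<in> A" and B: "B \<in> sets borel_M" "B \<subseteq> fst c"
  shows "snd c ` B \<in> sets borel"
proof -
  have "chart_inv c -` B \<inter> space (restrict_space lborel (chart_image c)) \<in> sets (restrict_space lborel (chart_image c))"
    by (rule measurable_sets[OF chart_inv_measurable[OF c] B(1)])
  moreover have "chart_inv c -` B \<inter> space (restrict_space lborel (chart_image c)) = snd c ` B"
    using chart_image_subset_iff[OF c B(2)] by (auto simp: space_restrict_space)
  ultimately show ?thesis
    using open_chart_image[OF c] by (auto simp: sets_restrict_space)
qed

definition jacobian :: "('a, 'n) chart \<Rightarrow> ('a, 'n) chart \<Rightarrow> 'a \<Rightarrow> real^'n^'n" where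
  "jacobian c d p = matrix (frechet_derivative (in_coords c (snd d)) (at (snd c p)))"

lemmas metric_conjuncts =
  conjunct1[OF metric[unfolded riemannian_metric_def Let_def, folded jacobian_def]]
  conjunct1[OF conjunct2[OF metric[unfolded riemannian_metric_def Let_def, folded jacobian_def]]]
  conjunct2[OF conjunct2[OF metric[unfolded riemannian_metric_def Let_def, folded jacobian_def]]]

lemma metric_smooth:
  assumes "c \<in> A"
  shows "Ck_on n (chart_image c) (in_coords c (g c))"
proof -
  have "smooth_on (chart_image c) (in_coords c (g c))"
    using metric_conjuncts(1) assms by (rule bspec)
  then show ?thesis unfolding smooth_on_def by (rule spec)
qed

lemma
  assumes c: "c \<in> A" and p: "p \<in> fst c"
  shows metric_symmetric: "transpose (g c p) = g c p"
    and metric_positive: "v \<noteq> 0 \<Longrightarrow> v \<bullet> (g c p *v v) > 0"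
  using bspec[OF bspec[OF metric_conjuncts(2) c] p] by simp_all

lemma metric_det_pos: "c \<in> A \<Longrightarrow> p \<in> fst c \<Longrightarrow> det (g c p) > 0"
  by (rule positive_definite_det_pos) (rule metric_positive)

lemma volume_density_pos: "c \<in> A \<Longrightarrow> p \<in> fst c \<Longrightarrow> volume_density g c p > 0"
  using metric_det_pos by (simp add: volume_density_def)

lemma C1_volume_density:
  assumes c: "c \<in> A"
  shows "Ck_on (Suc 0) (chart_image c) (in_coords c (volume_density g c))"
proof -
  have "Ck_on (Suc 0) (chart_image c) (\<lambda>y. sqrt (det (in_coords c (g c) y)))"
  proof (rule C1_on_sqrt)
    show "Ck_on (Suc 0) (chart_image c) (\<lambda>y. det (in_coords c (g c) y))"
      by (rule C1_on_det) (rule C1_on_nth[OF C1_on_nth[OF metric_smooth[OF c]]])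
    show "det (in_coords c (g c) y) > 0" if "y \<in> chart_image c" for y
      unfolding in_coords_def by (rule metric_det_pos[OF c chart_inv_in[OF that]])
  qed
  also have "(\<lambda>y. sqrt (det (in_coords c (g c) y))) = in_coords c (volume_density g c)"
    by (simp add: fun_eq_iff in_coords_def volume_density_def)
  finally show ?thesis .
qed

lemma continuous_volume_density: "c \<in> A \<Longrightarrow> continuous_on (chart_image c) (in_coords c (volume_density g c))"
  by (rule Ck_on_imp_continuous[OF C1_volume_density])

definition transition :: "('a, 'n) chart \<Rightarrow> ('a, 'n) chart \<Rightarrow> real^'n \<Rightarrow> real^'n" where
  "transition c d = in_coords c (snd d)"

lemma transition_C1:
  assumes c: "c \<in> A" and d: "d \<in> A"
  shows "Ck_on n (snd c ` (fst c \<inter> fst d)) (transition c d)"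
  using bspec[OF bspec[OF atlas_conjuncts(3) c] d] unfolding transition_def smooth_on_def by (rule spec)

lemma transition_chart: "c \<in> A \<Longrightarrow> p \<in> fst c \<Longrightarrow> transition c d (snd c p) = snd d p"
  by (simp add: transition_def in_coords_def chart_inv_chart)

lemma transition_has_derivative:
  assumes "c \<in> A" "d \<in> A" "p \<in> fst c" "p \<in> fst d"
  shows "(transition c d has_derivative (\<lambda>v. jacobian c d p *v v)) (at (snd c p))"
proof -
  have d: "(transition c d has_derivative frechet_derivative (transition c d) (at (snd c p))) (at (snd c p))"
    by (rule C1_on_has_derivative[OF transition_C1[OF assms(1,2)]]) (use assms in blast)
  have "frechet_derivative (transition c d) (at (snd c p)) = (\<lambda>v. jacobian c d p *v v)"
    using has_derivative_linear[OF d] by (auto simp: jacobian_def transition_def[symmetric] fun_eq_iff matrix_works)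
  with d show ?thesis by simp
qed

lemma metric_transformation:
  assumes c: "c \<in> A" and d: "d \<in> A" and p: "p \<in> fst c" "p \<in> fst d"
  shows "g c p = transpose (jacobian c d p) ** g d p ** jacobian c d p"
  using bspec[OF bspec[OF bspec[OF metric_conjuncts(3) c] d] IntI[OF p]] .

lemma det_metric_transformation:
  assumes "c \<in> A" "d \<in> A" "p \<in> fst c" "p \<in> fst d"
  shows "det (g c p) = (det (jacobian c d p))\<^sup>2 * det (g d p)"
  by (subst metric_transformation[OF assms])
     (simp add: det_mul det_transpose power2_eq_square mult_ac)

lemma det_jacobian_ne_0:
  assumes "c \<in> A" "d \<in> A" "p \<in> fst c" "p \<in> fst d"
  shows "det (jacobian c d p) \<noteq> 0"
  using det_metric_transformation[OF assms] metric_det_pos[OF assms(1,3)] by auto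

lemma volume_density_transformation:
  assumes "c \<in> A" "d \<in> A" "p \<in> fst c" "p \<in> fst d"
  shows "volume_density g c p = \<bar>det (jacobian c d p)\<bar> * volume_density g d p"
  unfolding volume_density_def det_metric_transformation[OF assms]
  by (simp add: real_sqrt_mult)

section \<open>The Riemannian volume in a chart\<close>

lemma sets_chart_volume [simp]: "sets (chart_volume M g c) = sets borel_M"
  by (simp add: chart_volume_def)

lemma density_measurable:
  assumes c: "c \<in> A"
  shows "(\<lambda>y. ennreal (in_coords c (volume_density g c) y)) \<in> borel_measurable (restrict_space lborel (chart_image c))"
proof -
  have "in_coords c (volume_density g c) \<in> borel_measurable (restrict_space borel (chart_image c))"
    by (rule borel_measurable_continuous_on_restrict[OF continuous_volume_density[OF c]])
  then have "in_coords c (volume_density g c) \<in> borel_measurable (restrict_space lborel (chart_image c))"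
    by (subst measurable_cong_sets[OF sets_restrict_space_cong[OF sets_lborel] refl])
  then show ?thesis by measurable
qed

lemma nn_integral_chart_volume:
  assumes c: "c \<in> A" and F: "F \<in> borel_measurable borel_M"
  shows "(\<integral>\<^sup>+p. F p \<partial>chart_volume M g c)
    = (\<integral>\<^sup>+y. indicator (chart_image c) y * (ennreal (volume_density g c (chart_inv c y)) * F (chart_inv c y)) \<partial>lborel)"
proof -
  let ?R = "restrict_space lborel (chart_image c)"
  have sets_eq: "chart_image c \<inter> space lborel \<in> sets lborel" using open_chart_image[OF c] by simp
  have Fm: "(\<lambda>y. F (chart_inv c y)) \<in> borel_measurable ?R"
    using measurable_compose[OF chart_inv_measurable[OF c] F] .
  have "(\<integral>\<^sup>+p. F p \<partial>chart_volume M g c)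
     = (\<integral>\<^sup>+y. F (chart_inv c y) \<partial>density ?R (\<lambda>y. ennreal (in_coords c (volume_density g c) y)))"
    unfolding chart_volume_def using F chart_inv_measurable[OF c]
    by (intro nn_integral_distr) auto
  also have "\<dots> = (\<integral>\<^sup>+y. ennreal (in_coords c (volume_density g c) y) * F (chart_inv c y) \<partial>?R)"
    by (rule nn_integral_density[OF density_measurable[OF c] Fm])
  also have "\<dots> = (\<integral>\<^sup>+y. ennreal (in_coords c (volume_density g c) y) * F (chart_inv c y) * indicator (chart_image c) y \<partial>lborel)"
    by (rule nn_integral_restrict_space[OF sets_eq])
  finally show ?thesis by (simp add: in_coords_def mult_ac)
qed

lemma emeasure_chart_volume:
  assumes c: "c \<in> A" and B: "B \<in> sets borel_M" "B \<subseteq> fst c"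
  shows "emeasure (chart_volume M g c) B
    = (\<integral>\<^sup>+y. ennreal (indicator (snd c ` B) y * volume_density g c (chart_inv c y)) \<partial>lborel)"
proof -
  have "emeasure (chart_volume M g c) B = (\<integral>\<^sup>+p. indicator B p \<partial>chart_volume M g c)"
    using B by simp
  also have "\<dots> = (\<integral>\<^sup>+y. indicator (chart_image c) y * (ennreal (volume_density g c (chart_inv c y)) * indicator B (chart_inv c y)) \<partial>lborel)"
    using B by (intro nn_integral_chart_volume c) auto
  also have "\<dots> = (\<integral>\<^sup>+y. ennreal (indicator (snd c ` B) y * volume_density g c (chart_inv c y)) \<partial>lborel)"
    using chart_image_subset_iff[OF c B(2)] by (intro nn_integral_cong) (auto simp: indicator_def simp del: image_iff)
  finally show ?thesis .
qed

text \<open>The measure of a chart is carried by the domain of the chart.\<close>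

lemma emeasure_chart_volume_Int:
  assumes c: "c \<in> A" and B: "B \<in> sets borel_M"
  shows "emeasure (chart_volume M g c) B = emeasure (chart_volume M g c) (B \<inter> fst c)"
proof -
  have "emeasure (chart_volume M g c) B' = (\<integral>\<^sup>+p. indicator B' p \<partial>chart_volume M g c)"
    if "B' \<in> sets borel_M" for B' using that by simp
  moreover have "(\<integral>\<^sup>+p. indicator B p \<partial>chart_volume M g c) = (\<integral>\<^sup>+p. indicator (B \<inter> fst c) p \<partial>chart_volume M g c)"
    using B chart_in_borel_M[OF c] chart_inv_in[of _ c]
    by (subst (1 2) nn_integral_chart_volume[OF c]) (auto intro!: nn_integral_cong simp: indicator_def simp del: image_iff)
  ultimately show ?thesis using B chart_in_borel_M[OF c] by simp
qed

lemma continuous_density_measurable: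
  assumes c: "c \<in> A" and B: "B \<in> sets borel_M" "B \<subseteq> fst c"
  shows "(\<lambda>y. indicator (snd c ` B) y * volume_density g c (chart_inv c y)) \<in> borel_measurable borel"
proof -
  have "continuous_on (snd c ` B) (\<lambda>y. volume_density g c (chart_inv c y))"
    using continuous_on_subset[OF continuous_volume_density[OF c] image_mono[OF B(2)]]
    by (simp add: in_coords_def)
  then show ?thesis
    using borel_measurable_continuous_on_indicator[OF chart_image_borel[OF c B], of "\<lambda>y. volume_density g c (chart_inv c y)"]
    by simp
qed

text \<open>The densities transform with the absolute value of the Jacobian determinant because the Gram matrices
transform by congruence. So the change of variables formula for the transition map identifies the two
chart measures on the overlap.\<close>

lemma chart_volume_agree:
  assumes c: "c \<in> A" and d: "d \<in> A" and B: "B \<in> sets borel_M" "B \<subseteq> fst c \<inter> fst d"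
  shows "emeasure (chart_volume M g c) B = emeasure (chart_volume M g d) B"
proof -
  let ?S = "snd c ` B" and ?\<tau> = "transition c d"
  let ?f = "\<lambda>y. volume_density g d (chart_inv d y)"
  let ?J = "\<lambda>y. jacobian c d (chart_inv c y)"
  have Bc: "B \<subseteq> fst c" and Bd: "B \<subseteq> fst d" using B(2) by auto
  have im: "?\<tau> ` ?S = snd d ` B"
    unfolding image_image using transition_chart[OF c, of _ d] Bc by (intro image_cong) auto
  have inv: "chart_inv c (snd c p) = p" "chart_inv d (snd d p) = p" if "p \<in> B" for p
    using that Bc Bd chart_inv_chart c d by auto
  have eq: "indicator ?S y * (\<bar>det (matrix ((*v) (?J y)))\<bar> * ?f (?\<tau> y))
      = indicator ?S y * volume_density g c (chart_inv c y)" for y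
  proof (cases "y \<in> ?S")
    case True
    then obtain p where p: "p \<in> B" "y = snd c p" by auto
    then show ?thesis
      using volume_density_transformation[OF c d subsetD[OF Bc p(1)] subsetD[OF Bd p(1)]]
        transition_chart[OF c subsetD[OF Bc p(1)], of d]
      by (simp add: inv)
  qed simp
  have "(\<integral>\<^sup>+y. ennreal (indicator ?S y * (\<bar>det (matrix ((*v) (?J y)))\<bar> * ?f (?\<tau> y))) \<partial>lborel)
      = (\<integral>\<^sup>+y. ennreal (indicator (?\<tau> ` ?S) y * ?f y) \<partial>lborel)"
  proof (rule nn_change_of_variables[where \<tau>'="\<lambda>y. (*v) (?J y)"])
    show "?S \<in> sets borel" by (rule chart_image_borel[OF c B(1) Bc])
    fix y assume "y \<in> ?S"
    then obtain p where p: "p \<in> B" "y = snd c p" by auto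
    then show "(?\<tau> has_derivative (*v) (?J y)) (at y)"
      using transition_has_derivative[OF c d, of p] Bc Bd by (auto simp: inv)
  next
    show "inj_on ?\<tau> ?S"
    proof (rule inj_onI)
      fix x y assume xy: "x \<in> ?S" "y \<in> ?S" and eq: "?\<tau> x = ?\<tau> y"
      obtain p where p: "p \<in> B" "x = snd c p" using xy(1) by (rule imageE)
      obtain q where q: "q \<in> B" "y = snd c q" using xy(2) by (rule imageE)
      have "snd d p = snd d q"
        using eq unfolding p(2) q(2) transition_chart[OF c subsetD[OF Bc p(1)]] transition_chart[OF c subsetD[OF Bc q(1)]] .
      then have "chart_inv d (snd d p) = chart_inv d (snd d q)" by (rule arg_cong)
      then have "p = q" unfolding inv(2)[OF p(1)] inv(2)[OF q(1)] .
      then show "x = y" unfolding p(2) q(2) by (rule arg_cong)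
    qed
    show "0 \<le> ?f y" if "y \<in> ?\<tau> ` ?S" for y
      using that Bd volume_density_pos[OF d] unfolding im by (auto simp: inv less_imp_le)
    show "(\<lambda>y. indicator ?S y * (\<bar>det (matrix ((*v) (?J y)))\<bar> * ?f (?\<tau> y))) \<in> borel_measurable borel"
      unfolding eq by (rule continuous_density_measurable[OF c B(1) Bc])
    show "(\<lambda>y. indicator (?\<tau> ` ?S) y * ?f y) \<in> borel_measurable borel"
      unfolding im by (rule continuous_density_measurable[OF d B(1) Bd])
  qed
  then show ?thesis
    unfolding eq im emeasure_chart_volume[OF c B(1) Bc] emeasure_chart_volume[OF d B(1) Bd] .
qed

abbreviation vol :: "'a measure" where
  "vol \<equiv> riemannian_volume M A g"

text \<open>A set in the domain of \<open>c\<close> has at most as much mass for any other chart \<open>d\<close>: only its part in the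
overlap counts for \<open>d\<close>, and there both measures agree.\<close>

lemma emeasure_riemannian_volume:
  assumes c: "c \<in> A" and B: "B \<in> sets borel_M" "B \<subseteq> fst c"
  shows "emeasure vol B = emeasure (chart_volume M g c) B"
  unfolding riemannian_volume_def
proof (rule emeasure_SUP_eq_of_dominated[OF _ c chart_in_borel_M[OF c] _ B])
  fix d B assume d: "d \<in> A" and B: "B \<in> sets borel_M" "B \<subseteq> fst c"
  have 1: "B \<inter> fst d \<in> sets borel_M" using B chart_in_borel_M[OF d] by auto
  have "emeasure (chart_volume M g d) B = emeasure (chart_volume M g d) (B \<inter> fst d)"
    by (rule emeasure_chart_volume_Int[OF d B(1)])
  also have "\<dots> = emeasure (chart_volume M g c) (B \<inter> fst d)"
    using B 1 by (intro chart_volume_agree d c) auto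
  also have "\<dots> \<le> emeasure (chart_volume M g c) B"
    using B by (intro emeasure_mono) auto
  finally show "emeasure (chart_volume M g d) B \<le> emeasure (chart_volume M g c) B" .
qed simp

lemma sets_vol: "M \<noteq> {} \<Longrightarrow> sets vol = sets borel_M"
  unfolding riemannian_volume_def using charts_cover by (intro sets_SUP) auto

end

lemma matrix_inv_inverse:
  fixes G :: "real^'n::finite^'n"
  assumes "det G \<noteq> 0"
  shows "G ** matrix_inv G = mat 1" "matrix_inv G ** G = mat 1"
proof -
  have "\<exists>B. G ** B = mat 1 \<and> B ** G = mat 1"
    using assms invertible_det_nz[of G] by (simp add: invertible_def)
  from someI_ex[OF this] show "G ** matrix_inv G = mat 1" "matrix_inv G ** G = mat 1"
    unfolding matrix_inv_def by blast+
qed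

context compact_riemannian_manifold
begin

section \<open>Continuous functions on the manifold\<close>

lemma continuous_on_M_of_charts:
  fixes f :: "'a \<Rightarrow> real"
  assumes f: "\<And>c. c \<in> A \<Longrightarrow> continuous_on (chart_image c) (in_coords c f)"
  shows "continuous_on M f"
  unfolding continuous_on_def
proof
  fix p assume p: "p \<in> M"
  then obtain c where c: "c \<in> A" "p \<in> fst c" using charts_cover by blast
  have "continuous_on (fst c) (\<lambda>p. in_coords c f (snd c p))"
    by (rule continuous_on_compose2[OF f[OF c(1)] continuous_chart[OF c(1)]]) simp
  then have "continuous_on (fst c) f"
    by (rule continuous_on_eq) (simp add: in_coords_def chart_inv_chart[OF c(1)])
  then have lim: "(f \<longlongrightarrow> f p) (at p within fst c)"
    using c(2) unfolding continuous_on_def by blast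
  obtain T where T: "open T" "fst c = M \<inter> T"
    using chart_openin[OF c(1)] unfolding openin_open by blast
  have "at p within fst c = at p within M"
    using c(2) T by (intro at_within_nhd[of p T]) auto
  with lim show "(f \<longlongrightarrow> f p) (at p within M)" by simp
qed

lemma C1_manifold_continuous:
  fixes f :: "'a \<Rightarrow> real"
  assumes "Ck_on_manifold n A f"
  shows "continuous_on M f"
  by (rule continuous_on_M_of_charts, rule Ck_on_imp_continuous[of n])
     (use assms in \<open>simp add: Ck_on_manifold_def\<close>)

lemma C1_manifold_chart: "Ck_on_manifold n A f \<Longrightarrow> c \<in> A \<Longrightarrow> Ck_on n (chart_image c) (in_coords c f)"
  unfolding Ck_on_manifold_def by (rule bspec)

section \<open>Gradients in charts\<close>

text \<open>The components of the differential, a covector, in the coordinate frame of \<open>c\<close>.\<close>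

definition coord_deriv :: "('a, 'n) chart \<Rightarrow> ('a \<Rightarrow> real) \<Rightarrow> 'a \<Rightarrow> real^'n" where
  "coord_deriv c f p = (\<chi> j. partial_deriv j (in_coords c f) (snd c p))"

text \<open>The quantity \<^const>\<open>grad_inner\<close> evaluated in a prescribed chart.\<close>

definition chart_grad_inner :: "('a, 'n) chart \<Rightarrow> ('a \<Rightarrow> real) \<Rightarrow> ('a \<Rightarrow> real) \<Rightarrow> 'a \<Rightarrow> real" where
  "chart_grad_inner c f h p = gradient g c f p \<bullet> (g c p *v gradient g c h p)"

lemma metric_gradient:
  assumes c: "c \<in> A" and p: "p \<in> fst c"
  shows "g c p *v gradient g c f p = coord_deriv c f p"
proof -
  have "g c p ** matrix_inv (g c p) = mat 1"
    using metric_det_pos[OF c p] by (intro matrix_inv_inverse) simp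
  then show ?thesis
    by (simp add: gradient_def coord_deriv_def matrix_vector_mul_assoc)
qed

lemma chart_grad_inner_eq:
  assumes c: "c \<in> A" and p: "p \<in> fst c"
  shows "chart_grad_inner c f h p = gradient g c f p \<bullet> coord_deriv c h p"
    and "chart_grad_inner c f h p = coord_deriv c f p \<bullet> gradient g c h p"
proof -
  show "chart_grad_inner c f h p = gradient g c f p \<bullet> coord_deriv c h p"
    by (simp add: chart_grad_inner_def metric_gradient[OF c p])
  have "gradient g c f p \<bullet> (g c p *v gradient g c h p) = (transpose (g c p) *v gradient g c f p) \<bullet> gradient g c h p"
    by (simp add: dot_lmul_matrix[symmetric])
  then show "chart_grad_inner c f h p = coord_deriv c f p \<bullet> gradient g c h p"
    by (simp add: chart_grad_inner_def metric_symmetric[OF c p] metric_gradient[OF c p])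
qed

lemma coord_deriv_transform:
  assumes c: "c \<in> A" and d: "d \<in> A" and p: "p \<in> fst c" "p \<in> fst d"
    and diff: "in_coords d f differentiable (at (snd d p))"
  shows "coord_deriv c f p = transpose (jacobian c d p) *v coord_deriv d f p"
proof -
  let ?D = "frechet_derivative (in_coords d f) (at (snd d p))"
  have D: "(in_coords d f has_derivative ?D) (at (transition c d (snd c p)))"
    using diff by (simp add: frechet_derivative_works transition_chart[OF c p(1)])
  have "((\<lambda>y. in_coords d f (transition c d y)) has_derivative (\<lambda>v. ?D (jacobian c d p *v v))) (at (snd c p))"
    by (rule has_derivative_compose[OF transition_has_derivative[OF c d p] D])
  then have der: "(in_coords c f has_derivative (\<lambda>v. ?D (jacobian c d p *v v))) (at (snd c p))"
  proof (rule has_derivative_transform_within_open[OF _ open_overlap_image[OF c d]])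
    show "snd c p \<in> snd c ` (fst c \<inter> fst d)" using p by blast
    fix y assume "y \<in> snd c ` (fst c \<inter> fst d)"
    then obtain q where q: "q \<in> fst c \<inter> fst d" "y = snd c q" by (rule imageE)
    then have q': "q \<in> fst c" "q \<in> fst d" by simp_all
    show "in_coords d f (transition c d y) = in_coords c f y"
      by (simp add: q(2) transition_chart[OF c q'(1)] in_coords_def chart_inv_chart[OF c q'(1)] chart_inv_chart[OF d q'(2)])
  qed
  have lin: "linear ?D" by (rule has_derivative_linear[OF D])
  have "partial_deriv j (in_coords c f) (snd c p) = (transpose (jacobian c d p) *v coord_deriv d f p) $ j" for j
  proof -
    have "partial_deriv j (in_coords c f) (snd c p) = ?D (jacobian c d p *v axis j 1)"
      by (simp add: partial_deriv_def frechet_derivative_at[OF der, symmetric])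
    also have "\<dots> = (\<Sum>i\<in>UNIV. (jacobian c d p *v axis j 1) $ i * ?D (axis i 1))"
      by (rule linear_axis_sum[OF lin])
    also have "\<dots> = (\<Sum>i\<in>UNIV. jacobian c d p $ i $ j * partial_deriv i (in_coords d f) (snd d p))"
      by (simp add: partial_deriv_def matrix_vector_mult_basis column_def)
    also have "\<dots> = (transpose (jacobian c d p) *v coord_deriv d f p) $ j"
      by (simp add: matrix_vector_mult_def transpose_def coord_deriv_def)
    finally show ?thesis .
  qed
  then show ?thesis by (simp add: vec_eq_iff coord_deriv_def)
qed

text \<open>Gradients transform as vectors. It suffices to compare both sides after applying the metric of \<open>d\<close> and
the transposed Jacobian matrix, where the transformation laws of the metric and of the differential apply.\<close>

lemma gradient_transform:
  assumes c: "c \<in> A" and d: "d \<in> A" and p: "p \<in> fst c" "p \<in> fst d"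
    and diff: "in_coords d f differentiable (at (snd d p))"
  shows "gradient g d f p = jacobian c d p *v gradient g c f p"
proof -
  let ?J = "jacobian c d p"
  have inj: "x = y" if "transpose ?J *v x = transpose ?J *v y" for x y
  proof -
    have "matrix_inv (transpose ?J) ** transpose ?J = mat 1"
      using det_jacobian_ne_0[OF c d p] by (intro matrix_inv_inverse) (simp add: det_transpose)
    then show ?thesis
      using arg_cong[OF that, of "\<lambda>v. matrix_inv (transpose ?J) *v v"]
      by (simp add: matrix_vector_mul_assoc del: transpose_matrix_vector)
  qed
  have inj_g: "x = y" if "g d p *v x = g d p *v y" for x y
  proof -
    have "matrix_inv (g d p) ** g d p = mat 1"
      using metric_det_pos[OF d p(2)] by (intro matrix_inv_inverse) simp
    then show ?thesis
      using arg_cong[OF that, of "\<lambda>v. matrix_inv (g d p) *v v"]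
      by (simp add: matrix_vector_mul_assoc)
  qed
  have "transpose ?J *v (g d p *v (?J *v gradient g c f p)) = g c p *v gradient g c f p"
    by (simp add: metric_transformation[OF c d p] matrix_vector_mul_assoc matrix_mul_assoc)
  also have "\<dots> = transpose ?J *v coord_deriv d f p"
    by (simp add: metric_gradient[OF c p(1)] coord_deriv_transform[OF c d p diff])
  also have "\<dots> = transpose ?J *v (g d p *v gradient g d f p)"
    by (simp add: metric_gradient[OF d p(2)])
  finally show ?thesis using inj inj_g by metis
qed

lemma chart_grad_inner_invariant:
  assumes c: "c \<in> A" and d: "d \<in> A" and p: "p \<in> fst c" "p \<in> fst d"
    and f: "in_coords d f differentiable (at (snd d p))"
    and h: "in_coords d h differentiable (at (snd d p))"
  shows "chart_grad_inner c f h p = chart_grad_inner d f h p"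
proof -
  have "chart_grad_inner c f h p = gradient g c f p \<bullet> (transpose (jacobian c d p) *v coord_deriv d h p)"
    by (simp add: chart_grad_inner_eq(1)[OF c p(1)] coord_deriv_transform[OF c d p h])
  also have "\<dots> = (jacobian c d p *v gradient g c f p) \<bullet> coord_deriv d h p"
    by (simp add: inner_commute[of "gradient g c f p"] inner_commute[of "jacobian c d p *v gradient g c f p"] dot_lmul_matrix)
  also have "\<dots> = chart_grad_inner d f h p"
    by (simp add: chart_grad_inner_eq(1)[OF d p(2)] gradient_transform[OF c d p f])
  finally show ?thesis .
qed

lemma C1_coord_deriv:
  assumes c: "c \<in> A" and f: "Ck_on (Suc (Suc 0)) (chart_image c) (in_coords c f)"
  shows "Ck_on (Suc 0) (chart_image c) (\<lambda>y. coord_deriv c f (chart_inv c y) $ i)"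
proof (rule C1_on_cong[OF open_chart_image[OF c]])
  show "coord_deriv c f (chart_inv c y) $ i = frechet_derivative (in_coords c f) (at y) (axis i 1)"
    if "y \<in> chart_image c" for y
    using chart_chart_inv[OF c that] by (simp add: coord_deriv_def partial_deriv_def)
  show "Ck_on (Suc 0) (chart_image c) (\<lambda>y. frechet_derivative (in_coords c f) (at y) (axis i 1))"
    using f Ck_on.simps(2)[of "Suc 0"] by blast
qed

lemma continuous_coord_deriv:
  assumes c: "c \<in> A" and f: "Ck_on (Suc 0) (chart_image c) (in_coords c f)"
  shows "continuous_on (chart_image c) (\<lambda>y. coord_deriv c f (chart_inv c y) $ i)"
proof -
  have "continuous_on (chart_image c) (\<lambda>y. frechet_derivative (in_coords c f) (at y) (axis i 1))"
    by (rule C1_on_continuous_derivative[OF f])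
  then show ?thesis
    by (rule continuous_on_eq) (simp add: coord_deriv_def partial_deriv_def chart_chart_inv[OF c])
qed

text \<open>Cramer's rule for the linear system that defines the gradient writes its components as quotients of
determinants of C1 functions.\<close>

lemma C1_gradient:
  assumes c: "c \<in> A" and f: "Ck_on (Suc (Suc 0)) (chart_image c) (in_coords c f)"
  shows "Ck_on (Suc 0) (chart_image c) (\<lambda>y. gradient g c f (chart_inv c y) $ k)"
proof (rule C1_on_cong[OF open_chart_image[OF c]])
  \<comment> \<open>The Gram matrix with its column \<open>k\<close> replaced by the right-hand side of the system.\<close>
  let ?R = "\<lambda>y. (\<chi> i j. if j = k then coord_deriv c f (chart_inv c y) $ i else in_coords c (g c) y $ i $ j) :: real^'n^'n"
  fix y assume y: "y \<in> chart_image c"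
  note p = chart_inv_in[OF y]
  have "det (?R y) = gradient g c f (chart_inv c y) $ k * det (in_coords c (g c) y)"
    using cramer_lemma[of k "g c (chart_inv c y)" "gradient g c f (chart_inv c y)"]
    unfolding metric_gradient[OF c p] in_coords_def .
  then show "gradient g c f (chart_inv c y) $ k = det (?R y) * inverse (det (in_coords c (g c) y))"
    using metric_det_pos[OF c p] by (simp add: in_coords_def)
next
  let ?R = "\<lambda>y. (\<chi> i j. if j = k then coord_deriv c f (chart_inv c y) $ i else in_coords c (g c) y $ i $ j) :: real^'n^'n"
  have G: "Ck_on (Suc 0) (chart_image c) (\<lambda>y. in_coords c (g c) y $ i $ j)" for i j
    by (rule C1_on_nth[OF C1_on_nth[OF metric_smooth[OF c]]])
  have R: "Ck_on (Suc 0) (chart_image c) (\<lambda>y. ?R y $ i $ j)" for i j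
    using G[of i j] C1_coord_deriv[OF c f, of i] by (cases "j = k") (simp_all del: Ck_on.simps)
  show "Ck_on (Suc 0) (chart_image c) (\<lambda>y. det (?R y) * inverse (det (in_coords c (g c) y)))"
  proof (rule C1_on_mult[OF C1_on_det[OF R] C1_on_inverse[OF C1_on_det[OF G]]])
    fix y assume "y \<in> chart_image c"
    from metric_det_pos[OF c chart_inv_in[OF this]]
    show "det (in_coords c (g c) y) \<noteq> 0" by (simp add: in_coords_def)
  qed
qed

section \<open>Bump functions on the manifold\<close>

definition chart_bump :: "('a, 'n) chart \<Rightarrow> real \<Rightarrow> real^'n \<Rightarrow> 'a \<Rightarrow> real" where
  "chart_bump c r a p = (if p \<in> fst c then bump r a (snd c p) else 0)"

definition chart_ball :: "('a, 'n) chart \<Rightarrow> real \<Rightarrow> real^'n \<Rightarrow> 'a set" where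
  "chart_ball c r a = chart_inv c ` cball a r"

context
  fixes c r a
  assumes c: "c \<in> A" and r: "r > 0" and ball: "cball a r \<subseteq> chart_image c"
begin

lemma compact_chart_ball: "compact (chart_ball c r a)"
  unfolding chart_ball_def
  by (rule compact_continuous_image[OF continuous_on_subset[OF continuous_chart_inv[OF c] ball] compact_cball])

lemma chart_ball_subset: "chart_ball c r a \<subseteq> fst c"
proof
  fix p assume "p \<in> chart_ball c r a"
  then obtain y where "y \<in> cball a r" "p = chart_inv c y"
    unfolding chart_ball_def by (rule imageE)
  then show "p \<in> fst c" using chart_inv_in[OF subsetD[OF ball]] by simp
qed

lemma chart_bump_nonneg: "chart_bump c r a p \<ge> 0"
  by (simp add: chart_bump_def bump_nonneg)

lemma chart_bump_eq_0:
  assumes "p \<notin> chart_ball c r a"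
  shows "chart_bump c r a p = 0"
proof (cases "p \<in> fst c")
  case True
  then have "snd c p \<notin> cball a r"
    using assms chart_inv_chart[OF c True] unfolding chart_ball_def by (metis image_eqI)
  then have "bump r a (snd c p) = 0" using r by (intro bump_eq_0) auto
  then show ?thesis by (simp add: chart_bump_def)
qed (simp add: chart_bump_def)

text \<open>The domain of any other chart is covered by two open sets: on the overlap with \<open>c\<close> the function is the
bump composed with a transition map, and off the closed set \<^const>\<open>chart_ball\<close> it vanishes.\<close>

lemma C1_chart_bump: "Ck_on_manifold (Suc 0) A (chart_bump c r a)"
  unfolding Ck_on_manifold_def
proof
  fix d assume d: "d \<in> A"
  let ?f = "in_coords d (chart_bump c r a)"
  let ?K = "chart_ball c r a"
  have 1: "Ck_on (Suc 0) (snd d ` (fst d \<inter> fst c)) ?f"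
  proof (rule C1_on_cong[OF open_overlap_image[OF d c]])
    fix y assume "y \<in> snd d ` (fst d \<inter> fst c)"
    then obtain q where q: "q \<in> fst d \<inter> fst c" "y = snd d q" by (rule imageE)
    then show "?f y = bump r a (transition d c y)"
      by (simp add: in_coords_def chart_inv_chart[OF d] chart_bump_def transition_chart[OF d])
  next
    show "Ck_on (Suc 0) (snd d ` (fst d \<inter> fst c)) (\<lambda>y. bump r a (transition d c y))"
      by (rule C1_on_compose[OF transition_C1[OF d c] C1_on_bump[of UNIV]]) simp
  qed
  have "closed ?K" using compact_chart_ball by (rule compact_imp_closed)
  have op: "openin (top_of_set M) (fst d - ?K)"
  proof (rule openin_diff[OF chart_openin[OF d]])
    show "closedin (top_of_set M) ?K"
      using \<open>closed ?K\<close> chart_ball_subset chart_subset[OF c] by (intro closed_subset) auto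
  qed
  have op': "open (snd d ` (fst d - ?K))"
    by (rule open_chart_image_of[OF d op]) simp
  have 2: "Ck_on (Suc 0) (snd d ` (fst d - ?K)) ?f"
  proof (rule C1_on_cong[OF op' _ C1_on_const])
    fix y assume "y \<in> snd d ` (fst d - ?K)"
    then obtain q where q: "q \<in> fst d - ?K" "y = snd d q" by (rule imageE)
    then show "?f y = 0"
      by (simp add: in_coords_def chart_inv_chart[OF d] chart_bump_eq_0)
  qed
  have "chart_image d = snd d ` (fst d \<inter> fst c) \<union> snd d ` (fst d - ?K)"
    using chart_ball_subset by (simp add: image_Un[symmetric]) (rule arg_cong[of _ _ "image (snd d)"], blast)
  then show "Ck_on (Suc 0) (chart_image d) ?f"
    using C1_on_Un[OF 1 2 open_overlap_image[OF d c] op'] by (simp only:)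
qed

lemma chart_bump_pos: "p \<in> fst c \<Longrightarrow> snd c p = a \<Longrightarrow> chart_bump c r a p > 0"
  using r by (simp add: chart_bump_def bump_pos_iff)

end

end

section \<open>The Witten measure in a chart\<close>

locale witten_manifold = compact_riemannian_manifold M A g
  for M :: "'a::t2_space set" and A :: "('a, 'n::finite) chart set" and g :: "('a, 'n) metric" +
  fixes H :: "'a \<Rightarrow> real"
  assumes nonempty: "M \<noteq> {}" and H_smooth: "smooth_on_manifold A H"
    and prob_witten: "prob_space (witten_measure M A g H)"
begin

abbreviation \<mu> :: "'a measure" where
  "\<mu> \<equiv> witten_measure M A g H"

definition mass :: real where
  "mass = (LINT y|vol. exp (- H y))"

lemma H_Ck: "Ck_on_manifold n A H"
  unfolding Ck_on_manifold_def
proof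
  fix c assume "c \<in> A"
  with H_smooth have "smooth_on (chart_image c) (in_coords c H)"
    unfolding smooth_on_manifold_def by (rule bspec)
  then show "Ck_on n (chart_image c) (in_coords c H)"
    unfolding smooth_on_def by (rule spec)
qed

lemma H_measurable: "H \<in> borel_measurable borel_M"
  by (rule continuous_on_M_measurable[OF C1_manifold_continuous[OF H_Ck]])

lemma \<mu>_eq: "\<mu> = density vol (\<lambda>x. ennreal (exp (- H x) / mass))"
  by (simp add: witten_measure_def mass_def Let_def)

lemma sets_\<mu>: "sets \<mu> = sets borel_M"
  by (simp add: \<mu>_eq sets_vol[OF nonempty])

lemma space_\<mu>: "space \<mu> = M"
  using sets_eq_imp_space_eq[OF sets_\<mu>] by (simp add: space_borel_M)

lemma measurable_\<mu>: "f \<in> borel_measurable borel_M \<Longrightarrow> f \<in> borel_measurable \<mu>"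
  by (simp add: measurable_cong_sets[OF sets_\<mu> refl])

sublocale prob_space \<mu> by (rule prob_witten)

text \<open>Otherwise the density of \<open>\<mu>\<close> would be a quotient by zero, hence zero, and \<open>\<mu>\<close> would not be a
probability measure.\<close>

lemma mass_pos: "mass > 0"
proof (rule ccontr)
  assume "\<not> mass > 0"
  moreover have "mass \<ge> 0" unfolding mass_def by (intro integral_nonneg_AE) auto
  ultimately have "mass = 0" by simp
  then have "emeasure \<mu> (space \<mu>) = 0"
    unfolding \<mu>_eq by (subst emeasure_density) (auto simp: measurable_cong_sets[OF sets_vol[OF nonempty] refl])
  then show False using emeasure_space_1 by simp
qed

text \<open>The density of \<open>\<mu>\<close> with respect to Lebesgue measure in the coordinates of \<open>c\<close>.\<close>

definition weight :: "('a, 'n) chart \<Rightarrow> real^'n \<Rightarrow> real" where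
  "weight c y = exp (- in_coords c H y) / mass * in_coords c (volume_density g c) y"

lemma weight_pos: "c \<in> A \<Longrightarrow> y \<in> chart_image c \<Longrightarrow> weight c y > 0"
  using mass_pos volume_density_pos[OF _ chart_inv_in] by (simp add: weight_def in_coords_def)

lemma nn_integral_vol_chart:
  assumes c: "c \<in> A" and k: "k \<in> borel_measurable borel_M"
  shows "(\<integral>\<^sup>+p. indicator (fst c) p * k p \<partial>vol)
    = (\<integral>\<^sup>+y. indicator (chart_image c) y * (ennreal (volume_density g c (chart_inv c y)) * k (chart_inv c y)) \<partial>lborel)"
proof -
  note U = chart_in_borel_M[OF c]
  have eq: "density vol (indicator (fst c)) = density (chart_volume M g c) (indicator (fst c))"
  proof (rule measure_eqI)
    show "sets (density vol (indicator (fst c))) = sets (density (chart_volume M g c) (indicator (fst c)))"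
      by (simp add: sets_vol[OF nonempty])
    fix B assume "B \<in> sets (density vol (indicator (fst c)))"
    then have B: "B \<in> sets borel_M" by (simp add: sets_vol[OF nonempty])
    have e: "emeasure (density N (indicator (fst c))) B = emeasure N (fst c \<inter> B)"
      if "sets N = sets borel_M" for N
    proof -
      have "emeasure (density N (indicator (fst c))) B = (\<integral>\<^sup>+p. indicator (fst c) p * indicator B p \<partial>N)"
        using that U B by (intro emeasure_density) auto
      also have "\<dots> = (\<integral>\<^sup>+p. indicator (fst c \<inter> B) p \<partial>N)"
        by (simp add: indicator_inter_arith)
      finally show ?thesis using that U B by simp
    qed
    show "emeasure (density vol (indicator (fst c))) B = emeasure (density (chart_volume M g c) (indicator (fst c))) B"
      using emeasure_riemannian_volume[OF c, of "fst c \<inter> B"] U B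
      by (simp add: e sets_vol[OF nonempty])
  qed
  have d: "(\<integral>\<^sup>+p. indicator (fst c) p * k p \<partial>N) = (\<integral>\<^sup>+p. k p \<partial>density N (indicator (fst c)))"
    if "sets N = sets borel_M" for N
    using that U k by (subst nn_integral_density) (auto simp: measurable_cong_sets[OF that refl])
  have "(\<integral>\<^sup>+p. indicator (fst c) p * k p \<partial>vol) = (\<integral>\<^sup>+p. indicator (fst c) p * k p \<partial>chart_volume M g c)"
    by (simp add: d sets_vol[OF nonempty] eq)
  also have "\<dots> = (\<integral>\<^sup>+y. indicator (chart_image c) y * (ennreal (volume_density g c (chart_inv c y)) * (indicator (fst c) (chart_inv c y) * k (chart_inv c y))) \<partial>lborel)"
    using U k by (intro nn_integral_chart_volume[OF c]) auto
  also have "\<dots> = (\<integral>\<^sup>+y. indicator (chart_image c) y * (ennreal (volume_density g c (chart_inv c y)) * k (chart_inv c y)) \<partial>lborel)"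
    using chart_inv_in[of _ c] by (intro nn_integral_cong) (simp add: indicator_def)
  finally show ?thesis .
qed

lemma density_chart:
  assumes c: "c \<in> A"
  shows "density \<mu> (indicator (fst c))
    = distr (density (restrict_space lborel (chart_image c)) (\<lambda>y. ennreal (weight c y))) borel_M (chart_inv c)"
    and "(\<lambda>y. ennreal (weight c y)) \<in> borel_measurable (restrict_space lborel (chart_image c))"
    and "weight c \<in> borel_measurable (restrict_space lborel (chart_image c))"
proof -
  let ?R = "restrict_space lborel (chart_image c)"
  note U = chart_in_borel_M[OF c]
  have "continuous_on (chart_image c) (weight c)"
    unfolding weight_def using mass_pos
    by (intro continuous_intros Ck_on_imp_continuous[OF C1_manifold_chart[OF H_Ck c]] continuous_volume_density[OF c]) auto
  from borel_measurable_continuous_on_restrict[OF this]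
  show wm: "weight c \<in> borel_measurable ?R"
    by (subst measurable_cong_sets[OF sets_restrict_space_cong[OF sets_lborel] refl])
  then show wm': "(\<lambda>y. ennreal (weight c y)) \<in> borel_measurable ?R" by measurable
  have em: "(\<lambda>x. ennreal (exp (- H x) / mass)) \<in> borel_measurable borel_M"
    using H_measurable by measurable
  show "density \<mu> (indicator (fst c)) = distr (density ?R (\<lambda>y. ennreal (weight c y))) borel_M (chart_inv c)"
  proof (rule measure_eqI)
    show "sets (density \<mu> (indicator (fst c))) = sets (distr (density ?R (\<lambda>y. ennreal (weight c y))) borel_M (chart_inv c))"
      by (simp add: sets_\<mu>)
    fix B assume "B \<in> sets (density \<mu> (indicator (fst c)))"
    then have B: "B \<in> sets borel_M" by (simp add: sets_\<mu>)
    have im: "(\<lambda>p. indicator (fst c) p * indicator B p :: ennreal) \<in> borel_measurable borel_M"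
      using U B by measurable
    have "emeasure (density \<mu> (indicator (fst c))) B = (\<integral>\<^sup>+p. indicator (fst c) p * indicator B p \<partial>\<mu>)"
      using U B by (intro emeasure_density measurable_\<mu> borel_measurable_indicator) (auto simp: sets_\<mu>)
    also have "\<dots> = (\<integral>\<^sup>+p. ennreal (exp (- H p) / mass) * (indicator (fst c) p * indicator B p) \<partial>vol)"
      unfolding \<mu>_eq using em im
      by (intro nn_integral_density) (auto simp: measurable_cong_sets[OF sets_vol[OF nonempty] refl])
    also have "\<dots> = (\<integral>\<^sup>+p. indicator (fst c) p * (ennreal (exp (- H p) / mass) * indicator B p) \<partial>vol)"
      by (simp add: mult_ac)
    also have "\<dots> = (\<integral>\<^sup>+y. indicator (chart_image c) y * (ennreal (volume_density g c (chart_inv c y)) *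
        (ennreal (exp (- H (chart_inv c y)) / mass) * indicator B (chart_inv c y))) \<partial>lborel)"
      using em B by (intro nn_integral_vol_chart[OF c]) auto
    also have "\<dots> = (\<integral>\<^sup>+y. ennreal (weight c y) * indicator B (chart_inv c y) * indicator (chart_image c) y \<partial>lborel)"
    proof (intro nn_integral_cong)
      fix y
      show "indicator (chart_image c) y * (ennreal (volume_density g c (chart_inv c y)) *
        (ennreal (exp (- H (chart_inv c y)) / mass) * indicator B (chart_inv c y)))
        = ennreal (weight c y) * indicator B (chart_inv c y) * indicator (chart_image c) y"
      proof (cases "y \<in> chart_image c")
        case True
        have "ennreal (volume_density g c (chart_inv c y)) * ennreal (exp (- H (chart_inv c y)) / mass) = ennreal (weight c y)"
          using volume_density_pos[OF c chart_inv_in[OF True]] mass_pos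
          by (simp add: ennreal_mult'[symmetric] weight_def in_coords_def mult.commute)
        with True show ?thesis by (simp add: mult.assoc[symmetric])
      qed simp
    qed
    also have "\<dots> = (\<integral>\<^sup>+y. ennreal (weight c y) * indicator B (chart_inv c y) \<partial>?R)"
      using open_chart_image[OF c] by (intro nn_integral_restrict_space[symmetric]) simp
    also have "\<dots> = (\<integral>\<^sup>+y. indicator B (chart_inv c y) \<partial>density ?R (\<lambda>y. ennreal (weight c y)))"
      using wm' measurable_compose[OF chart_inv_measurable[OF c], of "indicator B" borel] B
      by (intro nn_integral_density[symmetric]) auto
    also have "\<dots> = (\<integral>\<^sup>+p. indicator B p \<partial>distr (density ?R (\<lambda>y. ennreal (weight c y))) borel_M (chart_inv c))"
      using chart_inv_measurable[OF c] B by (intro nn_integral_distr[symmetric]) auto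
    also have "\<dots> = emeasure (distr (density ?R (\<lambda>y. ennreal (weight c y))) borel_M (chart_inv c)) B"
      using B by simp
    finally show "emeasure (density \<mu> (indicator (fst c))) B
        = emeasure (distr (density ?R (\<lambda>y. ennreal (weight c y))) borel_M (chart_inv c)) B" .
  qed
qed

text \<open>Restricted to the domain of a chart, \<open>\<mu>\<close> is the image of the measure with density \<^const>\<open>weight\<close>.\<close>

lemma integral_in_chart:
  fixes F :: "'a \<Rightarrow> real"
  assumes c: "c \<in> A" and F: "F \<in> borel_measurable borel_M" and F0: "\<And>p. p \<notin> fst c \<Longrightarrow> F p = 0"
  shows "(LINT p|\<mu>. F p) = (LINT y|lborel. indicator (chart_image c) y * (weight c y * F (chart_inv c y)))" (is ?eq)
    and "integrable \<mu> F \<longleftrightarrow> integrable lborel (\<lambda>y. indicator (chart_image c) y * (weight c y * F (chart_inv c y)))" (is ?iff)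
proof -
  let ?R = "restrict_space lborel (chart_image c)"
  note U = chart_in_borel_M[OF c]
  have F\<mu>: "F \<in> borel_measurable \<mu>" by (rule measurable_\<mu>[OF F])
  have ind: "indicator (fst c) p * F p = F p" for p using F0 by (cases "p \<in> fst c") auto
  have Ui: "(indicator (fst c) :: 'a \<Rightarrow> real) \<in> borel_measurable \<mu>"
    using U by (simp add: sets_\<mu> borel_measurable_indicator_iff)
  have 1: "density \<mu> (indicator (fst c)) = density \<mu> (\<lambda>p. ennreal (indicator (fst c) p))"
    by (simp add: ennreal_indicator)
  have wAE: "AE y in ?R. 0 \<le> weight c y"
    using weight_pos[OF c] by (intro AE_I2) (auto simp: space_restrict_space less_imp_le)
  have Fc: "(\<lambda>y. F (chart_inv c y)) \<in> borel_measurable ?R"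
    by (rule measurable_compose[OF chart_inv_measurable[OF c] F])
  have V: "chart_image c \<inter> space lborel \<in> sets lborel" using open_chart_image[OF c] by simp
  have inv_m: "chart_inv c \<in> measurable (density ?R (\<lambda>y. ennreal (weight c y))) borel_M"
    using chart_inv_measurable[OF c] by simp
  have "(LINT p|\<mu>. F p) = (LINT p|density \<mu> (indicator (fst c)). F p)"
    unfolding 1 using F\<mu> Ui by (subst integral_density) (auto simp: ind)
  also have "\<dots> = (LINT y|density ?R (\<lambda>y. ennreal (weight c y)). F (chart_inv c y))"
    unfolding density_chart(1)[OF c] by (rule integral_distr[OF inv_m F])
  also have "\<dots> = (LINT y|?R. weight c y * F (chart_inv c y))"
    using density_chart(3)[OF c] Fc wAE by (subst integral_density) auto
  also have "\<dots> = (LINT y|lborel. indicator (chart_image c) y * (weight c y * F (chart_inv c y)))"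
    using V by (subst integral_restrict_space) auto
  finally show ?eq .
  have "integrable \<mu> F \<longleftrightarrow> integrable (density \<mu> (indicator (fst c))) F"
    unfolding 1 using F\<mu> Ui by (subst integrable_density) (auto simp: ind)
  also have "\<dots> \<longleftrightarrow> integrable (density ?R (\<lambda>y. ennreal (weight c y))) (\<lambda>y. F (chart_inv c y))"
    unfolding density_chart(1)[OF c] by (rule integrable_distr_eq[OF inv_m F])
  also have "\<dots> \<longleftrightarrow> integrable ?R (\<lambda>y. weight c y * F (chart_inv c y))"
    using density_chart(3)[OF c] Fc wAE by (subst integrable_density) auto
  also have "\<dots> \<longleftrightarrow> integrable lborel (\<lambda>y. indicator (chart_image c) y * (weight c y * F (chart_inv c y)))"
    using V by (subst integrable_restrict_space) auto
  finally show ?iff .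
qed

end

section \<open>The inner product of gradients\<close>

context compact_riemannian_manifold
begin

lemma chart_at_in: "p \<in> M \<Longrightarrow> chart_at A p \<in> A" "p \<in> M \<Longrightarrow> p \<in> fst (chart_at A p)"
proof -
  assume "p \<in> M"
  then have "\<exists>c. c \<in> A \<and> p \<in> fst c" using charts_cover by blast
  from someI_ex[OF this] show "chart_at A p \<in> A" "p \<in> fst (chart_at A p)"
    unfolding chart_at_def by blast+
qed

lemma C1_chart_differentiable:
  assumes "Ck_on_manifold (Suc n) A f" "c \<in> A" "p \<in> fst c"
  shows "in_coords c f differentiable (at (snd c p))"
  using C1_manifold_chart[OF assms(1,2)] assms(3) by simp

lemma C2_imp_C1_manifold: "Ck_on_manifold (Suc n) A f \<Longrightarrow> Ck_on_manifold n A f"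
  unfolding Ck_on_manifold_def using Ck_on_Suc by blast

text \<open>The chart that \<^const>\<open>chart_at\<close> assigns to a point is an arbitrary choice that may jump from point to
point. Chart independence is what makes continuity and measurability visible.\<close>

lemma grad_inner_chart:
  assumes f: "Ck_on_manifold (Suc n) A f" and h: "Ck_on_manifold (Suc m) A h" and c: "c \<in> A" "p \<in> fst c"
  shows "grad_inner A g f h p = chart_grad_inner c f h p"
proof -
  have p: "p \<in> M" using c chart_subset by blast
  note d = chart_at_in[OF p]
  have "grad_inner A g f h p = chart_grad_inner (chart_at A p) f h p"
    by (simp add: grad_inner_def Let_def chart_grad_inner_def)
  also have "\<dots> = chart_grad_inner c f h p"
    by (rule chart_grad_inner_invariant[OF d(1) c(1) d(2) c(2)
          C1_chart_differentiable[OF f c] C1_chart_differentiable[OF h c]])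
  finally show ?thesis .
qed

text \<open>Differentials are local: they depend on the function near the point only.\<close>

lemma coord_deriv_transform_within_openin:
  assumes c: "c \<in> A" "p \<in> fst c" and U: "openin (top_of_set M) U" "p \<in> U"
    and eq: "\<And>q. q \<in> U \<Longrightarrow> q \<in> fst c \<Longrightarrow> f q = h q"
    and diff: "in_coords c h differentiable (at (snd c p))"
  shows "coord_deriv c f p = coord_deriv c h p"
proof -
  let ?D = "frechet_derivative (in_coords c h) (at (snd c p))"
  have D: "(in_coords c h has_derivative ?D) (at (snd c p))"
    using diff by (simp add: frechet_derivative_works)
  have op: "open (snd c ` (fst c \<inter> U))"
    by (rule open_chart_image_of[OF c(1) openin_Int[OF chart_openin[OF c(1)] U(1)]]) simp
  have "(in_coords c f has_derivative ?D) (at (snd c p))"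
  proof (rule has_derivative_transform_within_open[OF D op])
    show "snd c p \<in> snd c ` (fst c \<inter> U)" using c U by blast
    fix y assume "y \<in> snd c ` (fst c \<inter> U)"
    then obtain q where q: "q \<in> fst c \<inter> U" "y = snd c q" by (rule imageE)
    then show "in_coords c h y = in_coords c f y"
      using eq[of q] by (simp add: in_coords_def chart_inv_chart[OF c(1)])
  qed
  then have "frechet_derivative (in_coords c f) (at (snd c p)) = ?D"
    by (rule frechet_derivative_at[symmetric])
  then show ?thesis by (simp add: coord_deriv_def partial_deriv_def)
qed

lemma continuous_grad_inner:
  assumes f: "Ck_on_manifold (Suc (Suc 0)) A f" and h: "Ck_on_manifold (Suc 0) A h"
  shows "continuous_on M (grad_inner A g f h)"
proof (rule continuous_on_M_of_charts)
  fix c assume c: "c \<in> A"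
  have "continuous_on (chart_image c) (\<lambda>y. \<Sum>i\<in>UNIV. gradient g c f (chart_inv c y) $ i * coord_deriv c h (chart_inv c y) $ i)"
    by (intro continuous_on_sum continuous_on_mult continuous_coord_deriv[OF c]
        Ck_on_imp_continuous[OF C1_gradient[OF c]] C1_manifold_chart[OF f c] C1_manifold_chart[OF h c])
  then show "continuous_on (chart_image c) (in_coords c (grad_inner A g f h))"
  proof (rule continuous_on_eq)
    fix y assume "y \<in> chart_image c"
    note p = chart_inv_in[OF this]
    show "(\<Sum>i\<in>UNIV. gradient g c f (chart_inv c y) $ i * coord_deriv c h (chart_inv c y) $ i) = in_coords c (grad_inner A g f h) y"
      by (simp add: in_coords_def grad_inner_chart[OF f h c p] chart_grad_inner_eq(1)[OF c p] inner_vec_def)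
  qed
qed

end

context witten_manifold
begin

text \<open>The Witten Laplacian computed in a prescribed chart.\<close>

definition chart_witten :: "('a, 'n) chart \<Rightarrow> ('a \<Rightarrow> real) \<Rightarrow> 'a \<Rightarrow> real" where
  "chart_witten c f p = divergence g c (gradient g c f) p - chart_grad_inner c H f p"

section \<open>Integration by parts in a chart\<close>

text \<open>The Witten Laplacian is the divergence of the gradient with respect to the weighted volume: with
\<open>\<rho>\<close> the \<^const>\<open>weight\<close> and \<open>V\<close> the gradient of \<open>f\<close>, the Euclidean divergence of \<open>\<rho> \<eta> V\<close> is \<open>\<rho>\<close> times the sum of
\<open>\<eta>\<close> times the Witten Laplacian and of the derivative of \<open>\<eta>\<close> along \<open>V\<close>. Differentiating the factor
\<open>exp (- H)\<close> of \<open>\<rho>\<close> produces the drift term.\<close>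

lemma weighted_divergence:
  assumes c: "c \<in> A" and f: "Ck_on (Suc (Suc 0)) (chart_image c) (in_coords c f)"
    and e: "Ck_on (Suc 0) (chart_image c) (in_coords c \<eta>)"
  defines "h \<equiv> \<lambda>i y. weight c y * in_coords c \<eta> y * gradient g c f (chart_inv c y) $ i"
  shows "Ck_on (Suc 0) (chart_image c) (h i)"
    and "y \<in> chart_image c \<Longrightarrow> (\<Sum>i\<in>UNIV. frechet_derivative (h i) (at y) (axis i 1))
      = weight c y * (\<eta> (chart_inv c y) * chart_witten c f (chart_inv c y) + chart_grad_inner c f \<eta> (chart_inv c y))"
proof -
  let ?V = "chart_image c" and ?vd = "in_coords c (volume_density g c)" and ?H = "in_coords c H" and ?e = "in_coords c \<eta>"
  define k where "k = (\<lambda>i y. ?vd y * gradient g c f (chart_inv c y) $ i)"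
  define s where "s = (\<lambda>y. exp (- ?H y) / mass)"
  have H1: "Ck_on (Suc 0) ?V ?H" by (rule C1_manifold_chart[OF H_Ck c])
  have k1: "Ck_on (Suc 0) ?V (k i)" for i
    unfolding k_def by (rule C1_on_mult[OF C1_volume_density[OF c] C1_gradient[OF c f]])
  have s1: "Ck_on (Suc 0) ?V s"
    unfolding s_def divide_inverse by (rule C1_on_mult[OF C1_on_exp[OF C1_on_uminus[OF H1]] C1_on_const])
  have h_eq: "h i = (\<lambda>y. s y * ?e y * k i y)" for i
    by (simp add: h_def k_def s_def weight_def fun_eq_iff)
  show "Ck_on (Suc 0) ?V (h i)"
    unfolding h_eq by (rule C1_on_mult[OF C1_on_mult[OF s1 e] k1])
  assume y: "y \<in> ?V"
  let ?p = "chart_inv c y"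
  have p: "?p \<in> fst c" by (rule chart_inv_in[OF y])
  let ?D = "\<lambda>u. frechet_derivative u (at y)"
  note ds = C1_on_has_derivative[OF H1 y] C1_on_has_derivative[OF e y]
  have "(s has_derivative (\<lambda>v. - ?D ?H v * s y)) (at y)"
    unfolding s_def using mass_pos
    by (auto intro!: derivative_eq_intros ds simp: fun_eq_iff)
  then have "(h i has_derivative (\<lambda>v. s y * ?e y * ?D (k i) v + (s y * ?D ?e v + - ?D ?H v * s y * ?e y) * k i y)) (at y)" for i
    unfolding h_eq by (intro has_derivative_mult C1_on_has_derivative[OF k1 y] ds)
  then have Dh: "?D (h i) = (\<lambda>v. s y * ?e y * ?D (k i) v + (s y * ?D ?e v + - ?D ?H v * s y * ?e y) * k i y)" for i
    by (rule frechet_derivative_at[symmetric])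
  have vd: "?vd y > 0"
    using volume_density_pos[OF c p] by (simp add: in_coords_def)
  have div: "(\<Sum>i\<in>UNIV. ?D (k i) (axis i 1)) = ?vd y * divergence g c (gradient g c f) ?p"
    using vd by (simp add: divergence_def partial_deriv_def k_def in_coords_def chart_chart_inv[OF c y])
  have e': "?D ?e (axis i 1) = coord_deriv c \<eta> ?p $ i" and H': "?D ?H (axis i 1) = coord_deriv c H ?p $ i" for i
    by (simp_all add: coord_deriv_def partial_deriv_def chart_chart_inv[OF c y])
  have gi_e: "(\<Sum>i\<in>UNIV. coord_deriv c \<eta> ?p $ i * k i y) = ?vd y * chart_grad_inner c f \<eta> ?p"
    by (simp add: chart_grad_inner_eq(1)[OF c p] inner_vec_def k_def sum_distrib_left mult_ac)
  have gi_H: "(\<Sum>i\<in>UNIV. coord_deriv c H ?p $ i * k i y) = ?vd y * chart_grad_inner c H f ?p"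
    by (simp add: chart_grad_inner_eq(2)[OF c p] inner_vec_def k_def sum_distrib_left mult_ac)
  have "(\<Sum>i\<in>UNIV. ?D (h i) (axis i 1)) = (\<Sum>i\<in>UNIV. s y * ?e y * ?D (k i) (axis i 1)
      + s y * (coord_deriv c \<eta> ?p $ i * k i y) - s y * ?e y * (coord_deriv c H ?p $ i * k i y))"
    by (intro sum.cong refl) (simp add: Dh e' H' algebra_simps)
  also have "\<dots> = s y * ?e y * (\<Sum>i\<in>UNIV. ?D (k i) (axis i 1)) + s y * (\<Sum>i\<in>UNIV. coord_deriv c \<eta> ?p $ i * k i y)
      - s y * ?e y * (\<Sum>i\<in>UNIV. coord_deriv c H ?p $ i * k i y)"
    by (simp add: sum.distrib sum_subtractf sum_distrib_left)
  also have "\<dots> = weight c y * (\<eta> ?p * chart_witten c f ?p + chart_grad_inner c f \<eta> ?p)"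
    unfolding div gi_e gi_H by (simp add: weight_def s_def chart_witten_def in_coords_def algebra_simps)
  finally show "(\<Sum>i\<in>UNIV. ?D (h i) (axis i 1)) = \<dots>" .
qed

text \<open>By the previous identity the expression is a divergence of a C1 field over the positive weight.\<close>

lemma continuous_chart_witten:
  assumes c: "c \<in> A" and f: "Ck_on (Suc (Suc 0)) (chart_image c) (in_coords c f)"
    and e: "Ck_on (Suc 0) (chart_image c) (in_coords c \<eta>)"
  shows "continuous_on (chart_image c)
    (\<lambda>y. \<eta> (chart_inv c y) * chart_witten c f (chart_inv c y) + chart_grad_inner c f \<eta> (chart_inv c y))"
proof -
  let ?h = "\<lambda>i y. weight c y * in_coords c \<eta> y * gradient g c f (chart_inv c y) $ i"
  have w: "continuous_on (chart_image c) (weight c)"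
    unfolding weight_def using mass_pos
    by (intro continuous_intros Ck_on_imp_continuous[OF C1_manifold_chart[OF H_Ck c]] continuous_volume_density[OF c]) auto
  have "continuous_on (chart_image c) (\<lambda>y. (\<Sum>i\<in>UNIV. frechet_derivative (?h i) (at y) (axis i 1)) / weight c y)"
    using weight_pos[OF c]
    by (intro continuous_on_divide continuous_on_sum C1_on_continuous_derivative weighted_divergence(1)[OF c f e] w)
       (auto simp: less_imp_neq[symmetric])
  then show ?thesis
  proof (rule continuous_on_eq)
    fix y assume y: "y \<in> chart_image c"
    show "(\<Sum>i\<in>UNIV. frechet_derivative (?h i) (at y) (axis i 1)) / weight c y
      = \<eta> (chart_inv c y) * chart_witten c f (chart_inv c y) + chart_grad_inner c f \<eta> (chart_inv c y)"
      using weighted_divergence(2)[OF c f e y] weight_pos[OF c y] by simp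
  qed
qed

text \<open>The weighted field \<open>\<rho> \<eta> V\<close> has compact support in the coordinate image, extends by zero to a C1 field on
the whole space, and its divergence integrates to zero.\<close>

lemma chart_integration_by_parts:
  assumes c: "c \<in> A" and f: "Ck_on (Suc (Suc 0)) (chart_image c) (in_coords c f)"
    and e: "Ck_on (Suc 0) (chart_image c) (in_coords c \<eta>)"
    and K: "compact K" "K \<subseteq> fst c" and e0: "\<And>p. p \<in> fst c - K \<Longrightarrow> \<eta> p = 0"
  shows "(LINT p|\<mu>. indicator K p * (\<eta> p * chart_witten c f p + chart_grad_inner c f \<eta> p)) = 0"
    and "integrable \<mu> (\<lambda>p. indicator K p * (\<eta> p * chart_witten c f p + chart_grad_inner c f \<eta> p))"
proof -
  let ?V = "chart_image c"
  let ?T = "\<lambda>p. \<eta> p * chart_witten c f p + chart_grad_inner c f \<eta> p"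
  let ?F = "\<lambda>p. indicator K p * ?T p"
  define h where "h = (\<lambda>i y. weight c y * in_coords c \<eta> y * gradient g c f (chart_inv c y) $ i)"
  have h1: "Ck_on (Suc 0) ?V (h i)" for i
    unfolding h_def by (rule weighted_divergence(1)[OF c f e])
  have h2: "(\<Sum>i\<in>UNIV. frechet_derivative (h i) (at y) (axis i 1)) = weight c y * ?T (chart_inv c y)"
    if "y \<in> ?V" for y
    unfolding h_def by (rule weighted_divergence(2)[OF c f e that])
  define u where "u = (\<lambda>i y. if y \<in> ?V then h i y else 0)"
  let ?C = "- snd c ` K"
  have cK: "compact (snd c ` K)"
    by (rule compact_continuous_image[OF continuous_on_subset[OF continuous_chart[OF c] K(2)] K(1)])
  then have oC: "open ?C" by (intro open_Compl compact_imp_closed)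
  have oV: "open ?V" by (rule open_chart_image[OF c])
  have u0: "u i y = 0" if "y \<in> ?C" for i y
  proof (cases "y \<in> ?V")
    case True
    then obtain p where p: "p \<in> fst c" "y = snd c p" by (rule imageE)
    with that have "p \<in> fst c - K" by blast
    then have "in_coords c \<eta> y = 0" using e0 p by (simp add: in_coords_def chart_inv_chart[OF c])
    then show ?thesis by (simp add: u_def h_def)
  qed (simp add: u_def)
  have uV: "Ck_on (Suc 0) ?V (u i)" for i
    by (rule C1_on_cong[OF oV _ h1]) (simp add: u_def)
  have uC: "Ck_on (Suc 0) ?C (u i)" for i
    by (rule C1_on_cong[OF oC u0 C1_on_const])
  have UN: "?V \<union> ?C = UNIV" using K(2) by blast
  have u1: "Ck_on (Suc 0) UNIV (u i)" for i
    using C1_on_Un[OF uV uC oV oC] unfolding UN .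
  let ?D = "\<lambda>i y. frechet_derivative (u i) (at y) (axis i 1)"
  have DV: "?D i y = frechet_derivative (h i) (at y) (axis i 1)" if "y \<in> ?V" for i y
  proof -
    have "(u i has_derivative frechet_derivative (h i) (at y)) (at y)"
      by (rule has_derivative_transform_within_open[OF C1_on_has_derivative[OF h1 that] oV that]) (simp add: u_def)
    then show ?thesis by (simp add: frechet_derivative_at[symmetric])
  qed
  have DC: "?D i y = 0" if "y \<in> ?C" for i y
  proof -
    have "(u i has_derivative (\<lambda>v. 0)) (at y)"
      by (rule has_derivative_transform_within_open[OF has_derivative_const oC that]) (simp add: u0)
    then show ?thesis by (simp add: frechet_derivative_at[symmetric])
  qed
  have uint: "integrable lborel (u i)" for i
    by (rule integrable_lborel_continuous_compact_support[OF Ck_on_imp_continuous[OF u1] cK]) (simp add: u0)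
  have Dint: "integrable lborel (?D i)" for i
    by (rule integrable_lborel_continuous_compact_support[OF C1_on_continuous_derivative[OF u1] cK]) (simp add: DC)
  have D0: "(LINT y|lborel. ?D i y) = 0" for i
    by (rule integral_directional_derivative_eq_0[where u="u i" and u'="\<lambda>y. frechet_derivative (u i) (at y)"])
       (use C1_on_has_derivative[OF u1] C1_on_continuous_derivative[OF u1] uint Dint in simp_all)
  have coord: "indicator ?V y * (weight c y * ?F (chart_inv c y)) = (\<Sum>i\<in>UNIV. ?D i y)" for y
  proof (cases "y \<in> snd c ` K")
    case True
    then have y: "y \<in> ?V" "chart_inv c y \<in> K"
      using chart_image_subset_iff[OF c K(2)] by simp_all
    then show ?thesis by (simp add: DV h2)
  next
    case False
    then have "indicator ?V y * indicator K (chart_inv c y) = (0::real)"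
      using chart_image_subset_iff[OF c K(2), of y] by (simp add: indicator_def)
    then have "indicator ?V y * (weight c y * ?F (chart_inv c y)) = 0" by (simp, blast)
    with False show ?thesis by (simp add: DC)
  qed
  have Fm: "?F \<in> borel_measurable borel_M"
  proof -
    have "continuous_on K ?T"
    proof (rule continuous_on_eq)
      show "continuous_on K (\<lambda>p. (\<lambda>y. ?T (chart_inv c y)) (snd c p))"
        by (rule continuous_on_compose2[OF continuous_chart_witten[OF c f e]
            continuous_on_subset[OF continuous_chart[OF c] K(2)]]) (use K(2) in blast)
      fix p assume "p \<in> K"
      then show "(\<lambda>y. ?T (chart_inv c y)) (snd c p) = ?T p"
        using chart_inv_chart[OF c subsetD[OF K(2)]] by simp
    qed
    then have "(\<lambda>p. indicator K p *\<^sub>R ?T p) \<in> borel_measurable borel"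
      by (rule borel_measurable_continuous_on_indicator[rotated]) (rule borel_compact[OF K(1)])
    then show ?thesis by (intro measurable_restrict_space1) simp
  qed
  have F0: "?F p = 0" if "p \<notin> fst c" for p using that K(2) by (auto simp: indicator_def)
  have "(LINT p|\<mu>. ?F p) = (LINT y|lborel. indicator ?V y * (weight c y * ?F (chart_inv c y)))"
    by (rule integral_in_chart(1)[OF c Fm F0])
  also have "\<dots> = (LINT y|lborel. (\<Sum>i\<in>UNIV. ?D i y))" by (simp only: coord)
  also have "\<dots> = 0" using Dint D0 by simp
  finally show "(LINT p|\<mu>. ?F p) = 0" .
  have "integrable lborel (\<lambda>y. indicator ?V y * (weight c y * ?F (chart_inv c y)))"
    unfolding coord using Dint by simp
  moreover have "integrable \<mu> ?F \<longleftrightarrow> integrable lborel (\<lambda>y. indicator ?V y * (weight c y * ?F (chart_inv c y)))"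
    by (rule integral_in_chart(2)[OF c Fm F0])
  ultimately show "integrable \<mu> ?F" by (simp only:)
qed

section \<open>Chart independence of the Witten Laplacian\<close>

text \<open>In coordinates the mass of the set is the integral of a positive density over a ball, which is not a
null set.\<close>

lemma measure_chart_ball_pos:
  assumes c: "c \<in> A" and r: "r > 0" and V: "ball a r \<subseteq> chart_image c"
  shows "chart_inv c ` ball a r \<in> sets \<mu>" "emeasure \<mu> (chart_inv c ` ball a r) > 0"
proof -
  let ?E = "chart_inv c ` ball a r"
  have E: "?E \<subseteq> fst c" using chart_inv_in V by blast
  have im: "snd c ` ?E = ball a r"
    unfolding image_image using chart_chart_inv[OF c] V by force
  have "openin (top_of_set (fst c)) (chart_inv c ` ball a r)"
    by (rule homeomorphism_imp_open_map[OF chart_homeomorphism[OF c, THEN homeomorphism_symD]])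
       (use V in \<open>simp add: openin_open_eq[OF open_chart_image[OF c]]\<close>)
  then have "openin (top_of_set M) ?E"
    by (rule openin_trans[OF _ chart_openin[OF c]])
  then have sE: "?E \<in> sets borel_M" by (rule borel_M_openin)
  then show sE': "?E \<in> sets \<mu>" by (simp add: sets_\<mu>)
  show "emeasure \<mu> ?E > 0"
  proof (rule ccontr)
    assume "\<not> emeasure \<mu> ?E > 0"
    then have "measure \<mu> ?E = 0" by (simp add: measure_def)
    let ?F = "indicator ?E :: 'a \<Rightarrow> real"
    have Fm: "?F \<in> borel_measurable borel_M" using sE by simp
    have F0: "?F p = 0" if "p \<notin> fst c" for p using that E by (auto simp: indicator_def)
    have int\<mu>: "integrable \<mu> ?F" using sE' by (simp add: integrable_indicator_iff emeasure_finite less_top[symmetric])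
    have "integrable \<mu> ?F \<longleftrightarrow> integrable lborel (\<lambda>y. indicator (chart_image c) y * (weight c y * ?F (chart_inv c y)))"
      by (rule integral_in_chart(2)[OF c Fm F0])
    with int\<mu> have int: "integrable lborel (\<lambda>y. indicator (chart_image c) y * (weight c y * ?F (chart_inv c y)))"
      by (simp only:)
    have "(LINT p|\<mu>. ?F p) = (LINT y|lborel. indicator (chart_image c) y * (weight c y * ?F (chart_inv c y)))"
      by (rule integral_in_chart(1)[OF c Fm F0])
    moreover have "(LINT p|\<mu>. ?F p) = 0" using \<open>measure \<mu> ?E = 0\<close> sE' by simp
    ultimately have 0: "(LINT y|lborel. indicator (chart_image c) y * (weight c y * ?F (chart_inv c y))) = 0"
      by (simp only:)
    have nn: "0 \<le> indicator (chart_image c) y * (weight c y * ?F (chart_inv c y))" for y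
      using weight_pos[OF c, of y] by (cases "y \<in> chart_image c") (simp_all add: less_imp_le)
    have "AE y in lborel. indicator (chart_image c) y * (weight c y * ?F (chart_inv c y)) = 0"
      using integral_nonneg_eq_0_iff_AE[OF int] 0 nn by simp
    then have "AE y in lborel. y \<notin> ball a r"
    proof (rule AE_mp, intro AE_I2 impI notI)
      fix y assume z: "indicator (chart_image c) y * (weight c y * ?F (chart_inv c y)) = 0" and y: "y \<in> ball a r"
      then have "y \<in> chart_image c" using V by blast
      then show False using z y weight_pos[OF c, of y] by simp
    qed
    then have "emeasure lborel (ball a r) = 0"
      by (subst (asm) AE_iff_measurable[of "ball a r"]) (auto simp: ball_def)
    then show False using content_ball_pos[OF r, of a] by (simp add: measure_def)
  qed
qed

lemma integral_pos_of_pos_on_chart_ball: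
  fixes F :: "'a \<Rightarrow> real"
  assumes F: "integrable \<mu> F" "\<And>p. p \<in> M \<Longrightarrow> F p \<ge> 0"
    and c: "c \<in> A" and r: "r > 0" and V: "ball a r \<subseteq> chart_image c"
    and pos: "\<And>y. y \<in> ball a r \<Longrightarrow> F (chart_inv c y) > 0"
  shows "(LINT p|\<mu>. F p) \<noteq> 0"
proof
  let ?E = "chart_inv c ` ball a r"
  note E = measure_chart_ball_pos[OF c r V]
  assume "(LINT p|\<mu>. F p) = 0"
  moreover have "AE p in \<mu>. 0 \<le> F p"
    using F(2) by (intro AE_I2) (simp add: space_\<mu>)
  ultimately have "AE p in \<mu>. F p = 0"
    using integral_nonneg_eq_0_iff_AE[OF F(1)] by simp
  then have "AE p in \<mu>. p \<notin> ?E"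
    by (rule AE_mp) (use pos in \<open>force intro!: AE_I2\<close>)
  then have "emeasure \<mu> ?E = 0"
    using sets.sets_into_space[OF E(1)]
    by (subst (asm) AE_iff_measurable[OF E(1)]) auto
  with E(2) show False by simp
qed

text \<open>A direct verification would differentiate Jacobian determinants. The weak form avoids this: the
terms with \<^const>\<open>chart_grad_inner\<close> are chart independent, so integration by parts in both charts
shows that the difference of the two operators integrates to zero against every bump in the overlap.
If the difference were positive at a point, it would be positive on a small ball, and a bump on this
ball would give a positive integral.\<close>

lemma chart_witten_le:
  assumes f: "Ck_on_manifold (Suc (Suc 0)) A f"
    and c: "c \<in> A" and d: "d \<in> A" and p: "p \<in> fst c" "p \<in> fst d"
  shows "chart_witten c f p \<le> chart_witten d f p"
proof (rule ccontr)
  assume not_le: "\<not> chart_witten c f p \<le> chart_witten d f p"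
  let ?O = "snd c ` (fst c \<inter> fst d)"
  let ?D = "\<lambda>y. chart_witten c f (chart_inv c y) - chart_witten d f (chart_inv c y)"
  note fc = C1_manifold_chart[OF f c] and fd = C1_manifold_chart[OF f d]
  have zero: "coord_deriv e (\<lambda>_. 1) q = 0" for e q
    by (simp add: coord_deriv_def partial_deriv_def in_coords_def vec_eq_iff)
  have cont: "continuous_on (chart_image e) (\<lambda>y. chart_witten e f (chart_inv e y))" if e: "e \<in> A" for e
  proof (rule continuous_on_eq)
    show "continuous_on (chart_image e) (\<lambda>y. 1 * chart_witten e f (chart_inv e y) + chart_grad_inner e f (\<lambda>_. 1) (chart_inv e y))"
      by (rule continuous_chart_witten[OF e C1_manifold_chart[OF f e], of "\<lambda>_. 1"])
         (simp add: in_coords_def C1_on_const del: Ck_on.simps)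
    fix y assume "y \<in> chart_image e"
    then show "1 * chart_witten e f (chart_inv e y) + chart_grad_inner e f (\<lambda>_. 1) (chart_inv e y) = chart_witten e f (chart_inv e y)"
      using chart_grad_inner_eq(1)[OF e chart_inv_in] by (simp add: zero)
  qed
  \<comment> \<open>Continuity of the operator of \<open>d\<close> in the coordinates of \<open>c\<close> is transported by the transition map.\<close>
  have "continuous_on ?O (\<lambda>y. chart_witten d f (chart_inv d (transition c d y)))"
  proof (rule continuous_on_compose2[OF cont[OF d] Ck_on_imp_continuous[OF transition_C1[OF c d]]])
    show "transition c d ` ?O \<subseteq> chart_image d"
    proof
      fix z assume "z \<in> transition c d ` ?O"
      then obtain q where q: "q \<in> fst c \<inter> fst d" "z = transition c d (snd c q)" by blast
      then show "z \<in> chart_image d" using transition_chart[OF c, of q d] by simp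
    qed
  qed
  then have "continuous_on ?O (\<lambda>y. chart_witten d f (chart_inv c y))"
  proof (rule continuous_on_eq)
    fix y assume "y \<in> ?O"
    then obtain q where q: "q \<in> fst c \<inter> fst d" "y = snd c q" by (rule imageE)
    then show "chart_witten d f (chart_inv d (transition c d y)) = chart_witten d f (chart_inv c y)"
      using transition_chart[OF c, of q d] by (simp add: chart_inv_chart[OF c] chart_inv_chart[OF d])
  qed
  then have "continuous_on ?O ?D"
    using continuous_on_subset[OF cont[OF c], of ?O] by (intro continuous_on_diff) auto
  then have "open (?O \<inter> ?D -` {0<..})"
    by (rule continuous_open_preimage[OF _ open_overlap_image[OF c d]]) simp
  moreover have "snd c p \<in> ?O \<inter> ?D -` {0<..}"
    using p not_le by (simp add: chart_inv_chart[OF c])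
  ultimately obtain r where r: "r > 0" "cball (snd c p) r \<subseteq> ?O \<inter> ?D -` {0<..}"
    using open_contains_cball by blast
  let ?a = "snd c p"
  let ?\<eta> = "chart_bump c r ?a" and ?K = "chart_ball c r ?a"
  have V: "cball ?a r \<subseteq> chart_image c" using r(2) by blast
  note K = compact_chart_ball[OF c r(1) V] and Kc = chart_ball_subset[OF c r(1) V]
  have Kd: "?K \<subseteq> fst d"
  proof
    fix q assume "q \<in> ?K"
    then obtain y where y: "y \<in> cball ?a r" "q = chart_inv c y" unfolding chart_ball_def by (rule imageE)
    then have "y \<in> ?O" using r(2) by blast
    then obtain q' where "q' \<in> fst c \<inter> fst d" "y = snd c q'" by (rule imageE)
    then show "q \<in> fst d" using y by (simp add: chart_inv_chart[OF c])
  qed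
  note e1 = C1_chart_bump[OF c r(1) V]
  have e0: "?\<eta> q = 0" if "q \<in> S - ?K" for q S
    using that chart_bump_eq_0[OF c r(1) V, of q] by simp
  have Ic1: "(LINT q|\<mu>. indicator ?K q * (?\<eta> q * chart_witten c f q + chart_grad_inner c f ?\<eta> q)) = 0"
    by (rule chart_integration_by_parts(1)[OF c fc C1_manifold_chart[OF e1 c] K Kc]) (rule e0)
  have Ic2: "integrable \<mu> (\<lambda>q. indicator ?K q * (?\<eta> q * chart_witten c f q + chart_grad_inner c f ?\<eta> q))"
    by (rule chart_integration_by_parts(2)[OF c fc C1_manifold_chart[OF e1 c] K Kc]) (rule e0)
  have Id1: "(LINT q|\<mu>. indicator ?K q * (?\<eta> q * chart_witten d f q + chart_grad_inner d f ?\<eta> q)) = 0"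
    by (rule chart_integration_by_parts(1)[OF d fd C1_manifold_chart[OF e1 d] K Kd]) (rule e0)
  have Id2: "integrable \<mu> (\<lambda>q. indicator ?K q * (?\<eta> q * chart_witten d f q + chart_grad_inner d f ?\<eta> q))"
    by (rule chart_integration_by_parts(2)[OF d fd C1_manifold_chart[OF e1 d] K Kd]) (rule e0)
  let ?F = "\<lambda>q. indicator ?K q * (?\<eta> q * (chart_witten c f q - chart_witten d f q))"
  have F: "indicator ?K q * (?\<eta> q * chart_witten c f q + chart_grad_inner c f ?\<eta> q)
      - indicator ?K q * (?\<eta> q * chart_witten d f q + chart_grad_inner d f ?\<eta> q) = ?F q" for q
  proof (cases "q \<in> ?K")
    case True
    then have q: "q \<in> fst c" "q \<in> fst d" using Kc Kd by blast+
    have "chart_grad_inner c f ?\<eta> q = chart_grad_inner d f ?\<eta> q"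
      by (rule chart_grad_inner_invariant[OF c d q C1_chart_differentiable[OF f d q(2)] C1_chart_differentiable[OF e1 d q(2)]])
    then show ?thesis by (simp add: algebra_simps)
  qed simp
  have Fi: "integrable \<mu> ?F"
    using Bochner_Integration.integrable_diff[OF Ic2 Id2] unfolding F .
  have F0: "(LINT q|\<mu>. ?F q) = 0"
    using Bochner_Integration.integral_diff[OF Ic2 Id2] unfolding F Ic1 Id1
    by (simp only: diff_self)
  have onK: "chart_witten c f q - chart_witten d f q > 0" if "q \<in> ?K" for q
  proof -
    from that obtain y where y: "y \<in> cball ?a r" "q = chart_inv c y" unfolding chart_ball_def by (rule imageE)
    then have "y \<in> ?D -` {0<..}" using r(2) by blast
    then show ?thesis using y by simp
  qed
  have "(LINT q|\<mu>. ?F q) \<noteq> 0"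
  proof (rule integral_pos_of_pos_on_chart_ball[OF Fi _ c r(1)])
    show "?F q \<ge> 0" for q
      using onK[of q] chart_bump_nonneg[OF c r(1) V, of q] by (cases "q \<in> ?K") (simp_all add: less_imp_le)
    show "ball ?a r \<subseteq> chart_image c" using V ball_subset_cball by blast
    fix y assume y: "y \<in> ball ?a r"
    then have yV: "y \<in> chart_image c" using V ball_subset_cball by blast
    have yK: "chart_inv c y \<in> ?K" unfolding chart_ball_def using y ball_subset_cball by blast
    have "?\<eta> (chart_inv c y) > 0"
      using y r(1) bump_pos_iff[OF r(1), of ?a y] chart_inv_in[OF yV] by (simp add: chart_bump_def chart_chart_inv[OF c yV])
    then show "?F (chart_inv c y) > 0" using onK[OF yK] yK by simp
  qed
  with F0 show False by simp
qed

lemma witten_laplacian_chart: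
  assumes f: "Ck_on_manifold (Suc (Suc 0)) A f" and c: "c \<in> A" and p: "p \<in> fst c"
  shows "witten_laplacian A g H f p = chart_witten c f p"
proof -
  have pM: "p \<in> M" using c p chart_subset by blast
  note d = chart_at_in[OF pM]
  have "witten_laplacian A g H f p = chart_witten (chart_at A p) f p"
    by (simp add: witten_laplacian_def laplace_beltrami_def grad_inner_def Let_def chart_witten_def chart_grad_inner_def)
  then show ?thesis
    using chart_witten_le[OF f d(1) c d(2) p] chart_witten_le[OF f c d(1) p d(2)] by simp
qed

section \<open>Integration by parts on the manifold\<close>

text \<open>The sets where one bump is positive form an open cover, so compactness gives a finite subfamily whose
sum is positive everywhere.\<close>

lemma finite_bump_cover:
  "\<exists>I. finite I \<and> (\<forall>c r a. (c, r, a) \<in> I \<longrightarrow> c \<in> A \<and> r > 0 \<and> cball a r \<subseteq> chart_image c) \<and>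
    (\<forall>p\<in>M. (\<Sum>(c, r, a)\<in>I. chart_bump c r a p) > 0)"
proof -
  define J where "J = {(c, r, a). c \<in> A \<and> r > 0 \<and> cball a r \<subseteq> chart_image c}"
  have JD: "c \<in> A" "r > 0" "cball a r \<subseteq> chart_image c" if "(c, r, a) \<in> J" for c r a
    using that unfolding J_def by simp_all
  define U where "U = (\<lambda>(c, r, a). M \<inter> chart_bump c r a -` {0<..})"
  have op: "openin (top_of_set M) (U t)" if t: "t \<in> J" for t
  proof -
    obtain c r a where tt: "t = (c, r, a)" by (cases t) auto
    have "continuous_on M (chart_bump c r a)"
      using C1_manifold_continuous[OF C1_chart_bump[OF JD[of c r a]]] t unfolding tt by blast
    then show ?thesis
      unfolding U_def tt prod.case by (rule continuous_openin_preimage_gen) simp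
  qed
  have cover: "M \<subseteq> \<Union>(U ` J)"
  proof
    fix p assume p: "p \<in> M"
    then obtain c where c: "c \<in> A" "p \<in> fst c" using charts_cover by blast
    then obtain r where r: "r > 0" "cball (snd c p) r \<subseteq> chart_image c"
      using open_contains_cball open_chart_image[OF c(1)] by (metis imageI)
    then have J: "(c, r, snd c p) \<in> J" using c by (simp add: J_def)
    have "p \<in> U (c, r, snd c p)"
      using p chart_bump_pos[OF c(1) r c(2)] by (simp add: U_def)
    then show "p \<in> \<Union>(U ` J)" using J by blast
  qed
  have "(\<forall>X\<in>U ` J. openin (top_of_set M) X) \<and> M \<subseteq> \<Union>(U ` J)"
    using cover by (simp only: ball_simps) (simp add: op)
  then have "\<exists>D\<subseteq>U ` J. finite D \<and> M \<subseteq> \<Union>D"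
    by (rule compact_M[unfolded compact_eq_openin_cover, THEN spec, THEN mp])
  then obtain D where D: "D \<subseteq> U ` J" "finite D" "M \<subseteq> \<Union>D" by (elim exE conjE)
  obtain I where I: "I \<subseteq> J" "finite I" "D = U ` I"
    using finite_subset_image[OF D(2,1)] by (elim exE conjE)
  show ?thesis
  proof (intro exI[of _ I] conjI allI impI ballI)
    show "finite I" by (rule I(2))
    show "c \<in> A" "r > 0" "cball a r \<subseteq> chart_image c" if "(c, r, a) \<in> I" for c r a
      by (rule JD[OF subsetD[OF I(1) that]])+
    fix p assume "p \<in> M"
    then obtain t where t: "t \<in> I" "p \<in> U t" using D(3) unfolding I(3) by (elim UN_E[OF subsetD])
    obtain c r a where tt: "t = (c, r, a)" by (cases t) auto
    show "(\<Sum>(c, r, a)\<in>I. chart_bump c r a p) > 0"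
    proof (rule sum_pos2[OF I(2) t(1)])
      show "0 < (case t of (c, r, a) \<Rightarrow> chart_bump c r a p)"
        using t(2) by (simp add: tt U_def)
      show "0 \<le> (case s of (c, r, a) \<Rightarrow> chart_bump c r a p)" for s
        by (cases s) (simp add: chart_bump_def bump_nonneg)
    qed
  qed
qed

lemma grad_inner_eq_0:
  assumes U: "openin (top_of_set M) U" "p \<in> U" and eq: "\<And>q. q \<in> U \<Longrightarrow> h q = 0"
  shows "grad_inner A g f h p = 0"
proof -
  have pM: "p \<in> M" using U openin_imp_subset by blast
  note d = chart_at_in[OF pM]
  have "coord_deriv (chart_at A p) h p = coord_deriv (chart_at A p) (\<lambda>_. 0) p"
    by (rule coord_deriv_transform_within_openin[OF d U]) (simp_all add: eq in_coords_def)
  also have "\<dots> = 0"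
    by (simp add: coord_deriv_def partial_deriv_def in_coords_def vec_eq_iff)
  finally show ?thesis
    using chart_grad_inner_eq(1)[OF d, of f h]
    by (simp add: grad_inner_def Let_def chart_grad_inner_def)
qed

lemma grad_inner_sum:
  assumes p: "p \<in> M" and h: "\<And>t. t \<in> I \<Longrightarrow> Ck_on_manifold (Suc 0) A (h t)"
    and eq: "\<And>q. q \<in> M \<Longrightarrow> k q = (\<Sum>t\<in>I. h t q)"
  shows "grad_inner A g f k p = (\<Sum>t\<in>I. grad_inner A g f (h t) p)"
proof -
  let ?d = "chart_at A p"
  note d = chart_at_in[OF p]
  have D: "(in_coords ?d (\<lambda>q. \<Sum>t\<in>I. h t q) has_derivative
      (\<lambda>v. \<Sum>t\<in>I. frechet_derivative (in_coords ?d (h t)) (at (snd ?d p)) v)) (at (snd ?d p))"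
    unfolding in_coords_def[of _ "\<lambda>q. \<Sum>t\<in>I. h t q"]
    using C1_chart_differentiable[OF h d]
    by (intro has_derivative_sum) (simp add: frechet_derivative_works in_coords_def)
  have "coord_deriv ?d k p = coord_deriv ?d (\<lambda>q. \<Sum>t\<in>I. h t q) p"
    by (rule coord_deriv_transform_within_openin[OF d openin_subtopology_self p])
       (use eq D in \<open>auto simp: differentiable_def\<close>)
  also have "\<dots> = (\<Sum>t\<in>I. coord_deriv ?d (h t) p)"
    by (simp add: vec_eq_iff coord_deriv_def partial_deriv_def frechet_derivative_at[OF D, symmetric])
  finally show ?thesis
    using chart_grad_inner_eq(1)[OF d, of f]
    by (simp add: grad_inner_def Let_def chart_grad_inner_def inner_sum_right)
qed

text \<open>A partition of unity splits \<open>q\<close> into functions \<open>h t\<close> with compact support in single charts.\<close>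

theorem integration_by_parts:
  assumes f: "Ck_on_manifold (Suc (Suc 0)) A f" and q: "Ck_on_manifold (Suc 0) A q"
  shows "(LINT p|\<mu>. q p * witten_laplacian A g H f p + grad_inner A g f q p) = 0"
    and "integrable \<mu> (\<lambda>p. q p * witten_laplacian A g H f p + grad_inner A g f q p)"
proof -
  obtain I where I: "finite I"
    "\<forall>c r a. (c, r, a) \<in> I \<longrightarrow> c \<in> A \<and> r > 0 \<and> cball a r \<subseteq> chart_image c"
    and S_pos: "\<forall>p\<in>M. (\<Sum>(c, r, a)\<in>I. chart_bump c r a p) > 0"
    using finite_bump_cover by (elim exE conjE)
  define b where "b = (\<lambda>(c, r, a). chart_bump c r a)"
  define S where "S = (\<lambda>p. \<Sum>t\<in>I. b t p)"
  have Spos: "S p > 0" if "p \<in> M" for p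
    using bspec[OF S_pos that] by (simp add: S_def b_def case_prod_unfold)
  define h where "h = (\<lambda>t p. b t p * (q p * inverse (S p)))"
  have b1: "Ck_on_manifold (Suc 0) A (b t)" if "t \<in> I" for t
  proof -
    obtain c r a where tt: "t = (c, r, a)" by (cases t) auto
    have "c \<in> A" "r > 0" "cball a r \<subseteq> chart_image c"
      using I(2)[rule_format, of c r a] that unfolding tt by simp_all
    then show ?thesis unfolding tt b_def prod.case by (rule C1_chart_bump)
  qed
  have h1: "Ck_on_manifold (Suc 0) A (h t)" if t: "t \<in> I" for t
    unfolding Ck_on_manifold_def
  proof
    fix c assume c: "c \<in> A"
    have S1: "Ck_on (Suc 0) (chart_image c) (\<lambda>y. \<Sum>t\<in>I. in_coords c (b t) y)"
      by (rule C1_on_sum) (rule C1_manifold_chart[OF b1 c])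
    have "Ck_on (Suc 0) (chart_image c) (\<lambda>y. in_coords c (b t) y * (in_coords c q y * inverse (\<Sum>t\<in>I. in_coords c (b t) y)))"
    proof (rule C1_on_mult[OF C1_manifold_chart[OF b1[OF t] c] C1_on_mult[OF C1_manifold_chart[OF q c] C1_on_inverse[OF S1]]])
      fix y assume "y \<in> chart_image c"
      then have "chart_inv c y \<in> M" using chart_inv_in chart_subset[OF c] by blast
      from Spos[OF this] show "(\<Sum>t\<in>I. in_coords c (b t) y) \<noteq> 0"
        by (simp add: S_def in_coords_def)
    qed
    then show "Ck_on (Suc 0) (chart_image c) (in_coords c (h t))"
      unfolding in_coords_def h_def S_def .
  qed
  have q_eq: "q p = (\<Sum>t\<in>I. h t p)" if "p \<in> M" for p
  proof -
    have "(\<Sum>t\<in>I. h t p) = S p * (q p * inverse (S p))"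
      by (simp add: h_def S_def sum_distrib_right)
    then show ?thesis using Spos[OF that] by simp
  qed
  let ?L = "witten_laplacian A g H f"
  have part: "(LINT p|\<mu>. h t p * ?L p + grad_inner A g f (h t) p) = 0 \<and>
      integrable \<mu> (\<lambda>p. h t p * ?L p + grad_inner A g f (h t) p)" if t: "t \<in> I" for t
  proof -
    obtain c r a where tt: "t = (c, r, a)" by (cases t) auto
    have c: "c \<in> A" and r: "r > 0" and V: "cball a r \<subseteq> chart_image c"
      using I(2)[rule_format, of c r a] t unfolding tt by simp_all
    let ?K = "chart_ball c r a"
    note K = compact_chart_ball[OF c r V] chart_ball_subset[OF c r V]
    have h0: "h t p = 0" if "p \<notin> ?K" for p
      using chart_bump_eq_0[OF c r V that] by (simp add: h_def b_def tt)
    have h0': "h t p = 0" if "p \<in> fst c - ?K" for p using h0 that by blast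
    have op: "openin (top_of_set M) (M - ?K)"
      using compact_imp_closed[OF K(1)] K(2) chart_subset[OF c]
      by (intro openin_diff openin_subtopology_self closed_subset) auto
    have eq: "h t p * ?L p + grad_inner A g f (h t) p
        = indicator ?K p * (h t p * chart_witten c f p + chart_grad_inner c f (h t) p)" if p: "p \<in> M" for p
    proof (cases "p \<in> ?K")
      case True
      then have pc: "p \<in> fst c" using K(2) by blast
      show ?thesis
        using True by (simp add: witten_laplacian_chart[OF f c pc] grad_inner_chart[OF f h1[OF t] c pc])
    next
      case False
      then have "grad_inner A g f (h t) p = 0"
        using p h0 by (intro grad_inner_eq_0[OF op]) auto
      then show ?thesis using False h0 by simp
    qed
    let ?T = "\<lambda>p. h t p * ?L p + grad_inner A g f (h t) p"
    let ?T' = "\<lambda>p. indicator ?K p * (h t p * chart_witten c f p + chart_grad_inner c f (h t) p)"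
    have "(LINT p|\<mu>. ?T p) = (LINT p|\<mu>. ?T' p)"
      by (rule Bochner_Integration.integral_cong[OF refl]) (simp only: space_\<mu> eq)
    also have "\<dots> = 0"
      by (rule chart_integration_by_parts(1)[OF c C1_manifold_chart[OF f c] C1_manifold_chart[OF h1[OF t] c] K]) (rule h0')
    finally have "(LINT p|\<mu>. ?T p) = 0" .
    moreover have "integrable \<mu> ?T \<longleftrightarrow> integrable \<mu> ?T'"
      by (rule Bochner_Integration.integrable_cong[OF refl]) (simp only: space_\<mu> eq)
    moreover have "integrable \<mu> ?T'"
      by (rule chart_integration_by_parts(2)[OF c C1_manifold_chart[OF f c] C1_manifold_chart[OF h1[OF t] c] K]) (rule h0')
    ultimately show ?thesis by blast
  qed
  have total: "q p * ?L p + grad_inner A g f q p = (\<Sum>t\<in>I. h t p * ?L p + grad_inner A g f (h t) p)" if "p \<in> M" for p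
    by (simp add: q_eq[OF that] sum.distrib sum_distrib_right grad_inner_sum[OF that h1 q_eq])
  have "integrable \<mu> (\<lambda>p. \<Sum>t\<in>I. h t p * ?L p + grad_inner A g f (h t) p)"
    using part by (intro Bochner_Integration.integrable_sum) blast
  moreover have "integrable \<mu> (\<lambda>p. q p * ?L p + grad_inner A g f q p)
      \<longleftrightarrow> integrable \<mu> (\<lambda>p. \<Sum>t\<in>I. h t p * ?L p + grad_inner A g f (h t) p)"
    by (rule Bochner_Integration.integrable_cong[OF refl]) (simp only: space_\<mu> total)
  ultimately show "integrable \<mu> (\<lambda>p. q p * ?L p + grad_inner A g f q p)" by (simp only:)
  have "(LINT p|\<mu>. q p * ?L p + grad_inner A g f q p) = (LINT p|\<mu>. (\<Sum>t\<in>I. h t p * ?L p + grad_inner A g f (h t) p))"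
    by (rule Bochner_Integration.integral_cong[OF refl]) (simp only: space_\<mu> total)
  also have "\<dots> = (\<Sum>t\<in>I. LINT p|\<mu>. h t p * ?L p + grad_inner A g f (h t) p)"
    using part by (intro Bochner_Integration.integral_sum) blast
  also have "\<dots> = 0" using part by simp
  finally show "(LINT p|\<mu>. q p * ?L p + grad_inner A g f q p) = 0" .
qed

end

section \<open>Normal approximation of eigenfunctions\<close>

context compact_riemannian_manifold
begin

lemma bounded_on_M:
  fixes F :: "'a \<Rightarrow> real"
  assumes "continuous_on M F"
  shows "\<exists>K. \<forall>p\<in>M. \<bar>F p\<bar> \<le> K"
proof -
  have "compact (F ` M)" using assms compact_M by (rule compact_continuous_image)
  then have "bounded (F ` M)" by (rule compact_imp_bounded)
  then show ?thesis unfolding bounded_iff by auto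
qed

lemma coord_deriv_eq_0:
  assumes c: "c \<in> A" and p: "p \<in> fst c" and 0: "chart_grad_inner c f f p = 0"
  shows "coord_deriv c f p = 0"
proof -
  have "gradient g c f p = 0"
    using metric_positive[OF c p, of "gradient g c f p"] 0 unfolding chart_grad_inner_def by force
  then show ?thesis
    using metric_gradient[OF c p, of f] by simp
qed

text \<open>In a chart all partial derivatives vanish on a ball, so \<open>f\<close> is locally constant.\<close>

lemma constant_of_zero_gradient:
  assumes conn: "connected M" and f: "Ck_on_manifold (Suc 0) A f"
    and 0: "\<And>p. p \<in> M \<Longrightarrow> grad_inner A g f f p = 0" and pq: "p \<in> M" "q \<in> M"
  shows "f p = f q"
proof (rule connected_local_const[OF conn pq], rule ballI)
  fix a assume "a \<in> M"
  then obtain c where c: "c \<in> A" "a \<in> fst c" using charts_cover by blast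
  then have "snd c a \<in> chart_image c" by blast
  then have "\<exists>e>0. ball (snd c a) e \<subseteq> chart_image c"
    by (rule open_contains_ball[THEN iffD1, OF open_chart_image[OF c(1)], THEN bspec])
  then obtain r where r: "r > 0" "ball (snd c a) r \<subseteq> chart_image c"
    by (elim exE conjE)
  let ?B = "ball (snd c a) r"
  have const: "in_coords c f y = in_coords c f (snd c a)" if y: "y \<in> ?B" for y
  proof -
    have D: "(in_coords c f has_derivative (\<lambda>v. 0)) (at z within ?B)" if z: "z \<in> ?B" for z
    proof -
      have zV: "z \<in> chart_image c" using z r(2) by blast
      note p = chart_inv_in[OF zV]
      have pM: "chart_inv c z \<in> M" using p chart_subset[OF c(1)] by blast
      have "chart_grad_inner c f f (chart_inv c z) = 0"
        using 0[OF pM] grad_inner_chart[OF f f c(1) p] by simp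
      then have d0: "coord_deriv c f (chart_inv c z) = 0" by (rule coord_deriv_eq_0[OF c(1) p])
      have D: "(in_coords c f has_derivative frechet_derivative (in_coords c f) (at z)) (at z)"
        by (rule C1_on_has_derivative[OF C1_manifold_chart[OF f c(1)] zV])
      have ax: "frechet_derivative (in_coords c f) (at z) (axis i 1) = 0" for i
        using arg_cong[OF d0, of "\<lambda>v. v $ i"]
        by (simp add: coord_deriv_def partial_deriv_def chart_chart_inv[OF c(1) zV])
      have "frechet_derivative (in_coords c f) (at z) v = 0" for v
        by (subst linear_axis_sum[OF has_derivative_linear[OF D]]) (simp only: ax mult_zero_right sum.neutral_const)
      then have "frechet_derivative (in_coords c f) (at z) = (\<lambda>v. 0)" by (rule ext)
      with D have "(in_coords c f has_derivative (\<lambda>v. 0)) (at z)" by (simp only:)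
      then show ?thesis by (rule has_derivative_at_withinI)
    qed
    have "\<exists>k. \<forall>z\<in>?B. in_coords c f z = k"
      by (rule has_derivative_zero_constant[OF convex_ball D])
    moreover have "snd c a \<in> ?B" using r(1) by simp
    ultimately show ?thesis using y by metis
  qed
  have "openin (top_of_set (fst c)) (fst c \<inter> snd c -` ?B)"
    by (rule continuous_openin_preimage_gen[OF continuous_chart[OF c(1)] open_ball])
  then have "openin (top_of_set M) (fst c \<inter> snd c -` ?B)"
    by (rule openin_trans[OF _ chart_openin[OF c(1)]])
  then obtain T where T: "open T" "fst c \<inter> snd c -` ?B = M \<inter> T"
    unfolding openin_open by (elim exE conjE)
  have "a \<in> T" using c r T(2) by force
  then have "\<forall>\<^sub>F b in at a within M. b \<in> T \<and> b \<in> M"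
    using T(1) by (auto simp: eventually_at_topological)
  then show "\<forall>\<^sub>F b in at a within M. f a = f b"
  proof (rule eventually_mono)
    fix b assume "b \<in> T \<and> b \<in> M"
    then have "b \<in> fst c \<inter> snd c -` ?B" using T(2) by blast
    then have b: "b \<in> fst c" "snd c b \<in> ?B" by simp_all
    show "f a = f b"
      using const[OF b(2)] by (simp add: in_coords_def chart_inv_chart[OF c(1) b(1)] chart_inv_chart[OF c])
  qed
qed

lemma C1_compose_manifold:
  fixes f :: "'k::finite \<Rightarrow> 'a \<Rightarrow> real"
  assumes f: "\<And>i. Ck_on_manifold (Suc 0) A (f i)" and q: "Ck_on (Suc 0) UNIV q"
  shows "Ck_on_manifold (Suc 0) A (\<lambda>p. q (\<chi> i. f i p))"
  unfolding Ck_on_manifold_def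
proof
  fix c assume c: "c \<in> A"
  have "Ck_on (Suc 0) (chart_image c) (\<lambda>y. q ((\<lambda>y. \<chi> i. in_coords c (f i) y) y))"
  proof (rule C1_on_compose[OF C1_on_vec q])
    show "Ck_on (Suc 0) (chart_image c) (\<lambda>y. (\<chi> i. in_coords c (f i) y) $ i)" for i
      using C1_manifold_chart[OF f c, of i] by (simp del: Ck_on.simps)
  qed simp
  then show "Ck_on (Suc 0) (chart_image c) (in_coords c (\<lambda>p. q (\<chi> i. f i p)))"
    unfolding in_coords_def by simp
qed

lemma grad_inner_compose:
  fixes f :: "'k::finite \<Rightarrow> 'a \<Rightarrow> real"
  assumes f: "\<And>i. Ck_on_manifold (Suc 0) A (f i)" and q: "Ck_on (Suc 0) UNIV q" and p: "p \<in> M"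
  shows "grad_inner A g h (\<lambda>p. q (\<chi> i. f i p)) p
    = (\<Sum>j\<in>UNIV. frechet_derivative q (at (\<chi> i. f i p)) (axis j 1) * grad_inner A g h (f j) p)"
proof -
  let ?d = "chart_at A p" and ?Dq = "frechet_derivative q (at (\<chi> i. f i p))"
  note d = chart_at_in[OF p]
  let ?D = "\<lambda>j. frechet_derivative (in_coords ?d (f j)) (at (snd ?d p))"
  have fd: "(in_coords ?d (f j) has_derivative ?D j) (at (snd ?d p))" for j
    using C1_chart_differentiable[OF f d] by (simp add: frechet_derivative_works)
  have vec: "((\<lambda>y. \<chi> i. in_coords ?d (f i) y) has_derivative (\<lambda>v. \<chi> i. ?D i v)) (at (snd ?d p))"
    unfolding has_derivative_componentwise_within[of "\<lambda>y. \<chi> i. in_coords ?d (f i) y"]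
  proof
    fix b :: "real^'k" assume "b \<in> Basis"
    then obtain i where b: "b = axis i 1" by (auto simp: Basis_vec_def)
    show "((\<lambda>y. (\<chi> i. in_coords ?d (f i) y) \<bullet> b) has_derivative (\<lambda>v. (\<chi> i. ?D i v) \<bullet> b)) (at (snd ?d p))"
      using fd[of i] by (simp add: b inner_axis)
  qed
  have at: "(\<chi> i. in_coords ?d (f i) (snd ?d p)) = (\<chi> i. f i p)"
    by (simp add: in_coords_def chart_inv_chart[OF d])
  have Dq: "(q has_derivative ?Dq) (at (\<chi> i. in_coords ?d (f i) (snd ?d p)))"
    unfolding at by (rule C1_on_has_derivative[OF q]) simp
  have "((\<lambda>y. q (\<chi> i. in_coords ?d (f i) y)) has_derivative (\<lambda>v. ?Dq (\<chi> i. ?D i v))) (at (snd ?d p))"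
    by (rule has_derivative_compose[OF vec Dq])
  then have der: "(in_coords ?d (\<lambda>p. q (\<chi> i. f i p)) has_derivative (\<lambda>v. ?Dq (\<chi> i. ?D i v))) (at (snd ?d p))"
    unfolding in_coords_def .
  have "coord_deriv ?d (\<lambda>p. q (\<chi> i. f i p)) p = (\<Sum>j\<in>UNIV. ?Dq (axis j 1) *\<^sub>R coord_deriv ?d (f j) p)"
  proof (rule vec_eq_iff[THEN iffD2], rule allI)
    fix l
    have "coord_deriv ?d (\<lambda>p. q (\<chi> i. f i p)) p $ l = ?Dq (\<chi> i. ?D i (axis l 1))"
      by (simp add: coord_deriv_def partial_deriv_def frechet_derivative_at[OF der, symmetric])
    also have "\<dots> = (\<Sum>j\<in>UNIV. (\<chi> i. ?D i (axis l 1)) $ j * ?Dq (axis j 1))"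
      by (rule linear_axis_sum[OF has_derivative_linear[OF Dq]])
    also have "\<dots> = (\<Sum>j\<in>UNIV. ?Dq (axis j 1) *\<^sub>R coord_deriv ?d (f j) p) $ l"
      by (simp add: coord_deriv_def partial_deriv_def mult.commute)
    finally show "coord_deriv ?d (\<lambda>p. q (\<chi> i. f i p)) p $ l = (\<Sum>j\<in>UNIV. ?Dq (axis j 1) *\<^sub>R coord_deriv ?d (f j) p) $ l" .
  qed
  then show ?thesis
    using chart_grad_inner_eq(1)[OF d, of h]
    by (simp add: grad_inner_def Let_def chart_grad_inner_def inner_sum_right)
qed

end

locale witten_eigenfunctions = witten_manifold M A g H
  for M :: "'a::t2_space set" and A :: "('a, 'n::finite) chart set" and g :: "('a, 'n) metric" and H :: "'a \<Rightarrow> real" +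
  fixes f :: "'k::finite \<Rightarrow> 'a \<Rightarrow> real" and \<nu> :: "'k \<Rightarrow> real"
  assumes connected_M: "connected M"
    and f_C2: "\<And>i. Ck_on_manifold 2 A (f i)"
    and eigen: "\<And>i p. p \<in> M \<Longrightarrow> witten_laplacian A g H (f i) p = - \<nu> i * f i p"
    and orthonormal: "\<And>i j. (LINT x|\<mu>. f i x * f j x) = (if i = j then 1 else 0)"
    and mean_zero: "\<And>i. (LINT x|\<mu>. f i x) = 0"
begin

lemma f_C2': "Ck_on_manifold (Suc (Suc 0)) A (f i)"
  using f_C2 by (simp add: numeral_2_eq_2)

lemma f_C1: "Ck_on_manifold (Suc 0) A (f i)"
  by (rule C2_imp_C1_manifold[OF f_C2'])

abbreviation "W \<equiv> \<lambda>x. \<chi> i. f i x"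
abbreviation "G i j \<equiv> grad_inner A g (f i) (f j)"

lemma continuous_f: "continuous_on M (f i)"
  by (rule C1_manifold_continuous[OF f_C1])

lemma continuous_G: "continuous_on M (G i j)"
  by (rule continuous_grad_inner[OF f_C2' f_C1])

lemma continuous_M_integrable:
  fixes F :: "'a \<Rightarrow> real"
  assumes "continuous_on M F"
  shows "integrable \<mu> F"
proof -
  obtain K where K: "\<forall>p\<in>M. \<bar>F p\<bar> \<le> K" using bounded_on_M[OF assms] by blast
  show ?thesis
  proof (rule integrable_const_bound[where B=K])
    show "AE p in \<mu>. norm (F p) \<le> K"
      using K by (intro AE_I2) (simp add: space_\<mu>)
  qed (rule measurable_\<mu>[OF continuous_on_M_measurable[OF assms]])
qed

text \<open>The integrated form of the eigenvalue equation. For \<open>q = f j\<close> it evaluates the mean of \<open>G i j\<close>, and for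
functions of \<open>W\<close> it is the Stein identity.\<close>

lemma eigenfunction_by_parts:
  assumes q: "Ck_on_manifold (Suc 0) A q"
  shows "\<nu> i * (LINT x|\<mu>. f i x * q x) = (LINT x|\<mu>. grad_inner A g (f i) q x)"
proof -
  have iq: "integrable \<mu> (\<lambda>x. f i x * q x)"
    by (rule continuous_M_integrable) (intro continuous_on_mult continuous_f C1_manifold_continuous[OF q])
  have iG: "integrable \<mu> (grad_inner A g (f i) q)"
    by (rule continuous_M_integrable[OF continuous_grad_inner[OF f_C2' q]])
  have "0 = (LINT x|\<mu>. q x * witten_laplacian A g H (f i) x + grad_inner A g (f i) q x)"
    by (rule integration_by_parts(1)[OF f_C2' q, symmetric])
  also have "\<dots> = (LINT x|\<mu>. - \<nu> i * (f i x * q x) + grad_inner A g (f i) q x)"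
    by (rule Bochner_Integration.integral_cong[OF refl]) (simp add: space_\<mu> eigen)
  also have "\<dots> = - \<nu> i * (LINT x|\<mu>. f i x * q x) + (LINT x|\<mu>. grad_inner A g (f i) q x)"
    using iq iG by simp
  finally show ?thesis by simp
qed

lemma expectation_G: "(LINT x|\<mu>. G i j x) = (if i = j then \<nu> i else 0)"
  using eigenfunction_by_parts[OF f_C1, of i j] unfolding orthonormal by (cases "i = j") simp_all

lemma grad_inner_nonneg:
  assumes p: "p \<in> M" shows "grad_inner A g h h p \<ge> 0"
proof -
  note d = chart_at_in[OF p]
  let ?v = "gradient g (chart_at A p) h p"
  have "?v \<bullet> (g (chart_at A p) p *v ?v) \<ge> 0"
    using metric_positive[OF d, of ?v] by (cases "?v = 0") (simp_all add: less_imp_le)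
  then show ?thesis by (simp add: grad_inner_def Let_def)
qed

text \<open>The eigenvalue is the mean of the squared norm of the gradient of \<open>f i\<close>. If it were not positive, this
continuous nonnegative function would vanish, because \<open>\<mu>\<close> charges every ball of a chart. Then \<open>f i\<close> would
be constant on the connected manifold, so zero because of its zero mean, against the normalisation.\<close>

lemma \<nu>_pos: "\<nu> i > 0"
proof (rule ccontr)
  assume "\<not> \<nu> i > 0"
  moreover have E: "(LINT x|\<mu>. G i i x) = \<nu> i" using expectation_G[of i i] by simp
  moreover have "(LINT x|\<mu>. G i i x) \<ge> 0"
    using grad_inner_nonneg by (intro integral_nonneg_AE AE_I2) (simp add: space_\<mu>)
  ultimately have E0: "(LINT x|\<mu>. G i i x) = 0" by simp
  have G0: "G i i p = 0" if p: "p \<in> M" for p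
  proof (rule ccontr)
    assume "G i i p \<noteq> 0"
    then have pos: "G i i p > 0" using grad_inner_nonneg[OF p, of "f i"] by simp
    obtain c where c: "c \<in> A" "p \<in> fst c" using charts_cover[OF p] by blast
    let ?N = "\<lambda>y. G i i (chart_inv c y)"
    have "continuous_on (chart_image c) ?N"
      by (rule continuous_on_compose2[OF continuous_G continuous_chart_inv[OF c(1)]])
         (use chart_inv_in chart_subset[OF c(1)] in blast)
    then have "open (chart_image c \<inter> ?N -` {0<..})"
      by (rule continuous_open_preimage[OF _ open_chart_image[OF c(1)]]) simp
    moreover have "snd c p \<in> chart_image c \<inter> ?N -` {0<..}"
      using pos c by (simp add: chart_inv_chart[OF c])
    ultimately obtain r where r: "r > 0" "ball (snd c p) r \<subseteq> chart_image c \<inter> ?N -` {0<..}"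
      using open_contains_ball by blast
    have "(LINT x|\<mu>. G i i x) \<noteq> 0"
      by (rule integral_pos_of_pos_on_chart_ball[OF continuous_M_integrable[OF continuous_G] grad_inner_nonneg c(1) r(1)])
         (use r(2) in auto)
    with E0 show False by simp
  qed
  obtain p where p: "p \<in> M" using nonempty by blast
  have const: "f i x = f i p" if "x \<in> M" for x
    by (rule constant_of_zero_gradient[OF connected_M f_C1 G0 that p])
  have "(LINT x|\<mu>. f i x) = (LINT x|\<mu>. f i p)"
    by (rule Bochner_Integration.integral_cong[OF refl]) (simp only: space_\<mu> const)
  then have "f i p = 0" using mean_zero[of i] by (simp add: prob_space)
  have "(LINT x|\<mu>. f i x * f i x) = (LINT x|\<mu>. 0)"
    by (rule Bochner_Integration.integral_cong[OF refl]) (simp add: space_\<mu> const \<open>f i p = 0\<close>)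
  then show False using orthonormal[of i i] by simp
qed

lemma W_bounded: "\<exists>K. \<forall>p\<in>M. norm (W p) \<le> K"
proof -
  have "continuous_on M W" using continuous_f by (intro continuous_on_vec_lambda)
  then have "compact (W ` M)" using compact_M by (rule compact_continuous_image)
  then have "bounded (W ` M)" by (rule compact_imp_bounded)
  then obtain K where K: "\<forall>y\<in>W ` M. norm y \<le> K" unfolding bounded_iff by (elim exE)
  show ?thesis by (intro exI[of _ K] ballI bspec[OF K] imageI)
qed

lemma W_measurable: "W \<in> borel_measurable borel_M"
  by (rule continuous_on_M_measurable) (intro continuous_on_vec_lambda continuous_f)

lemma eigenfunctions_stein_data: "\<exists>R. stein_data \<mu> W G \<nu> R"
proof -
  obtain R1 where R1: "\<forall>p\<in>M. norm (W p) \<le> R1" using W_bounded by blast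
  define K where "K = (\<lambda>i j. SOME k. \<forall>p\<in>M. \<bar>G i j p\<bar> \<le> k)"
  have K: "\<forall>p\<in>M. \<bar>G i j p\<bar> \<le> K i j" for i j
    unfolding K_def by (rule someI_ex[OF bounded_on_M[OF continuous_G]])
  define R where "R = max R1 (\<Sum>i\<in>UNIV. \<Sum>j\<in>UNIV. \<bar>K i j\<bar>)"
  have KR: "\<bar>K i j\<bar> \<le> R" for i j
  proof -
    have "\<bar>K i j\<bar> \<le> (\<Sum>j\<in>UNIV. \<bar>K i j\<bar>)" by (rule member_le_sum) auto
    also have "\<dots> \<le> (\<Sum>i\<in>UNIV. \<Sum>j\<in>UNIV. \<bar>K i j\<bar>)"
      by (rule member_le_sum[of i UNIV "\<lambda>i. \<Sum>j\<in>UNIV. \<bar>K i j\<bar>"]) (auto intro: sum_nonneg)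
    finally show ?thesis by (simp add: R_def)
  qed
  have "stein_data \<mu> W G \<nu> R"
  proof (intro stein_data.intro stein_data_axioms.intro prob_witten)
    show "W \<in> borel_measurable \<mu>" by (rule measurable_\<mu>[OF W_measurable])
    show "G i j \<in> borel_measurable \<mu>" for i j
      by (rule measurable_\<mu>[OF continuous_on_M_measurable[OF continuous_G]])
    show "norm (W x) \<le> R" if "x \<in> space \<mu>" for x
      unfolding R_def by (rule max.coboundedI1, rule bspec[OF R1]) (use that in \<open>simp only: space_\<mu>\<close>)
    show "\<bar>G i j x\<bar> \<le> R" if "x \<in> space \<mu>" for x i j
    proof -
      have "\<bar>G i j x\<bar> \<le> K i j" using K that by (simp only: space_\<mu>)
      then show ?thesis using KR[of i j] by linarith
    qed
    show "\<nu> i > 0" for i by (rule \<nu>_pos)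
    fix q :: "real^'k \<Rightarrow> real" and i assume q: "Ck_on (Suc 0) UNIV q"
    have "\<nu> i * (LINT x|\<mu>. f i x * q (W x)) = (LINT x|\<mu>. grad_inner A g (f i) (\<lambda>x. q (W x)) x)"
      by (rule eigenfunction_by_parts[OF C1_compose_manifold[OF f_C1 q]])
    also have "\<dots> = (LINT x|\<mu>. (\<Sum>j\<in>UNIV. frechet_derivative q (at (W x)) (axis j 1) * G i j x))"
      by (rule Bochner_Integration.integral_cong[OF refl]) (simp only: space_\<mu> grad_inner_compose[OF f_C1 q])
    finally show "\<nu> i * (LINT x|\<mu>. W x $ i * q (W x))
        = (LINT x|\<mu>. (\<Sum>j\<in>UNIV. frechet_derivative q (at (W x)) (axis j 1) * G i j x))"
      by simp
  qed
  then show ?thesis by blast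
qed

text \<open>The mean of \<open>G i j\<close> is \<open>\<nu> i\<close> on the diagonal and zero elsewhere, so the matrix \<open>B\<close> of the Stein bound is
the centred matrix \<open>G\<close> with its row \<open>i\<close> divided by \<open>\<nu> i\<close>.\<close>

theorem eigenfunction_normal_approximation:
  assumes h: "1-lipschitz_on UNIV h"
  shows "\<bar>(LINT x|\<mu>. h (W x)) - (LINT z|gaussian. h z)\<bar>
    \<le> (MAX i. inverse (\<nu> i)) *
      (LINT x|\<mu>. sqrt (\<Sum>i\<in>UNIV. \<Sum>j\<in>UNIV. (G i j x - (LINT y|\<mu>. G i j y))\<^sup>2))"
proof -
  obtain R where "stein_data \<mu> W G \<nu> R" using eigenfunctions_stein_data by blast
  then interpret S: stein_data \<mu> W G \<nu> R .
  let ?m = "MAX i. inverse (\<nu> i)"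
  let ?N = "\<lambda>x. sqrt (\<Sum>i\<in>UNIV. \<Sum>j\<in>UNIV. (G i j x - (LINT y|\<mu>. G i j y))\<^sup>2)"
  have m: "inverse (\<nu> i) \<le> ?m" for i by (rule Max_ge) auto
  have m0: "?m \<ge> 0" using m \<nu>_pos by (meson inverse_nonnegative_iff_nonnegative less_imp_le order_trans)
  have B: "S.B i j x = inverse (\<nu> i) * (G i j x - (LINT y|\<mu>. G i j y))" for i j x
    using \<nu>_pos[of i] by (simp add: S.B_def expectation_G field_simps)
  have le: "S.defect x \<le> ?m * ?N x" for x
  proof -
    have "(S.B i j x)\<^sup>2 \<le> ?m\<^sup>2 * (G i j x - (LINT y|\<mu>. G i j y))\<^sup>2" for i j
      unfolding B power_mult_distrib using m[of i] \<nu>_pos[of i] by (intro mult_right_mono power_mono) auto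
    then have "(\<Sum>i\<in>UNIV. \<Sum>j\<in>UNIV. (S.B i j x)\<^sup>2)
        \<le> ?m\<^sup>2 * (\<Sum>i\<in>UNIV. \<Sum>j\<in>UNIV. (G i j x - (LINT y|\<mu>. G i j y))\<^sup>2)"
      unfolding sum_distrib_left by (intro sum_mono)
    then have "S.defect x \<le> sqrt (?m\<^sup>2 * (\<Sum>i\<in>UNIV. \<Sum>j\<in>UNIV. (G i j x - (LINT y|\<mu>. G i j y))\<^sup>2))"
      unfolding S.defect_def by (rule real_sqrt_le_mono)
    also have "\<dots> = ?m * ?N x" using m0 by (simp add: real_sqrt_mult)
    finally show ?thesis .
  qed
  have iN: "integrable \<mu> ?N"
    by (rule continuous_M_integrable) (intro continuous_intros continuous_G)
  have "\<bar>(LINT x|\<mu>. h (W x)) - (LINT z|gaussian. h z)\<bar> \<le> (LINT x|\<mu>. S.defect x)"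
    by (rule S.lipschitz_bound[OF h])
  also have "\<dots> \<le> (LINT x|\<mu>. ?m * ?N x)"
    by (rule integral_mono[OF S.integrable_defect integrable_mult_right[OF iN] le])
  also have "\<dots> = ?m * (LINT x|\<mu>. ?N x)" by simp
  finally show ?thesis .
qed

end

theorem theorem3p6:
  fixes M :: "'a::t2_space set"
    and A :: "('a, 'n::finite) chart set"
    and g :: "('a, 'n) metric"
    and H :: "'a \<Rightarrow> real"
    and f :: "'k::finite \<Rightarrow> 'a \<Rightarrow> real"
    and \<nu> :: "'k \<Rightarrow> real"
    and P :: "'p measure" and X :: "'p \<Rightarrow> 'a"
    and Q :: "'q measure" and Z :: "'q \<Rightarrow> real^'k"
  defines "\<mu> \<equiv> witten_measure M A g H"
  assumes "M \<noteq> {}" and "compact M" and "connected M"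
    and "smooth_atlas M A" and "riemannian_metric A g"
    and "smooth_on_manifold A H"
    and "\<And>i. Ck_on_manifold 2 A (f i)"
    and "\<And>i p. p \<in> M \<Longrightarrow> witten_laplacian A g H (f i) p = - \<nu> i * f i p"
    and "\<And>i j. (LINT x|\<mu>. f i x * f j x) = (if i = j then 1 else 0)"
    and "\<And>i. (LINT x|\<mu>. f i x) = 0"
    and "prob_space P" and "X \<in> measurable P \<mu>" and "distr P \<mu> X = \<mu>"
    and "prob_space Q" and "std_gaussian_vector Q Z"
  shows "wasserstein_dist P (\<lambda>\<omega>. \<chi> i. f i (X \<omega>)) Q Z \<le>
    ereal ((MAX i. inverse (\<nu> i)) *
      (LINT \<omega>|P. sqrt (\<Sum>i\<in>UNIV. \<Sum>j\<in>UNIV.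
         (grad_inner A g (f i) (f j) (X \<omega>)
            - (LINT \<omega>'|P. grad_inner A g (f i) (f j) (X \<omega>')))\<^sup>2)))"
proof -
  \<comment> \<open>As the law of \<open>X\<close>, the measure \<open>\<mu>\<close> is a probability measure.\<close>
  have "prob_space \<mu>"
    using prob_space.prob_space_distr[OF \<open>prob_space P\<close> \<open>X \<in> measurable P \<mu>\<close>] \<open>distr P \<mu> X = \<mu>\<close> by simp
  interpret E: witten_eigenfunctions M A g H f \<nu>
    by (intro witten_eigenfunctions.intro witten_manifold.intro compact_riemannian_manifold.intro
        witten_manifold_axioms.intro witten_eigenfunctions_axioms.intro)
       (fact assms[unfolded \<mu>_def] | use \<open>prob_space \<mu>\<close> in \<open>simp only: \<mu>_def\<close>)+
  have push: "(LINT \<omega>|P. F (X \<omega>)) = (LINT x|E.\<mu>. F x)" if "F \<in> borel_measurable E.borel_M" for F :: "'a \<Rightarrow> real"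
    using integral_distr[OF \<open>X \<in> measurable P \<mu>\<close>, of F] E.measurable_\<mu>[OF that] \<open>distr P \<mu> X = \<mu>\<close>
    by (simp add: \<mu>_def)
  have Gm: "E.G i j \<in> borel_measurable E.borel_M" for i j
    by (rule E.continuous_on_M_measurable[OF E.continuous_G])
  have EG: "(LINT \<omega>|P. E.G i j (X \<omega>)) = (LINT x|E.\<mu>. E.G i j x)" for i j
    by (rule push[OF Gm])
  show ?thesis
    unfolding wasserstein_dist_def
  proof (rule SUP_least)
    fix h :: "real^'k \<Rightarrow> real" assume "h \<in> {h. 1-lipschitz_on UNIV h}"
    then have h: "1-lipschitz_on UNIV h" by simp
    then have hm: "h \<in> borel_measurable borel"
      by (intro borel_measurable_continuous_onI lipschitz_on_continuous_on)
    have hW: "(LINT \<omega>|P. h (\<chi> i. f i (X \<omega>))) = (LINT x|E.\<mu>. h (E.W x))"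
      by (rule push[of "\<lambda>x. h (E.W x)"]) (rule measurable_compose[OF E.W_measurable hm])
    have hZ: "(LINT \<omega>|Q. h (Z \<omega>)) = (LINT z|gaussian. h z)"
    proof -
      have "Z \<in> measurable Q lborel" "distr Q lborel Z = gaussian"
        using \<open>std_gaussian_vector Q Z\<close> unfolding std_gaussian_vector_def distributed_def gauss_density_def by simp_all
      then show ?thesis using integral_distr[of Z Q lborel h] hm by simp
    qed
    have "(LINT \<omega>|P. sqrt (\<Sum>i\<in>UNIV. \<Sum>j\<in>UNIV. (E.G i j (X \<omega>) - (LINT x|E.\<mu>. E.G i j x))\<^sup>2))
       = (LINT x|E.\<mu>. sqrt (\<Sum>i\<in>UNIV. \<Sum>j\<in>UNIV. (E.G i j x - (LINT x|E.\<mu>. E.G i j x))\<^sup>2))"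
      by (rule push[of "\<lambda>x. sqrt (\<Sum>i\<in>UNIV. \<Sum>j\<in>UNIV. (E.G i j x - (LINT x|E.\<mu>. E.G i j x))\<^sup>2)"])
         (use Gm in measurable)
    then show "ereal \<bar>(LINT \<omega>|P. h (\<chi> i. f i (X \<omega>))) - (LINT \<omega>|Q. h (Z \<omega>))\<bar> \<le>
      ereal ((MAX i. inverse (\<nu> i)) *
        (LINT \<omega>|P. sqrt (\<Sum>i\<in>UNIV. \<Sum>j\<in>UNIV. (E.G i j (X \<omega>) - (LINT \<omega>'|P. E.G i j (X \<omega>')))\<^sup>2)))"
      using E.eigenfunction_normal_approximation[OF h] by (simp only: hW hZ EG ereal_less_eq)
  qed
qed

end
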